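(* Let $n\ge1$, $a_1,\ldots,a_n$ nonnegative integers, $\lambda=\sum a_i\omega_i$. For every symmetric $E\in\mathbf R_p$ one has $x(E)\in\varphi(P_\lambda)$ and $\varphi^{-1}(x(E))$ is a vertex of $P_\lambda$. Moreover, there is a bijection $\Xi:E\mapsto w_C(E)$ from the set of symmetric $E\in\mathbf R_p$ onto the Weyl group $W$ of $\mathfrak{sp}_{2n}$ such that $T_{w_C(E)}=\varphi^{-1}(x(E))$ for every symmetric $E\in\mathbf R_p$.
   Context: $\mathfrak{sp}_{2n}$ has simple roots $\alpha_1,\ldots,\alpha_n$ with $\alpha_n$ long, fundamental weights $\omega_i$; for $k>n$ set $\alpha_k=\alpha_{2n-k}$ and $\alpha_{i,j}=\alpha_i+\ldots+\alpha_{j-1}$. $U=\mathbb R^{n^2}$ has coordinates $x_{i,j}$, $1\le i<j\le 2n+1-i$. A type $C$ Dyck path is a sequence $d=((i_1,j_1),\ldots,(i_N,j_N))$ of such pairs with $j_1-i_1=1$, each $(i_{k+1},j_{k+1})$ equal to $(i_k+1,j_k)$ or $(i_k,j_k+1)$, and $j_N-i_N=1$ or $i_N+j_N=2n+1$; $S(x,d)=\sum_{(i,j)\in d}x_{i,j}$; $M(\lambda,d)=a_{i_1}+\ldots+a_{i_N}$ if $j_N-i_N=1$, else $a_{i_1}+\ldots+a_n$. $P_\lambda=\{x\in U:x\ge0,\ S(x,d)\le M(\lambda,d)\ \forall d\}$, $\Pi_\lambda=P_\lambda\cap\mathbb Z^{n^2}$. For $T\in\Pi_\lambda$ let $\mu_T=\lambda-\sum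 T_{i,j}\alpha_{i,j}$ (weight of the FFLV basis vector $v_T$); for each $w\in W$ there is a unique $T_w\in\Pi_\lambda$ with $\mu_{T_w}=w\lambda$. Let $U_A=\mathbb R^{n(2n-1)}$ with coordinates $x_{i,j}$, $1\le i<j\le 2n$, and $\varphi:U\to U_A$ the map with $\varphi(x)_{i,j}=x_{i,j}$ if $i+j<2n+1$, $2x_{i,j}$ if $i+j=2n+1$, $x_{2n+1-j,2n+1-i}$ if $i+j>2n+1$. Let $\bar\lambda$ be the $\mathfrak{sl}_{2n}$-weight with coordinates $(\bar a_1,\ldots,\bar a_{2n-1})=(a_1,\ldots,a_{n-1},2a_n,a_{n-1},\ldots,a_1)$. A type $A$ Dyck path is a sequence of pairs $1\le i_k<j_k\le 2n$ with the same step rule, starting and ending with $j-i=1$; $M(\bar\lambda,d)=\bar a_{i_1}+\ldots+\bar a_{i_N}$. Let $R$ be the set of segments $[i,j]$, integers $1\le i<j\le 2n$; $\mathbf R_p$ is the set of $E\subset R$ such that the intersection of any two segments of $E$ with nonempty intersection lies in $E$. $E$ is symmetric if $[2n+1-j,2n+1-i]\in E$ implies $[i,j]\in E$. For $i<j$ let $d^{i,j}=((i,i+1),\ldots,(i,j),(i+1,j),\ldots,(j-1,j))$; $x(E)\in U_A$ is the unique point with $x(E)_{i,j}=0$ for $[i,j]\notin E$ and $S(x(E),d^{i,j})=\bar a_i+\ldots+\bar a_{j-1}$ for $[i,j]\in E$. *)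

theory Defs
  imports "HOL-Analysis.Analysis" "HOL-Library.Function_Algebras"
begin

(* Pointwise real vector space structure on functions, so that the library's notion of
   extreme point applies to points given as coordinate functions. *)

instantiation "fun" :: (type, scaleR) scaleR
begin

definition scaleR_fun :: "real \<Rightarrow> ('a \<Rightarrow> 'b) \<Rightarrow> 'a \<Rightarrow> 'b" where
  "scaleR_fun r f = (\<lambda>x. r *\<^sub>R f x)"

instance ..

end

lemma scaleR_fun_apply [simp]: "(r *\<^sub>R f) x = r *\<^sub>R f x"
  by (simp add: scaleR_fun_def)

instance "fun" :: (type, real_vector) real_vector
  by standard (simp_all add: fun_eq_iff scaleR_add_left scaleR_add_right)

section \<open>The root system of type C\<close>

text \<open>
  The weight space is realised in the standard way as the span of an orthonormal basis
  $\varepsilon_1,\dots,\varepsilon_n$: a weight is a function on the indices $1,\dots,n$,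
  extended by zero. The simple roots are $\varepsilon_i-\varepsilon_{i+1}$ for $i<n$
  and $2\varepsilon_n$.
\<close>

type_synonym weight = "nat \<Rightarrow> real"

definition eps :: "nat \<Rightarrow> weight" where
  "eps k = (\<lambda>m. if m = k then 1 else 0)"

definition wt_inner :: "nat \<Rightarrow> weight \<Rightarrow> weight \<Rightarrow> real" where
  "wt_inner n u v = (\<Sum>k=1..n. u k * v k)"

definition simple_root :: "nat \<Rightarrow> nat \<Rightarrow> weight" where
  "simple_root n i = (if i < n then eps i - eps (i + 1) else 2 *\<^sub>R eps n)"

definition fund_weight :: "nat \<Rightarrow> weight" where
  "fund_weight i = (\<Sum>k=1..i. eps k)"

definition coroot_pairing :: "nat \<Rightarrow> weight \<Rightarrow> weight \<Rightarrow> real" where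
  "coroot_pairing n v \<alpha> = 2 * wt_inner n v \<alpha> / wt_inner n \<alpha> \<alpha>"

definition reflection :: "nat \<Rightarrow> weight \<Rightarrow> weight \<Rightarrow> weight" where
  "reflection n \<alpha> v = v - coroot_pairing n v \<alpha> *\<^sub>R \<alpha>"

text \<open>
  Simple reflections are involutions, so closing the identity under composition with them
  gives the group they generate. Its elements act as the identity on coordinates outside
  $1,\dots,n$.
\<close>

inductive_set weyl_group :: "nat \<Rightarrow> (weight \<Rightarrow> weight) set" for n :: nat where
  one: "id \<in> weyl_group n"
| refl: "w \<in> weyl_group n \<Longrightarrow> 1 \<le> i \<Longrightarrow> i \<le> n \<Longrightarrow>
    reflection n (simple_root n i) \<circ> w \<in> weyl_group n"

definition simple_root_ext :: "nat \<Rightarrow> nat \<Rightarrow> weight" where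
  "simple_root_ext n k = simple_root n (if k \<le> n then k else 2 * n - k)"

definition pos_root :: "nat \<Rightarrow> nat \<times> nat \<Rightarrow> weight" where
  "pos_root n = (\<lambda>(i, j). \<Sum>k=i..<j. simple_root_ext n k)"

definition hw :: "nat \<Rightarrow> (nat \<Rightarrow> nat) \<Rightarrow> weight" where
  "hw n a = (\<Sum>i=1..n. real (a i) *\<^sub>R fund_weight i)"

lemma fund_weight_apply: "fund_weight i m = (if 1 \<le> m \<and> m \<le> i then 1 else 0)"
proof -
  have *: "(\<Sum>k\<in>A. eps k) m = (\<Sum>k\<in>A. eps k m)" for A
    by (induction A rule: infinite_finite_induct) auto
  show ?thesis
    unfolding fund_weight_def * by (auto simp: eps_def)
qed

lemma coroot_pairing_fund_weight:
  assumes "1 \<le> i" "i \<le> n" "1 \<le> j" "j \<le> n"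
  shows "coroot_pairing n (fund_weight i) (simple_root n j) = (if i = j then 1 else 0)"
proof (cases "j < n")
  case True
  have *: "wt_inner n u (simple_root n j) = u j - u (j + 1)" for u
  proof -
    have "wt_inner n u (simple_root n j)
        = (\<Sum>k=1..n. (if k = j then u k else 0) - (if k = j + 1 then u k else 0))"
      unfolding wt_inner_def by (rule sum.cong) (auto simp: simple_root_def eps_def True)
    then show ?thesis
      using assms True by (simp add: sum_subtractf)
  qed
  show ?thesis
    using assms True unfolding coroot_pairing_def *
    by (auto simp: fund_weight_apply simple_root_def eps_def)
next
  case False
  have *: "wt_inner n u (simple_root n j) = 2 * u n" for u
  proof -
    have "wt_inner n u (simple_root n j) = (\<Sum>k=1..n. (if k = n then 2 * u k else 0))"
      unfolding wt_inner_def by (rule sum.cong) (auto simp: simple_root_def eps_def False)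
    then show ?thesis
      using assms by simp
  qed
  show ?thesis
    using assms False unfolding coroot_pairing_def *
    by (auto simp: fund_weight_apply simple_root_def eps_def)
qed

section \<open>The type C polytope\<close>

text \<open>
  A point is a function on pairs $(i,j)$ vanishing outside the relevant index set.
\<close>

type_synonym point = "nat \<times> nat \<Rightarrow> real"

definition indexC :: "nat \<Rightarrow> (nat \<times> nat) set" where
  "indexC n = {(i, j). 1 \<le> i \<and> i < j \<and> i + j \<le> 2 * n + 1}"

definition spaceC :: "nat \<Rightarrow> point set" where
  "spaceC n = {x. \<forall>p. p \<notin> indexC n \<longrightarrow> x p = 0}"

definition dyck_step :: "nat \<times> nat \<Rightarrow> nat \<times> nat \<Rightarrow> bool" where
  "dyck_step p q \<longleftrightarrow> q = (fst p + 1, snd p) \<or> q = (fst p, snd p + 1)"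

definition dyck_pathC :: "nat \<Rightarrow> (nat \<times> nat) list \<Rightarrow> bool" where
  "dyck_pathC n d \<longleftrightarrow>
     d \<noteq> [] \<and> set d \<subseteq> indexC n \<and> successively dyck_step d \<and>
     snd (hd d) = fst (hd d) + 1 \<and>
     (snd (last d) = fst (last d) + 1 \<or> fst (last d) + snd (last d) = 2 * n + 1)"

definition path_sum :: "point \<Rightarrow> (nat \<times> nat) list \<Rightarrow> real" where
  "path_sum x d = (\<Sum>p\<in>set d. x p)"

text \<open>
  The bound is a sum over the whole range of indices from $i_1$ to $i_N$ (respectively $n$),
  each index counted once.
\<close>

definition path_boundC :: "nat \<Rightarrow> (nat \<Rightarrow> nat) \<Rightarrow> (nat \<times> nat) list \<Rightarrow> real" where
  "path_boundC n a d =
     (if snd (last d) = fst (last d) + 1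
      then \<Sum>k=fst (hd d)..fst (last d). real (a k)
      else \<Sum>k=fst (hd d)..n. real (a k))"

definition polytopeC :: "nat \<Rightarrow> (nat \<Rightarrow> nat) \<Rightarrow> point set" where
  "polytopeC n a =
     {x \<in> spaceC n. (\<forall>p\<in>indexC n. 0 \<le> x p) \<and>
        (\<forall>d. dyck_pathC n d \<longrightarrow> path_sum x d \<le> path_boundC n a d)}"

definition lattice_pointsC :: "nat \<Rightarrow> (nat \<Rightarrow> nat) \<Rightarrow> point set" where
  "lattice_pointsC n a = {x \<in> polytopeC n a. \<forall>p\<in>indexC n. x p \<in> \<int>}"

definition point_weight :: "nat \<Rightarrow> (nat \<Rightarrow> nat) \<Rightarrow> point \<Rightarrow> weight" where
  "point_weight n a T = hw n a - (\<Sum>p\<in>indexC n. T p *\<^sub>R pos_root n p)"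

definition extremal_point :: "nat \<Rightarrow> (nat \<Rightarrow> nat) \<Rightarrow> (weight \<Rightarrow> weight) \<Rightarrow> point" where
  "extremal_point n a w =
     (THE T. T \<in> lattice_pointsC n a \<and> point_weight n a T = w (hw n a))"

section \<open>Symmetric sets of segments and the associated type A points\<close>

definition indexA :: "nat \<Rightarrow> (nat \<times> nat) set" where
  "indexA n = {(i, j). 1 \<le> i \<and> i < j \<and> j \<le> 2 * n}"

definition spaceA :: "nat \<Rightarrow> point set" where
  "spaceA n = {x. \<forall>p. p \<notin> indexA n \<longrightarrow> x p = 0}"

definition unfold_map :: "nat \<Rightarrow> point \<Rightarrow> point" where
  "unfold_map n x = (\<lambda>(i, j).
     if (i, j) \<in> indexA n then
       if i + j < 2 * n + 1 then x (i, j)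
       else if i + j = 2 * n + 1 then 2 * x (i, j)
       else x (2 * n + 1 - j, 2 * n + 1 - i)
     else 0)"

definition coeffA :: "nat \<Rightarrow> (nat \<Rightarrow> nat) \<Rightarrow> nat \<Rightarrow> nat" where
  "coeffA n a k = (if k < n then a k else if k = n then 2 * a n else a (2 * n - k))"

definition segment :: "nat \<Rightarrow> nat \<Rightarrow> real set" where
  "segment i j = {real i..real j}"

definition segments :: "nat \<Rightarrow> real set set" where
  "segments n = {segment i j |i j. 1 \<le> i \<and> i < j \<and> j \<le> 2 * n}"

text \<open>
  Two segments sharing only an endpoint intersect in a single point, which is nonempty but
  not a member of \<^term>\<open>segments n\<close>, so they cannot both belong to such a family.
\<close>

definition Rp :: "nat \<Rightarrow> real set set set" where
  "Rp n = {E. E \<subseteq> segments n \<and> (\<forall>A\<in>E. \<forall>B\<in>E. A \<inter> B \<noteq> {} \<longrightarrow> A \<inter> B \<in> E)}"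

definition symmetric_family :: "nat \<Rightarrow> real set set \<Rightarrow> bool" where
  "symmetric_family n E \<longleftrightarrow>
     (\<forall>i j. 1 \<le> i \<and> i < j \<and> j \<le> 2 * n \<longrightarrow>
        segment (2 * n + 1 - j) (2 * n + 1 - i) \<in> E \<longrightarrow> segment i j \<in> E)"

definition hook_path :: "nat \<Rightarrow> nat \<Rightarrow> (nat \<times> nat) list" where
  "hook_path i j = map (\<lambda>k. (i, k)) [i + 1..<j + 1] @ map (\<lambda>k. (k, j)) [i + 1..<j]"

definition family_point :: "nat \<Rightarrow> (nat \<Rightarrow> nat) \<Rightarrow> real set set \<Rightarrow> point" where
  "family_point n a E =
     (THE x. x \<in> spaceA n \<and>
        (\<forall>(i, j)\<in>indexA n.
           (segment i j \<notin> E \<longrightarrow> x (i, j) = 0) \<and>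
           (segment i j \<in> E \<longrightarrow>
              path_sum x (hook_path i j) = (\<Sum>k=i..<j. real (coeffA n a k)))))"

end

theory Submission
  imports Defs "HOL-Combinatorics.Permutations"
begin

text \<open>
  Put \<open>N = 2n\<close>. For a permutation \<open>\<sigma>\<close> of \<open>1, \<dots>, N\<close> and each \<open>k\<close>, pair the positions \<open>i \<le> k\<close> with
  \<open>\<sigma> i > k\<close> and the positions \<open>j > k\<close> with \<open>\<sigma> j \<le> k\<close> by the unique matching \<open>M\<^sub>k\<close> consisting of nested
  segments. Adding up the hook inequalities over \<open>M\<^sub>k\<close> shows that a feasible type A point of
  weight \<open>\<sigma>\<inverse>\<lambda>\<close> makes all of them tight and vanishes outside \<open>E(\<sigma>) = \<Union>\<^sub>k M\<^sub>k\<close>; so it is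
  \<open>x(E(\<sigma>))\<close>, which equals \<open>\<Sum>\<^sub>k a\<^sub>k 1\<^bsub>M\<^sub>k\<^esub>\<close>. Taking the weight to be a fundamental one, every segment of
  \<open>E(\<sigma>)\<close> that contains \<open>[k, k + 1]\<close> has an element of \<open>M\<^sub>k\<close> on its hook. This property alone
  forces the union of the matchings to be closed under intersection. Conversely, in a closed
  family one selects such matchings by recursion on the length of the segments, and their
  endpoints form a complete flag of subsets of \<open>1, \<dots>, N\<close>, that is, a permutation. Hence
  \<open>\<sigma> \<mapsto> E(\<sigma>)\<close> is a bijection onto the closed families, and it commutes with the reversal
  \<open>p \<mapsto> N + 1 - p\<close>. The permutations commuting with the reversal form the Weyl group of type C,
  and folding carries the type C inequalities to the hook inequalities.
\<close>

section \<open>The nested matchings of a permutation\<close>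

text \<open>Each matching plays two roles at once. Being nested, it is an antichain, so a Dyck path
  meets it at most once and the sum of indicators weighted by the coefficients is feasible. The same
  nesting makes its hooks cover exactly the cells where the weight equations leave a negative
  coefficient, so it is also a dual certificate, and tightness comes from complementary slackness
  instead of a computation.

  The families and the bijection do not involve \<lambda>, whereas for vanishing coefficients many
  permutations share a weight. Facts about E(\<sigma>) alone are therefore read off from special
  coefficients: a fundamental weight for the meeting property, all ones for injectivity. This is why
  the type A part is stated for arbitrary real coefficients \<open>b\<close>.

  The rigidity argument imposes hook inequalities only; other Dyck paths matter just for placing the
  points in the polytope. So the passage from type C has to express no more than hook sums through
  type C paths.\<close>

definition hook :: "nat \<Rightarrow> nat \<Rightarrow> (nat \<times> nat) set" where
  "hook i j = {(p, q). p < q \<and> (p = i \<and> q \<le> j \<or> q = j \<and> i \<le> p)}"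

definition lrank :: "(nat \<Rightarrow> nat) \<Rightarrow> nat \<Rightarrow> nat \<Rightarrow> nat" where
  "lrank \<sigma> k i = card {p \<in> {1..i}. k < \<sigma> p}"

definition rrank :: "nat \<Rightarrow> (nat \<Rightarrow> nat) \<Rightarrow> nat \<Rightarrow> nat \<Rightarrow> nat" where
  "rrank N \<sigma> k j = card {q \<in> {j..N}. \<sigma> q \<le> k}"

definition cells :: "nat \<Rightarrow> (nat \<times> nat) set" where
  "cells N = {(i, j). 1 \<le> i \<and> i < j \<and> j \<le> N}"

text \<open>Ranks are counted from the outer ends: the r-th opening position from the left is paired
  with the r-th closing position from the right. That the segment straddles \<open>k\<close> is a
  consequence of counting, see \<open>matching_contains\<close>.\<close>

definition matching :: "nat \<Rightarrow> (nat \<Rightarrow> nat) \<Rightarrow> nat \<Rightarrow> (nat \<times> nat) set" where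
  "matching N \<sigma> k =
     {(i, j) \<in> cells N. k < \<sigma> i \<and> \<sigma> j \<le> k \<and> lrank \<sigma> k i = rrank N \<sigma> k j}"

lemma finite_cells [simp]: "finite (cells N)"
  by (rule finite_subset[of _ "{..N} \<times> {..N}"]) (auto simp: cells_def)

lemma finite_hook [simp]: "finite (hook i j)"
  by (rule finite_subset[of _ "{..j} \<times> {..j}"]) (auto simp: hook_def)

lemma hook_subset_cells: "(i, j) \<in> cells N \<Longrightarrow> hook i j \<subseteq> cells N"
  by (auto simp: hook_def cells_def)

lemma matching_subset_cells: "matching N \<sigma> k \<subseteq> cells N"
  by (auto simp: matching_def)

lemma finite_matching [simp]: "finite (matching N \<sigma> k)"
  by (rule finite_subset[OF matching_subset_cells]) simp

lemma lrank_mono: "i \<le> i' \<Longrightarrow> lrank \<sigma> k i \<le> lrank \<sigma> k i'"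
  unfolding lrank_def by (rule card_mono) auto

lemma rrank_antimono: "j \<le> j' \<Longrightarrow> rrank N \<sigma> k j' \<le> rrank N \<sigma> k j"
  unfolding rrank_def by (rule card_mono) auto

lemma lrank_strict: "i < i' \<Longrightarrow> k < \<sigma> i' \<Longrightarrow> lrank \<sigma> k i < lrank \<sigma> k i'"
  unfolding lrank_def by (intro psubset_card_mono psubsetI) (auto simp: set_eq_iff intro!: exI[of _ i'])

lemma rrank_strict:
  "j < j' \<Longrightarrow> j' \<le> N \<Longrightarrow> \<sigma> j \<le> k \<Longrightarrow> rrank N \<sigma> k j' < rrank N \<sigma> k j"
  unfolding rrank_def by (intro psubset_card_mono psubsetI) (auto simp: set_eq_iff intro!: exI[of _ j])

lemma lrank_Suc: "lrank \<sigma> k (Suc i) = lrank \<sigma> k i + (if k < \<sigma> (Suc i) then 1 else 0)"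
proof -
  have "{p \<in> {1..Suc i}. k < \<sigma> p} =
      (if k < \<sigma> (Suc i) then insert (Suc i) {p \<in> {1..i}. k < \<sigma> p} else {p \<in> {1..i}. k < \<sigma> p})"
    by (auto simp: le_Suc_eq)
  then show ?thesis
    by (simp add: lrank_def)
qed

lemma lrank_0 [simp]: "lrank \<sigma> k 0 = 0"
  by (simp add: lrank_def)

lemma rrank_step:
  assumes "j \<le> N"
  shows "rrank N \<sigma> k j = rrank N \<sigma> k (Suc j) + (if \<sigma> j \<le> k then 1 else 0)"
proof -
  have "{q \<in> {j..N}. \<sigma> q \<le> k} =
      (if \<sigma> j \<le> k then insert j {q \<in> {Suc j..N}. \<sigma> q \<le> k} else {q \<in> {Suc j..N}. \<sigma> q \<le> k})"
    using assms by (auto simp: Suc_le_eq dest: le_neq_implies_less)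
  then show ?thesis
    by (simp add: rrank_def)
qed

lemma rrank_above [simp]: "N < j \<Longrightarrow> rrank N \<sigma> k j = 0"
  by (simp add: rrank_def)

lemma lrank_attained:
  "1 \<le> r \<Longrightarrow> r \<le> lrank \<sigma> k i \<Longrightarrow> \<exists>i'. 1 \<le> i' \<and> i' \<le> i \<and> k < \<sigma> i' \<and> lrank \<sigma> k i' = r"
proof (induction i)
  case (Suc i)
  show ?case
  proof (cases "r \<le> lrank \<sigma> k i")
    case True
    then show ?thesis
      using Suc by (metis le_SucI)
  next
    case False
    then have "k < \<sigma> (Suc i)" "lrank \<sigma> k (Suc i) = r"
      using Suc.prems by (auto simp: lrank_Suc split: if_splits)
    then show ?thesis
      by (intro exI[of _ "Suc i"]) auto
  qed
qed simp

lemma rrank_attained: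
  assumes "1 \<le> r" "r \<le> rrank N \<sigma> k j"
  shows "\<exists>j'. j \<le> j' \<and> j' \<le> N \<and> \<sigma> j' \<le> k \<and> rrank N \<sigma> k j' = r"
  using assms
proof (induction "Suc N - j" arbitrary: j)
  case 0
  then show ?case
    by simp
next
  case (Suc d)
  show ?case
  proof (cases "r \<le> rrank N \<sigma> k (Suc j)")
    case True
    then show ?thesis
      using Suc by (metis Suc_diff_Suc Suc_leD diff_Suc_Suc nat.inject zero_less_Suc zero_less_diff)
  next
    case False
    have "j \<le> N"
      using Suc.hyps(2) by simp
    then have "\<sigma> j \<le> k" "rrank N \<sigma> k j = r"
      using Suc.prems False by (auto simp: rrank_step split: if_splits)
    then show ?thesis
      using \<open>j \<le> N\<close> by blast
  qed
qed

lemma lrank_complement: "lrank \<sigma> k i + card {p \<in> {1..i}. \<sigma> p \<le> k} = i"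
proof -
  have "{p \<in> {1..i}. k < \<sigma> p} \<union> {p \<in> {1..i}. \<sigma> p \<le> k} = {1..i}"
    "{p \<in> {1..i}. k < \<sigma> p} \<inter> {p \<in> {1..i}. \<sigma> p \<le> k} = {}"
    by auto
  then show ?thesis
    unfolding lrank_def by (metis (no_types, lifting) card_Un_disjoint card_atLeastAtMost diff_Suc_1 finite_Un finite_atLeastAtMost)
qed

lemma card_sublevel:
  assumes "\<sigma> permutes {1..N}" "k \<le> N"
  shows "card {p \<in> {1..N}. \<sigma> p \<le> k} = k"
proof -
  have "\<sigma> ` {p \<in> {1..N}. \<sigma> p \<le> k} = {1..k}"
  proof (intro equalityI subsetI)
    fix y assume "y \<in> {1..k}"
    then have "y \<in> \<sigma> ` {1..N}"
      using assms permutes_image[OF assms(1)] by auto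
    then show "y \<in> \<sigma> ` {p \<in> {1..N}. \<sigma> p \<le> k}"
      using \<open>y \<in> {1..k}\<close> by auto
  qed (use permutes_image[OF assms(1)] in fastforce)
  moreover have "inj_on \<sigma> {p \<in> {1..N}. \<sigma> p \<le> k}"
    using permutes_inj[OF assms(1)] by (rule inj_on_subset) simp
  ultimately show ?thesis
    by (metis card_atLeastAtMost card_image diff_Suc_1)
qed

lemma rrank_complement:
  assumes "\<sigma> permutes {1..N}" "k \<le> N" "i \<le> N"
  shows "rrank N \<sigma> k (Suc i) + card {p \<in> {1..i}. \<sigma> p \<le> k} = k"
proof -
  have "{q \<in> {Suc i..N}. \<sigma> q \<le> k} \<union> {p \<in> {1..i}. \<sigma> p \<le> k} = {p \<in> {1..N}. \<sigma> p \<le> k}"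
    "{q \<in> {Suc i..N}. \<sigma> q \<le> k} \<inter> {p \<in> {1..i}. \<sigma> p \<le> k} = {}"
    using assms by auto
  then have "rrank N \<sigma> k (Suc i) + card {p \<in> {1..i}. \<sigma> p \<le> k} = card {p \<in> {1..N}. \<sigma> p \<le> k}"
    unfolding rrank_def by (subst card_Un_disjoint[symmetric]) auto
  then show ?thesis
    using card_sublevel[OF assms(1,2)] by simp
qed

lemma permutes_interval_bounds:
  fixes \<sigma> :: "nat \<Rightarrow> nat"
  assumes "\<sigma> permutes {1..N}" "1 \<le> p" "p \<le> N"
  shows "1 \<le> \<sigma> p" "\<sigma> p \<le> N"
  using permutes_in_image[OF assms(1), of p] assms(2,3) by auto

text \<open>Both \<open>i - lrank\<close> and \<open>k - rrank\<close> are the number of positions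
  up to \<open>i\<close> with value at most \<open>k\<close>. Comparing the two ranks at a cut thus
  tells on which side of \<open>k\<close> the cut lies.\<close>

lemma lrank_add_eq_rrank_add:
  assumes "\<sigma> permutes {1..N}" "k \<le> N" "i \<le> N"
  shows "lrank \<sigma> k i + k = rrank N \<sigma> k (Suc i) + i"
  using rrank_complement[OF assms] lrank_complement[of \<sigma> k i] by linarith

lemma matching_less: "(i, j) \<in> matching N \<sigma> k \<Longrightarrow> \<sigma> permutes {1..N} \<Longrightarrow> k < N"
  using permutes_interval_bounds[of \<sigma> N i] by (auto simp: matching_def cells_def)

lemma matching_contains:
  assumes perm: "\<sigma> permutes {1..N}" and ij: "(i, j) \<in> matching N \<sigma> k"
  shows "i \<le> k" "k < j"
proof -
  have b: "1 \<le> i" "i < j" "j \<le> N" "lrank \<sigma> k i = rrank N \<sigma> k j"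
    using ij by (auto simp: matching_def cells_def)
  have kN: "k \<le> N"
    using matching_less[OF ij perm] by simp
  show "i \<le> k"
    using lrank_add_eq_rrank_add[OF perm kN, of i] rrank_antimono[of "Suc i" j N \<sigma> k] b by simp
  show "k < j"
    using lrank_add_eq_rrank_add[OF perm kN, of "j - 1"] lrank_mono[of i "j - 1" \<sigma> k] b
    by (cases j) auto
qed

lemma matching_nested:
  assumes "(i, j) \<in> matching N \<sigma> k" "(i', j') \<in> matching N \<sigma> k"
  shows "i < i' \<longleftrightarrow> j' < j"
proof
  assume "i < i'"
  then have "rrank N \<sigma> k j < rrank N \<sigma> k j'"
    using assms lrank_strict[of i i' k \<sigma>] by (simp add: matching_def)
  then show "j' < j"
    using rrank_antimono[of j j' N \<sigma> k] by linarith
next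
  assume "j' < j"
  then have "lrank \<sigma> k i < lrank \<sigma> k i'"
    using assms rrank_strict[of j' j N \<sigma> k] by (simp add: matching_def cells_def)
  then show "i < i'"
    using lrank_mono[of i' i \<sigma> k] by linarith
qed

text \<open>The position of smaller rank finds its partner at or beyond the other one, so the cell
  is on the hook of that matched segment. Each alternative records the comparison, so that a caller
  who knows it can discard the other alternative.\<close>

lemma matching_covers:
  assumes "1 \<le> i" "i < j" "j \<le> N" "k < \<sigma> i" "\<sigma> j \<le> k"
  obtains j' where "j \<le> j'" "(i, j') \<in> matching N \<sigma> k" "lrank \<sigma> k i \<le> rrank N \<sigma> k j"
  | i' where "i' \<le> i" "(i', j) \<in> matching N \<sigma> k" "rrank N \<sigma> k j \<le> lrank \<sigma> k i"
proof (cases "lrank \<sigma> k i \<le> rrank N \<sigma> k j")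
  case True
  have "1 \<le> lrank \<sigma> k i"
    using lrank_strict[of 0 i k \<sigma>] assms by simp
  from rrank_attained[OF this True] obtain j' where
    "j \<le> j'" "j' \<le> N" "\<sigma> j' \<le> k" "rrank N \<sigma> k j' = lrank \<sigma> k i"
    by blast
  then show ?thesis
    using assms True by (intro that(1)[of j']) (auto simp: matching_def cells_def)
next
  case False
  have "1 \<le> rrank N \<sigma> k j"
    using rrank_step[of j N \<sigma> k] assms by simp
  from lrank_attained[OF this, of \<sigma> k i] False obtain i' where
    "1 \<le> i'" "i' \<le> i" "k < \<sigma> i'" "lrank \<sigma> k i' = rrank N \<sigma> k j"
    by auto
  then show ?thesis
    using assms False by (intro that(2)[of i']) (auto simp: matching_def cells_def)
qed

lemma mem_fst_matching:
  assumes perm: "\<sigma> permutes {1..N}" and p: "1 \<le> p" "p \<le> N"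
  shows "p \<in> fst ` matching N \<sigma> k \<longleftrightarrow> p \<le> k \<and> k < \<sigma> p"
proof
  assume "p \<in> fst ` matching N \<sigma> k"
  then obtain j where "(p, j) \<in> matching N \<sigma> k"
    by auto
  then show "p \<le> k \<and> k < \<sigma> p"
    using matching_contains(1)[OF perm, of p j k] by (simp add: matching_def)
next
  assume a: "p \<le> k \<and> k < \<sigma> p"
  then have kN: "k \<le> N"
    using permutes_interval_bounds[OF perm p] by simp
  have "lrank \<sigma> k p \<le> rrank N \<sigma> k (Suc p)"
    using lrank_add_eq_rrank_add[OF perm kN p(2)] a by simp
  moreover have "1 \<le> lrank \<sigma> k p"
    using lrank_strict[of 0 p k \<sigma>] a p by simp
  ultimately obtain j' where "Suc p \<le> j'" "j' \<le> N" "\<sigma> j' \<le> k" "rrank N \<sigma> k j' = lrank \<sigma> k p"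
    using rrank_attained by blast
  then have "(p, j') \<in> matching N \<sigma> k"
    using a p by (auto simp: matching_def cells_def)
  then show "p \<in> fst ` matching N \<sigma> k"
    by force
qed

lemma mem_snd_matching:
  assumes perm: "\<sigma> permutes {1..N}" and p: "1 \<le> p" "p \<le> N"
  shows "p \<in> snd ` matching N \<sigma> k \<longleftrightarrow> k < p \<and> \<sigma> p \<le> k"
proof
  assume "p \<in> snd ` matching N \<sigma> k"
  then obtain i where "(i, p) \<in> matching N \<sigma> k"
    by auto
  then show "k < p \<and> \<sigma> p \<le> k"
    using matching_contains(2)[OF perm, of i p k] by (simp add: matching_def)
next
  assume a: "k < p \<and> \<sigma> p \<le> k"
  then have kN: "k \<le> N"
    using p by simp
  have "rrank N \<sigma> k p \<le> lrank \<sigma> k (p - 1)"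
    using lrank_add_eq_rrank_add[OF perm kN, of "p - 1"] a p by (cases p) auto
  moreover have "1 \<le> rrank N \<sigma> k p"
    using rrank_step[of p N \<sigma> k] a p by simp
  ultimately obtain i' where "1 \<le> i'" "i' \<le> p - 1" "k < \<sigma> i'" "lrank \<sigma> k i' = rrank N \<sigma> k p"
    using lrank_attained by blast
  then have "(i', p) \<in> matching N \<sigma> k"
    using a p by (auto simp: matching_def cells_def)
  then show "p \<in> snd ` matching N \<sigma> k"
    by force
qed

lemma inj_on_fst_matching: "inj_on fst (matching N \<sigma> k)"
proof (rule inj_onI)
  fix c d assume *: "c \<in> matching N \<sigma> k" "d \<in> matching N \<sigma> k" "fst c = fst d"
  then show "c = d"
    using matching_nested[of "fst c" "snd c" N \<sigma> k "fst d" "snd d"]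
      matching_nested[of "fst d" "snd d" N \<sigma> k "fst c" "snd c"]
    by (cases c; cases d) auto
qed

lemma inj_on_snd_matching: "inj_on snd (matching N \<sigma> k)"
proof (rule inj_onI)
  fix c d assume *: "c \<in> matching N \<sigma> k" "d \<in> matching N \<sigma> k" "snd c = snd d"
  then show "c = d"
    using matching_nested[of "fst c" "snd c" N \<sigma> k "fst d" "snd d"]
      matching_nested[of "fst d" "snd d" N \<sigma> k "fst c" "snd c"]
    by (cases c; cases d) auto
qed

text \<open>Raising the level changes the status of the single position with value
  \<open>Suc k\<close>. Since \<open>i < j\<close>, this lowers the left rank or raises the right
  rank, but not both.\<close>

lemma rank_diff_step:
  assumes perm: "\<sigma> permutes {1..N}" and k: "k < N" and ij: "i < j" "j \<le> N"
    and "rrank N \<sigma> k j < lrank \<sigma> k i"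
  shows "rrank N \<sigma> (Suc k) j \<le> lrank \<sigma> (Suc k) i"
proof -
  obtain p where p: "\<sigma> p = Suc k" "p \<in> {1..N}"
    using permutes_image[OF perm] k by (metis Suc_leI atLeastAtMost_iff imageE le_add1 plus_1_eq_Suc)
  have uniq: "\<sigma> q = Suc k \<longleftrightarrow> q = p" for q
    using p permutes_inj[OF perm] by (metis injD)
  have "k < \<sigma> q \<longleftrightarrow> Suc k < \<sigma> q \<or> q = p" for q
    using uniq[of q] by linarith
  then have "{q \<in> {1..i}. k < \<sigma> q} = {q \<in> {1..i}. Suc k < \<sigma> q} \<union> {1..i} \<inter> {p}"
    by blast
  then have l: "lrank \<sigma> k i \<le> lrank \<sigma> (Suc k) i + card ({1..i} \<inter> {p})"
    unfolding lrank_def by (metis card_Un_le)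
  have "\<sigma> q \<le> Suc k \<longleftrightarrow> \<sigma> q \<le> k \<or> q = p" for q
    using uniq[of q] by linarith
  then have "{q \<in> {j..N}. \<sigma> q \<le> Suc k} = {q \<in> {j..N}. \<sigma> q \<le> k} \<union> {j..N} \<inter> {p}"
    by blast
  then have r: "rrank N \<sigma> (Suc k) j \<le> rrank N \<sigma> k j + card ({j..N} \<inter> {p})"
    unfolding rrank_def by (metis card_Un_le)
  have "card ({1..i} \<inter> {p}) = (if p \<in> {1..i} then 1 else 0)"
    "card ({j..N} \<inter> {p}) = (if p \<in> {j..N} then 1 else 0)"
    by auto
  then have "card ({1..i} \<inter> {p}) + card ({j..N} \<inter> {p}) \<le> 1"
    using ij by simp
  then show ?thesis
    using l r assms(5) by linarith
qed

section \<open>Feasible points of extremal weight\<close>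

text \<open>The m-th coordinate of the weight with coefficients \<open>b\<close>. Correspondingly
  \<open>net_flow\<close> is the p-th coordinate of the sum of the roots
  \<open>eps i - eps j\<close> with multiplicities \<open>x (i, j)\<close>.\<close>

definition tail_sum :: "nat \<Rightarrow> (nat \<Rightarrow> real) \<Rightarrow> nat \<Rightarrow> real" where
  "tail_sum N b m = sum b {m..<N}"

definition net_flow :: "nat \<Rightarrow> point \<Rightarrow> nat \<Rightarrow> real" where
  "net_flow N x p = (\<Sum>q\<in>{p<..N}. x (p, q)) - (\<Sum>q\<in>{1..<p}. x (q, p))"

definition feasible :: "nat \<Rightarrow> (nat \<Rightarrow> real) \<Rightarrow> point \<Rightarrow> bool" where
  "feasible N b x \<longleftrightarrow>
     (\<forall>c. c \<notin> cells N \<longrightarrow> x c = 0) \<and> (\<forall>c. 0 \<le> x c) \<and>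
     (\<forall>(i, j)\<in>cells N. sum x (hook i j) \<le> sum b {i..<j})"

definition hook_point :: "(nat \<Rightarrow> real) \<Rightarrow> (nat \<times> nat) set \<Rightarrow> point \<Rightarrow> bool" where
  "hook_point b F x \<longleftrightarrow>
     (\<forall>c. c \<notin> F \<longrightarrow> x c = 0) \<and> (\<forall>(i, j)\<in>F. sum x (hook i j) = sum b {i..<j})"

definition perm_cells :: "nat \<Rightarrow> (nat \<Rightarrow> nat) \<Rightarrow> (nat \<times> nat) set" where
  "perm_cells N \<sigma> = (\<Union>k. matching N \<sigma> k)"

lemma perm_cells_subset: "perm_cells N \<sigma> \<subseteq> cells N"
  using matching_subset_cells by (auto simp: perm_cells_def)

text \<open>The system is triangular with respect to length: apart from \<open>(i, j)\<close> its
  hook contains only strictly shorter cells.\<close>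

lemma hook_point_unique:
  assumes F: "F \<subseteq> cells N" and x: "hook_point b F x" and y: "hook_point b F y"
  shows "x = y"
proof -
  have "x (i, j) = y (i, j)" for i j
  proof (induction "j - i" arbitrary: i j rule: less_induct)
    case less
    show ?case
    proof (cases "(i, j) \<in> F")
      case True
      then have ij: "i < j" "(i, j) \<in> hook i j"
        using F by (auto simp: cells_def hook_def)
      have "x c = y c" if "c \<in> hook i j - {(i, j)}" for c
        using that less[of "snd c" "fst c"] by (cases c) (auto simp: hook_def)
      then have "sum x (hook i j - {(i, j)}) = sum y (hook i j - {(i, j)})"
        by (rule sum.cong[OF HOL.refl])
      moreover have "sum x (hook i j) = sum y (hook i j)"
        using x y True unfolding hook_point_def by fastforce
      ultimately show ?thesis
        using ij(2) by (simp add: sum.remove)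
    next
      case False
      then show ?thesis
        using x y by (simp add: hook_point_def)
    qed
  qed
  then show ?thesis
    by auto
qed

lemma sum_net_flow:
  "(\<Sum>p\<in>{1..N}. f p * net_flow N x p) = (\<Sum>c\<in>cells N. x c * (f (fst c) - f (snd c)))"
proof -
  have "(\<Sum>p\<in>{1..N}. \<Sum>q\<in>{p<..N}. f p * x (p, q)) = (\<Sum>c\<in>cells N. f (fst c) * x c)"
    by (subst sum.Sigma) (auto simp: cells_def split_def intro!: sum.cong)
  moreover have "(\<Sum>p\<in>{1..N}. \<Sum>q\<in>{1..<p}. f p * x (q, p)) = (\<Sum>c\<in>cells N. f (snd c) * x c)"
    by (subst sum.Sigma, simp, simp, rule sum.reindex_bij_witness[of _ prod.swap prod.swap])
      (auto simp: cells_def)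
  ultimately show ?thesis
    by (simp add: net_flow_def right_diff_distrib sum_subtractf sum_distrib_left mult.commute)
qed

text \<open>Positions with both \<open>p \<le> k\<close> and \<open>\<sigma> p \<le> k\<close> are
  endpoints of nothing and cancel between the indicators. The sum depends on the sets of endpoints,
  not on the pairing.\<close>

lemma sum_matching_endpoints:
  fixes f :: "nat \<Rightarrow> real"
  assumes perm: "\<sigma> permutes {1..N}"
  shows "(\<Sum>c\<in>matching N \<sigma> k. f (fst c) - f (snd c))
      = (\<Sum>p\<in>{1..N}. f p * (of_bool (p \<le> k) - of_bool (\<sigma> p \<le> k)))"
proof -
  have "fst ` matching N \<sigma> k \<subseteq> {1..N}" "snd ` matching N \<sigma> k \<subseteq> {1..N}"
    using matching_subset_cells[of N \<sigma> k] by (auto simp: cells_def)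
  then have eq: "fst ` matching N \<sigma> k = {p \<in> {1..N}. p \<in> fst ` matching N \<sigma> k}"
    "snd ` matching N \<sigma> k = {p \<in> {1..N}. p \<in> snd ` matching N \<sigma> k}"
    by blast+
  have sets1: "{p \<in> {1..N}. p \<in> fst ` matching N \<sigma> k} = {p \<in> {1..N}. p \<le> k \<and> k < \<sigma> p}"
    using mem_fst_matching[OF perm] by (intro Collect_cong conj_cong) simp_all
  have sets2: "{p \<in> {1..N}. p \<in> snd ` matching N \<sigma> k} = {p \<in> {1..N}. k < p \<and> \<sigma> p \<le> k}"
    using mem_snd_matching[OF perm] by (intro Collect_cong conj_cong) simp_all
  note sets = trans[OF eq(1) sets1] trans[OF eq(2) sets2]
  have "(\<Sum>c\<in>matching N \<sigma> k. f (fst c)) = (\<Sum>p\<in>fst ` matching N \<sigma> k. f p)"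
    by (simp add: sum.reindex[OF inj_on_fst_matching])
  also have "\<dots> = (\<Sum>p\<in>{1..N}. f p * of_bool (p \<le> k \<and> k < \<sigma> p))"
    unfolding sets by (subst sum.inter_filter, simp, rule sum.cong) simp_all
  finally have l: "(\<Sum>c\<in>matching N \<sigma> k. f (fst c)) = \<dots>" .
  have "(\<Sum>c\<in>matching N \<sigma> k. f (snd c)) = (\<Sum>p\<in>snd ` matching N \<sigma> k. f p)"
    by (simp add: sum.reindex[OF inj_on_snd_matching])
  also have "\<dots> = (\<Sum>p\<in>{1..N}. f p * of_bool (k < p \<and> \<sigma> p \<le> k))"
    unfolding sets by (subst sum.inter_filter, simp, rule sum.cong) simp_all
  finally have r: "(\<Sum>c\<in>matching N \<sigma> k. f (snd c)) = \<dots>" .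
  have "(\<Sum>p\<in>{1..N}. f p * of_bool (p \<le> k \<and> k < \<sigma> p)) -
      (\<Sum>p\<in>{1..N}. f p * of_bool (k < p \<and> \<sigma> p \<le> k))
    = (\<Sum>p\<in>{1..N}. f p * (of_bool (p \<le> k) - of_bool (\<sigma> p \<le> k)))"
    unfolding sum_subtractf[symmetric] by (rule sum.cong) simp_all
  then show ?thesis
    by (simp only: sum_subtractf l r)
qed

lemma sum_eq_tail_sum_diff: "i \<le> j \<Longrightarrow> j \<le> N \<Longrightarrow> sum b {i..<j} = tail_sum N b i - tail_sum N b j"
  using sum.atLeastLessThan_concat[of i j N b] by (simp add: tail_sum_def)

text \<open>
  Summing the weight equations over the positions \<open>p\<close> with \<open>\<sigma> p \<le> k\<close> expresses the sum of the
  right-hand sides of the hook inequalities over \<open>matching N \<sigma> k\<close> through \<open>x\<close>. Since these hooks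
  cover every cell \<open>(p, q)\<close> with \<open>\<sigma> q \<le> k < \<sigma> p\<close>, the total defect of the inequalities plus a
  nonnegative combination of coordinates is zero.
\<close>

lemma matching_complementary_slackness:
  assumes perm: "\<sigma> permutes {1..N}" and x: "feasible N b x"
    and wt: "\<forall>p\<in>{1..N}. net_flow N x p = tail_sum N b p - tail_sum N b (\<sigma> p)"
  shows "(i, j) \<in> matching N \<sigma> k \<Longrightarrow> sum x (hook i j) = sum b {i..<j}"
    and "(i, j) \<in> matching N \<sigma> k \<Longrightarrow> (p, q) \<in> hook i j \<Longrightarrow> k < \<sigma> p \<longleftrightarrow> k < \<sigma> q \<Longrightarrow> x (p, q) = 0"
    and "(p, q) \<in> cells N \<Longrightarrow> \<sigma> p \<le> k \<Longrightarrow> k < \<sigma> q \<Longrightarrow> x (p, q) = 0"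
proof -
  let ?M = "matching N \<sigma> k"
  let ?L = "tail_sum N b"
  define I :: "nat \<Rightarrow> real" where "I p = of_bool (\<sigma> p \<le> k)" for p
  define h where "h c = (\<Sum>m\<in>?M. of_bool (c \<in> hook (fst m) (snd m)) :: real)" for c
  define e where "e c = h c + (I (fst c) - I (snd c))" for c
  define \<delta> where "\<delta> m = sum b {fst m..<snd m} - sum x (hook (fst m) (snd m))" for m
  have h_ge: "1 \<le> h c" if "m \<in> ?M" "c \<in> hook (fst m) (snd m)" for c m
    using member_le_sum[of m ?M "\<lambda>m. of_bool (c \<in> hook (fst m) (snd m)) :: real"] that
    by (simp add: h_def)
  have h_nonneg: "0 \<le> h c" for c
    by (auto simp: h_def intro: sum_nonneg)
  have e_nonneg: "0 \<le> e c" if c: "c \<in> cells N" for c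
  proof (cases "k < \<sigma> (fst c) \<and> \<sigma> (snd c) \<le> k")
    case True
    obtain m where "m \<in> ?M" "c \<in> hook (fst m) (snd m)"
    proof (rule matching_covers[of "fst c" "snd c" N k \<sigma>])
      fix j' assume "snd c \<le> j'" "(fst c, j') \<in> ?M"
      then show thesis
        using c by (intro that[of "(fst c, j')"]) (auto simp: hook_def cells_def)
    next
      fix i' assume "i' \<le> fst c" "(i', snd c) \<in> ?M"
      then show thesis
        using c by (intro that[of "(i', snd c)"]) (auto simp: hook_def cells_def)
    qed (use c True in \<open>auto simp: cells_def\<close>)
    then show ?thesis
      using h_ge[of m c] by (auto simp: e_def I_def)
  next
    case False
    then show ?thesis
      using h_nonneg[of c] by (auto simp: e_def I_def)
  qed
  have \<delta>_nonneg: "0 \<le> \<delta> m" if "m \<in> ?M" for m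
    using that x subsetD[OF matching_subset_cells that]
    by (cases m) (auto simp: feasible_def \<delta>_def)
  have hooks: "(\<Sum>m\<in>?M. sum x (hook (fst m) (snd m))) = (\<Sum>c\<in>cells N. x c * h c)"
  proof -
    have "sum x (hook (fst m) (snd m)) = (\<Sum>c\<in>cells N. x c * of_bool (c \<in> hook (fst m) (snd m)))"
      if "m \<in> ?M" for m
      using that hook_subset_cells[of "fst m" "snd m" N] matching_subset_cells[of N \<sigma> k]
      by (intro sum.mono_neutral_cong_left) auto
    then have "(\<Sum>m\<in>?M. sum x (hook (fst m) (snd m))) =
        (\<Sum>m\<in>?M. \<Sum>c\<in>cells N. x c * of_bool (c \<in> hook (fst m) (snd m)))"
      by simp
    also have "\<dots> = (\<Sum>c\<in>cells N. \<Sum>m\<in>?M. x c * of_bool (c \<in> hook (fst m) (snd m)))"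
      by (rule sum.swap)
    finally show ?thesis
      unfolding h_def sum_distrib_left .
  qed
  have flow: "(\<Sum>c\<in>cells N. x c * (I (fst c) - I (snd c)))
      = (\<Sum>p\<in>{1..N}. ?L p * (I p - of_bool (p \<le> k)))"
  proof -
    \<comment> \<open>Reindexing by \<sigma> turns the condition on values into one on indices; this
      is the only place where the extremal form of the weight enters.\<close>
    have "(\<Sum>p\<in>{1..N}. I p * ?L (\<sigma> p)) = (\<Sum>p\<in>{1..N}. of_bool (p \<le> k) * ?L p)"
      using sum.permute[OF perm, of "\<lambda>p. of_bool (p \<le> k) * ?L p"] by (simp add: I_def o_def)
    moreover have "(\<Sum>p\<in>{1..N}. I p * net_flow N x p) = (\<Sum>p\<in>{1..N}. I p * (?L p - ?L (\<sigma> p)))"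
      by (rule sum.cong) (simp_all add: wt)
    ultimately show ?thesis
      unfolding sum_net_flow[symmetric] by (simp add: algebra_simps sum_subtractf)
  qed
  have bounds: "(\<Sum>m\<in>?M. sum b {fst m..<snd m}) = (\<Sum>p\<in>{1..N}. ?L p * (of_bool (p \<le> k) - I p))"
  proof -
    have "sum b {fst m..<snd m} = ?L (fst m) - ?L (snd m)" if "m \<in> ?M" for m
      using that matching_subset_cells[of N \<sigma> k]
      by (intro sum_eq_tail_sum_diff) (auto simp: cells_def)
    then show ?thesis
      using sum_matching_endpoints[OF perm, of ?L k] by (simp add: I_def)
  qed
  \<comment> \<open>The right-hand sides of \<open>flow\<close> and \<open>bounds\<close> are
    opposite.\<close>
  have "(\<Sum>c\<in>cells N. x c * e c) + sum \<delta> ?M = 0"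
    using flow unfolding e_def \<delta>_def sum_subtractf distrib_left sum.distrib hooks bounds
    by (simp add: algebra_simps sum_subtractf)
  moreover have "0 \<le> (\<Sum>c\<in>cells N. x c * e c)" "0 \<le> sum \<delta> ?M"
    using x e_nonneg \<delta>_nonneg by (auto intro!: sum_nonneg simp: feasible_def)
  ultimately have z: "(\<Sum>c\<in>cells N. x c * e c) = 0" "sum \<delta> ?M = 0"
    by linarith+
  have xe: "x c * e c = 0" if "c \<in> cells N" for c
    using z(1) that x e_nonneg
    by (subst (asm) sum_nonneg_eq_0_iff) (auto simp: feasible_def)
  have \<delta>0: "\<delta> m = 0" if "m \<in> ?M" for m
    using z(2) that \<delta>_nonneg by (subst (asm) sum_nonneg_eq_0_iff) auto
  show "sum x (hook i j) = sum b {i..<j}" if "(i, j) \<in> ?M"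
    using \<delta>0[OF that] by (simp add: \<delta>_def)
  show "x (p, q) = 0" if "(i, j) \<in> ?M" "(p, q) \<in> hook i j" "k < \<sigma> p \<longleftrightarrow> k < \<sigma> q"
  proof -
    have "(p, q) \<in> cells N"
      using that hook_subset_cells matching_subset_cells by blast
    \<comment> \<open>With both values on the same side of \<open>k\<close> the indicators cancel,
      so one covering hook makes the coefficient positive.\<close>
    moreover have "0 < e (p, q)"
      using h_ge[OF that(1), of "(p, q)"] that(2,3) by (auto simp: e_def I_def not_less)
    ultimately show ?thesis
      using xe[of "(p, q)"] by simp
  qed
  show "x (p, q) = 0" if "(p, q) \<in> cells N" "\<sigma> p \<le> k" "k < \<sigma> q"
    using xe[OF that(1)] h_nonneg[of "(p, q)"] that(2,3) by (auto simp: e_def I_def)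
qed

text \<open>
  If \<open>\<sigma> j < \<sigma> i\<close>, the difference of the two ranks drops by at most one as \<open>k\<close> runs from \<open>\<sigma> j\<close> to
  \<open>\<sigma> i\<close>. So either it vanishes for some \<open>k\<close>, or its sign is constant, and then \<open>(i, j)\<close> lies on a
  hook of the matching next to one of the two ends of this range.
\<close>

lemma feasible_extremal_support:
  assumes perm: "\<sigma> permutes {1..N}" and x: "feasible N b x"
    and wt: "\<forall>p\<in>{1..N}. net_flow N x p = tail_sum N b p - tail_sum N b (\<sigma> p)"
    and ij: "(i, j) \<in> cells N" "(i, j) \<notin> perm_cells N \<sigma>"
  shows "x (i, j) = 0"
proof -
  note slack = matching_complementary_slackness[OF perm x wt]
  have b: "1 \<le> i" "i < j" "j \<le> N"
    using ij(1) by (auto simp: cells_def)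
  have \<sigma>i: "\<sigma> i \<le> N" and \<sigma>j: "1 \<le> \<sigma> j"
    using permutes_interval_bounds[OF perm] b by auto
  have ne: "\<sigma> i \<noteq> \<sigma> j"
    using permutes_inj[OF perm] b by (auto dest: injD)
  have nm: "lrank \<sigma> k i \<noteq> rrank N \<sigma> k j" if "k < \<sigma> i" "\<sigma> j \<le> k" for k
    using ij that by (auto simp: perm_cells_def matching_def)
  consider "\<sigma> i < \<sigma> j" | "\<sigma> j < \<sigma> i" "lrank \<sigma> (\<sigma> j) i < rrank N \<sigma> (\<sigma> j) j"
    | "\<sigma> j < \<sigma> i" "rrank N \<sigma> (\<sigma> j) j < lrank \<sigma> (\<sigma> j) i"
    using ne nm[of "\<sigma> j"] by linarith
  then show ?thesis
  proof cases
    case 1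
    then show ?thesis
      using slack(3)[OF ij(1), of "\<sigma> i"] by simp
  next
    case 2
    obtain j' where j': "j \<le> j'" "(i, j') \<in> matching N \<sigma> (\<sigma> j)"
      using matching_covers[of i j N "\<sigma> j" \<sigma>] b 2 by (metis order.refl not_less)
    have "j' \<noteq> j"
      using 2 j'(2) by (auto simp: matching_def)
    then have jj: "j < j'"
      using j' by simp
    \<comment> \<open>One level lower only position \<open>j\<close> changes status, and it lies
      strictly between \<open>i\<close> and \<open>j'\<close>, so \<open>(i, j')\<close> stays
      matched. Now both ends of \<open>(i, j)\<close> have values above the level, as the second
      slackness statement requires.\<close>
    let ?k = "\<sigma> j - 1"
    have inj: "\<sigma> q = \<sigma> j \<longleftrightarrow> q = j" for q
      using permutes_inj[OF perm] by (auto dest: injD)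
    have q1: "\<sigma> q \<le> ?k \<longleftrightarrow> \<sigma> q \<le> \<sigma> j \<and> q \<noteq> j" for q
      using inj[of q] \<sigma>j by linarith
    then have q2: "?k < \<sigma> q \<longleftrightarrow> \<sigma> j < \<sigma> q \<or> q = j" for q
      using inj[of q] \<sigma>j by linarith
    have "lrank \<sigma> ?k i = lrank \<sigma> (\<sigma> j) i"
      unfolding lrank_def q2 using b by (intro arg_cong[of _ _ card]) auto
    moreover have "rrank N \<sigma> ?k j' = rrank N \<sigma> (\<sigma> j) j'"
      unfolding rrank_def q1 using jj by (intro arg_cong[of _ _ card]) auto
    ultimately have "(i, j') \<in> matching N \<sigma> ?k"
      using j'(2) jj q1[of j'] by (auto simp: matching_def)
    moreover have "(i, j) \<in> hook i j'"
      using b jj by (simp add: hook_def)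
    moreover have "?k < \<sigma> i" "?k < \<sigma> j"
      using 2 \<sigma>j by auto
    ultimately show ?thesis
      using slack(2) by blast
  next
    case 3
    have pos: "rrank N \<sigma> k j < lrank \<sigma> k i" if "\<sigma> j \<le> k" "k < \<sigma> i" for k
      using that
    proof (induction k rule: dec_induct)
      case base
      then show ?case
        using 3 by simp
    next
      case (step k)
      then have "rrank N \<sigma> (Suc k) j \<le> lrank \<sigma> (Suc k) i"
        using rank_diff_step[OF perm _ b(2,3), of k] \<sigma>i by simp
      then show ?case
        using nm[of "Suc k"] step by simp
    qed
    \<comment> \<open>The mirror image at the top of the range: passing from this level to
      \<open>\<sigma> i\<close> changes only position \<open>i\<close>, which lies strictly between
      \<open>i'\<close> and \<open>j\<close>.\<close>
    let ?k = "\<sigma> i - 1"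
    have k: "\<sigma> j \<le> ?k" "?k < \<sigma> i"
      using 3 by auto
    obtain i' where i': "i' \<le> i" "(i', j) \<in> matching N \<sigma> ?k"
      using matching_covers[of i j N ?k \<sigma>] b k pos[OF k] by (metis not_less)
    have "i' \<noteq> i"
      using pos[OF k] i'(2) by (auto simp: matching_def)
    then have ii: "i' < i"
      using i' by simp
    have inj: "\<sigma> q = \<sigma> i \<longleftrightarrow> q = i" for q
      using permutes_inj[OF perm] by (auto dest: injD)
    have q1: "\<sigma> q \<le> \<sigma> i \<longleftrightarrow> \<sigma> q \<le> ?k \<or> q = i" for q
      using inj[of q] k by linarith
    then have q2: "\<sigma> i < \<sigma> q \<longleftrightarrow> ?k < \<sigma> q \<and> q \<noteq> i" for q
      using inj[of q] k by linarith
    have "lrank \<sigma> (\<sigma> i) i' = lrank \<sigma> ?k i'"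
      unfolding lrank_def q2 using ii by (intro arg_cong[of _ _ card]) auto
    moreover have "rrank N \<sigma> (\<sigma> i) j = rrank N \<sigma> ?k j"
      unfolding rrank_def q1 using b by (intro arg_cong[of _ _ card]) auto
    ultimately have "(i', j) \<in> matching N \<sigma> (\<sigma> i)"
      using i'(2) ii q2[of i'] by (auto simp: matching_def)
    moreover have "(i, j) \<in> hook i' j"
      using b ii by (simp add: hook_def)
    moreover have "\<not> \<sigma> i < \<sigma> i" "\<not> \<sigma> i < \<sigma> j"
      using 3 by auto
    ultimately show ?thesis
      using slack(2) by blast
  qed
qed

lemma feasible_extremal_hook_point:
  assumes perm: "\<sigma> permutes {1..N}" and x: "feasible N b x"
    and wt: "\<forall>p\<in>{1..N}. net_flow N x p = tail_sum N b p - tail_sum N b (\<sigma> p)"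
  shows "hook_point b (perm_cells N \<sigma>) x"
  unfolding hook_point_def
proof (intro conjI allI impI)
  fix c assume "c \<notin> perm_cells N \<sigma>"
  then show "x c = 0"
    using feasible_extremal_support[OF perm x wt, of "fst c" "snd c"] x
    by (cases c; cases "c \<in> cells N") (simp_all add: feasible_def)
next
  show "\<forall>(i, j)\<in>perm_cells N \<sigma>. sum x (hook i j) = sum b {i..<j}"
    using matching_complementary_slackness(1)[OF perm x wt] by (auto simp: perm_cells_def)
qed

section \<open>The extremal point of a permutation\<close>

definition matching_point :: "nat \<Rightarrow> (nat \<Rightarrow> real) \<Rightarrow> (nat \<Rightarrow> nat) \<Rightarrow> point" where
  "matching_point N b \<sigma> c = (\<Sum>k\<in>{1..<N}. b k * of_bool (c \<in> matching N \<sigma> k))"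

lemma matching_point_nonneg: "(\<And>k. 0 \<le> b k) \<Longrightarrow> 0 \<le> matching_point N b \<sigma> c"
  by (auto simp: matching_point_def intro!: sum_nonneg)

lemma matching_point_outside: "c \<notin> cells N \<Longrightarrow> matching_point N b \<sigma> c = 0"
  using matching_subset_cells by (auto simp: matching_point_def intro!: sum.neutral)

text \<open>A chain meets the antichain \<open>matching N \<sigma> k\<close> at most once, and then
  \<open>k\<close> lies between \<open>l\<close> and \<open>r\<close>. The form with an arbitrary
  chain serves hooks, type C Dyck paths and the unions of such paths with their reversals.\<close>

lemma sum_matching_point_chain_le:
  assumes perm: "\<sigma> permutes {1..N}" and b: "\<And>k. 0 \<le> b k" and S: "finite S"
    and sub: "\<And>i j. (i, j) \<in> S \<Longrightarrow> l \<le> i \<and> j \<le> r"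
    and chain: "\<And>i j i' j'. (i, j) \<in> S \<Longrightarrow> (i', j') \<in> S \<Longrightarrow> i < i' \<Longrightarrow> j \<le> j'"
  shows "sum (matching_point N b \<sigma>) S \<le> sum b {l..<r}"
proof -
  have card: "(\<Sum>c\<in>S. of_bool (c \<in> matching N \<sigma> k)) \<le> (of_bool (k \<in> {l..<r}) :: real)" for k
  proof (cases "S \<inter> matching N \<sigma> k = {}")
    case True
    then have "(\<Sum>c\<in>S. of_bool (c \<in> matching N \<sigma> k)) = (0 :: real)"
      by (intro sum.neutral) auto
    then show ?thesis
      by simp
  next
    case False
    then obtain i j where c: "(i, j) \<in> S" "(i, j) \<in> matching N \<sigma> k"
      by auto
    have only: "d = (i, j)" if "d \<in> S" "d \<in> matching N \<sigma> k" for d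
    proof -
      obtain i' j' where d: "d = (i', j')"
        by (cases d)
      have "i' = i"
        using that c chain[of i j i' j'] chain[of i' j' i j] matching_nested[of i j N \<sigma> k i' j']
          matching_nested[of i' j' N \<sigma> k i j]
        unfolding d by linarith
      then show ?thesis
        using that(2) c(2) inj_onD[OF inj_on_fst_matching[of N \<sigma> k], of "(i', j')" "(i, j)"]
        unfolding d by simp
    qed
    have "(\<Sum>d\<in>S. of_bool (d \<in> matching N \<sigma> k)) = (\<Sum>d\<in>S. if d = (i, j) then 1 else 0 :: real)"
    proof (rule sum.cong[OF HOL.refl])
      fix d assume "d \<in> S"
      then have "d \<in> matching N \<sigma> k \<longleftrightarrow> d = (i, j)"
        using only c(2) by metis
      then show "of_bool (d \<in> matching N \<sigma> k) = (if d = (i, j) then 1 else 0 :: real)"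
        by (simp only: of_bool_def)
    qed
    also have "\<dots> = 1"
      using S c by simp
    finally have "(\<Sum>d\<in>S. of_bool (d \<in> matching N \<sigma> k)) = (1 :: real)" .
    then show ?thesis
      using matching_contains[OF perm c(2)] sub[OF c(1)] by simp
  qed
  have "sum (matching_point N b \<sigma>) S
      = (\<Sum>k\<in>{1..<N}. b k * (\<Sum>c\<in>S. of_bool (c \<in> matching N \<sigma> k)))"
    unfolding matching_point_def by (subst sum.swap) (simp only: sum_distrib_left)
  also have "\<dots> \<le> (\<Sum>k\<in>{1..<N}. b k * of_bool (k \<in> {l..<r}))"
    by (intro sum_mono mult_left_mono card b)
  also have "\<dots> = sum b ({1..<N} \<inter> {l..<r})"
    by (subst sum.inter_restrict, simp, rule sum.cong) simp_all
  also have "\<dots> \<le> sum b {l..<r}"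
    by (rule sum_mono2) (use b in auto)
  finally show ?thesis .
qed

lemma net_flow_matching_point:
  assumes perm: "\<sigma> permutes {1..N}" and p: "p \<in> {1..N}"
  shows "net_flow N (matching_point N b \<sigma>) p = tail_sum N b p - tail_sum N b (\<sigma> p)"
proof -
  have tail: "(\<Sum>k\<in>{1..<N}. b k * of_bool (m \<le> k)) = tail_sum N b m" if "1 \<le> m" for m
    unfolding tail_sum_def using that by (intro sum.mono_neutral_cong_right) auto
  have row: "(\<Sum>q\<in>{p<..N}. of_bool ((p, q) \<in> matching N \<sigma> k))
      = (of_bool (p \<in> fst ` matching N \<sigma> k) :: real)" for k
  proof (cases "p \<in> fst ` matching N \<sigma> k")
    case True
    then obtain j where j: "(p, j) \<in> matching N \<sigma> k"
      by auto
    have "(p, q) \<in> matching N \<sigma> k \<longleftrightarrow> q = j" for q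
      using j inj_onD[OF inj_on_fst_matching _ j, of "(p, q)"] by auto
    then show ?thesis
      using True subsetD[OF matching_subset_cells j] by (simp add: cells_def of_bool_def)
  next
    case False
    then show ?thesis
      by (force intro!: sum.neutral)
  qed
  have col: "(\<Sum>q\<in>{1..<p}. of_bool ((q, p) \<in> matching N \<sigma> k))
      = (of_bool (p \<in> snd ` matching N \<sigma> k) :: real)" for k
  proof (cases "p \<in> snd ` matching N \<sigma> k")
    case True
    then obtain i where i: "(i, p) \<in> matching N \<sigma> k"
      by auto
    have "(q, p) \<in> matching N \<sigma> k \<longleftrightarrow> q = i" for q
      using i inj_onD[OF inj_on_snd_matching _ i, of "(q, p)"] by auto
    then show ?thesis
      using True subsetD[OF matching_subset_cells i] by (simp add: cells_def of_bool_def)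
  next
    case False
    then show ?thesis
      by (force intro!: sum.neutral)
  qed
  have "net_flow N (matching_point N b \<sigma>) p = (\<Sum>k\<in>{1..<N}. b k *
      ((\<Sum>q\<in>{p<..N}. of_bool ((p, q) \<in> matching N \<sigma> k)) - (\<Sum>q\<in>{1..<p}. of_bool ((q, p) \<in> matching N \<sigma> k))))"
    unfolding net_flow_def matching_point_def
    by (subst (1 2) sum.swap) (simp only: sum_distrib_left right_diff_distrib sum_subtractf)
  also have "\<dots> = (\<Sum>k\<in>{1..<N}. b k * (of_bool (p \<le> k) - of_bool (\<sigma> p \<le> k)))"
    unfolding row col using mem_fst_matching[OF perm, of p] mem_snd_matching[OF perm, of p] p
    by (intro sum.cong) (simp_all add: not_le)
  also have "\<dots> = (\<Sum>k\<in>{1..<N}. b k * of_bool (p \<le> k)) - (\<Sum>k\<in>{1..<N}. b k * of_bool (\<sigma> p \<le> k))"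
    by (simp add: right_diff_distrib sum_subtractf)
  also have "\<dots> = tail_sum N b p - tail_sum N b (\<sigma> p)"
    using p permutes_interval_bounds[OF perm, of p] tail[of p] tail[of "\<sigma> p"] by (simp only: atLeastAtMost_iff)
  finally show ?thesis .
qed

lemma feasible_matching_point:
  assumes perm: "\<sigma> permutes {1..N}" and b: "\<And>k. 0 \<le> b k"
  shows "feasible N b (matching_point N b \<sigma>)"
  unfolding feasible_def
proof (intro conjI allI impI)
  show "\<forall>(i, j)\<in>cells N. sum (matching_point N b \<sigma>) (hook i j) \<le> sum b {i..<j}"
    by (auto intro!: sum_matching_point_chain_le[OF perm b finite_hook]) (auto simp: hook_def)
qed (simp_all add: matching_point_outside matching_point_nonneg b)

text \<open>The matching point is feasible and has the extremal weight, and every such point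
  satisfies the hook system.\<close>

lemma hook_point_matching_point:
  assumes "\<sigma> permutes {1..N}" "\<And>k. 0 \<le> b k"
  shows "hook_point b (perm_cells N \<sigma>) (matching_point N b \<sigma>)"
  using assms by (intro feasible_extremal_hook_point feasible_matching_point ballI net_flow_matching_point)

lemma matching_meets_hook:
  assumes perm: "\<sigma> permutes {1..N}" and ij: "(i, j) \<in> perm_cells N \<sigma>" and l: "i \<le> l" "l < j"
  shows "\<exists>c\<in>matching N \<sigma> l. c \<in> hook i j"
proof (rule ccontr)
  assume none: "\<not> ?thesis"
  \<comment> \<open>For these coefficients the matching point is the indicator of
    \<open>matching N \<sigma> l\<close>, and the hook bound is one.\<close>
  let ?b = "\<lambda>k. of_bool (k = l) :: real"
  have "matching_point N ?b \<sigma> c = 0" if "c \<in> hook i j" for c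
    using none that by (auto simp: matching_point_def intro!: sum.neutral)
  then have "sum (matching_point N ?b \<sigma>) (hook i j) = 0"
    by simp
  moreover have "sum (matching_point N ?b \<sigma>) (hook i j) = sum ?b {i..<j}"
    using hook_point_matching_point[OF perm, of ?b] ij by (auto simp: hook_point_def)
  moreover have "sum ?b {i..<j} = 1"
    using l by (simp add: of_bool_def)
  ultimately show False
    by simp
qed

text \<open>The hook system sees only the cells. With all coefficients one the tail sums are
  \<open>N - m\<close>, pairwise distinct, so the net flow of the common solution determines each
  value of the permutation.\<close>

lemma perm_cells_inj:
  assumes \<sigma>: "\<sigma> permutes {1..N}" and \<tau>: "\<tau> permutes {1..N}"
    and eq: "perm_cells N \<sigma> = perm_cells N \<tau>"
  shows "\<sigma> = \<tau>"
proof
  fix p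
  let ?b = "\<lambda>k. 1 :: real"
  show "\<sigma> p = \<tau> p"
  proof (cases "p \<in> {1..N}")
    case True
    have "matching_point N ?b \<sigma> = matching_point N ?b \<tau>"
      using hook_point_matching_point[OF \<sigma>, of ?b] hook_point_matching_point[OF \<tau>, of ?b]
      by (intro hook_point_unique[OF perm_cells_subset[of N \<sigma>]]) (auto simp: eq)
    then have "tail_sum N ?b (\<sigma> p) = tail_sum N ?b (\<tau> p)"
      using net_flow_matching_point[OF \<sigma> True, of ?b] net_flow_matching_point[OF \<tau> True, of ?b] by simp
    then show ?thesis
      using permutes_interval_bounds[OF \<sigma>, of p] permutes_interval_bounds[OF \<tau>, of p] True
      by (simp add: tail_sum_def of_nat_diff)
  next
    case False
    then show ?thesis
      using \<sigma> \<tau> by (simp add: permutes_not_in)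
  qed
qed

section \<open>Intersection-closed families of segments\<close>

text \<open>The axioms hold both for the matchings of a permutation and for those selected from a
  closed family, so the comparison of consecutive levels is carried out once for both directions of
  the correspondence.\<close>

locale nested_system =
  fixes M :: "nat \<Rightarrow> (nat \<times> nat) set"
  assumes contains: "(i, j) \<in> M k \<Longrightarrow> i \<le> k \<and> k < j"
    and nested: "(i, j) \<in> M k \<Longrightarrow> (i', j') \<in> M k \<Longrightarrow> i < i' \<longleftrightarrow> j' < j"
    and meets: "(i, j) \<in> M k \<Longrightarrow> i \<le> l \<Longrightarrow> l < j \<Longrightarrow> \<exists>c\<in>M l. c \<in> hook i j"
    and no_touch: "(i, j) \<in> M k \<Longrightarrow> (j, m) \<in> M l \<Longrightarrow> False"
begin

lemma meets_cases:
  assumes "(i, j) \<in> M k" "i \<le> l" "l < j"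
  obtains q where "(i, q) \<in> M l" "q \<le> j" | p where "(p, j) \<in> M l" "i \<le> p"
  using meets[OF assms] by (auto simp: hook_def)

lemma row_unique: "(i, j) \<in> M k \<Longrightarrow> (i, j') \<in> M k \<Longrightarrow> j = j'"
  using nested[of i j k i j'] nested[of i j' k i j] by linarith

lemma col_unique: "(i, j) \<in> M k \<Longrightarrow> (i', j) \<in> M k \<Longrightarrow> i = i'"
  using nested[of i j k i' j] nested[of i' j k i j] by linarith

text \<open>The hook of the first segment supplies an element of \<open>M l\<close> ending by
  \<open>j\<close>. If it starts before \<open>i'\<close>, the element supplied by the second hook
  starts later and is therefore nested inside it, which leaves only the form \<open>(i', q)\<close>
  with \<open>q \<le> j\<close>.\<close>

lemma meets_crossing:
  assumes A: "(i, j) \<in> M k" and B: "(i', j') \<in> M k'" and lt: "i < i'" "j < j'" "i' \<le> l" "l < j"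
  shows "(\<exists>q\<le>j. (i', q) \<in> M l) \<or> (\<exists>p\<ge>i'. (p, j) \<in> M l)"
proof (rule meets_cases[OF A, of l])
  fix q1 assume 1: "(i, q1) \<in> M l" "q1 \<le> j"
  show ?thesis
  proof (rule meets_cases[OF B, of l])
    fix q2 assume 2: "(i', q2) \<in> M l"
    have "q2 \<le> j"
      using nested[OF 1(1) 2] 1 lt by linarith
    then show ?thesis
      using 2 by blast
  next
    fix p2 assume "(p2, j') \<in> M l" "i' \<le> p2"
    then show ?thesis
      using nested[OF 1(1), of p2 j'] 1 lt by linarith
  qed (use lt in auto)
next
  fix p1 assume 1: "(p1, j) \<in> M l" "i \<le> p1"
  show ?thesis
  proof (cases "i' \<le> p1")
    case False
    show ?thesis
    proof (rule meets_cases[OF B, of l])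
      fix q2 assume 2: "(i', q2) \<in> M l"
      have "q2 \<le> j"
        using nested[OF 1(1) 2] False by linarith
      then show ?thesis
        using 2 by blast
    next
      fix p2 assume "(p2, j') \<in> M l" "i' \<le> p2"
      then show ?thesis
        using nested[OF 1(1), of p2 j'] False lt by linarith
    qed (use lt in auto)
  qed (use 1 in blast)
qed (use lt in auto)

text \<open>
  In each of the next three statements a violation produces a strictly shorter one.
\<close>

lemma no_crossing_step:
  "(i, q) \<in> M k \<Longrightarrow> (p, j) \<in> M (Suc k) \<Longrightarrow> i < p \<Longrightarrow> q < j \<Longrightarrow> False"
proof (induction "q - i" arbitrary: i q p j rule: less_induct)
  case less
  note A = less.prems(1) and B = less.prems(2) and lt = less.prems(3,4)
  have c: "i \<le> k" "k < q" "p \<le> Suc k" "Suc k < j"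
    using contains[OF A] contains[OF B] by auto
  have pq: "p < q"
    using no_touch[OF A, of j "Suc k"] B c by (cases "p = q") auto
  show False
  proof (cases "Suc k < q")
    case False
    \<comment> \<open>Here there is no room for a descent: an element of \<open>M k\<close> nested
      inside \<open>(i, q)\<close> would end at or before \<open>k\<close>.\<close>
    then have "q = Suc k" "p \<le> k"
      using c pq by auto
    from meets_crossing[OF A B lt, of k] \<open>p \<le> k\<close> c
    consider r where "r \<le> q" "(p, r) \<in> M k" | s where "p \<le> s" "(s, q) \<in> M k"
      by blast
    then show False
    proof cases
      case 1
      then show False
        using nested[OF A 1(2)] contains[OF 1(2)] lt \<open>q = Suc k\<close> by linarith
    next
      case 2
      then show False
        using col_unique[OF A 2(2)] lt by linarith
    qed
  next
    case True
    from meets_crossing[OF A B lt, of "Suc k"] True c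
    consider r where "r \<le> q" "(p, r) \<in> M (Suc k)" | s where "p \<le> s" "(s, q) \<in> M (Suc k)"
      by blast
    then obtain s where s: "p \<le> s" "(s, q) \<in> M (Suc k)"
      using row_unique[OF B] lt by (metis leD)
    have "s \<noteq> p"
      using s(2) row_unique[OF B, of q] lt by auto
    then have ps: "p < s"
      using s by simp
    then have "p \<le> k"
      using contains[OF s(2)] by simp
    from meets_crossing[OF A B lt, of k] \<open>p \<le> k\<close> c
    consider r where "r \<le> q" "(p, r) \<in> M k" | s where "p \<le> s" "(s, q) \<in> M k"
      by blast
    then obtain r where r: "(p, r) \<in> M k"
      using col_unique[OF A] lt by (metis leD)
    then have "r < q"
      using nested[OF A r] lt by simp
    \<comment> \<open>The cells \<open>(p, r)\<close> and \<open>(s, q)\<close> form the same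
      configuration within the overlap of the original two.\<close>
    then show False
      using less.hyps[OF _ r s(2) ps] lt pq contains[OF r] by linarith
  qed
qed

lemma no_col_retreat:
  "(p, j) \<in> M k \<Longrightarrow> (i, j) \<in> M (Suc k) \<Longrightarrow> i < p \<Longrightarrow> False"
proof (induction "j - i" arbitrary: i p j rule: less_induct)
  case less
  note A = less.prems(1) and B = less.prems(2) and lt = less.prems(3)
  have c: "p \<le> k" "Suc k < j"
    using contains[OF A] contains[OF B] by auto
  \<comment> \<open>Following the row of \<open>p\<close> at level \<open>Suc k\<close> and then the
    column of its end \<open>q\<close> at level \<open>k\<close> reproduces the configuration
    further inside.\<close>
  obtain q where q: "(p, q) \<in> M (Suc k)"
    by (rule meets_cases[OF A, of "Suc k"]) (use c col_unique[OF B] lt in auto)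
  then have qj: "q < j"
    using nested[OF B q] lt by simp
  obtain s where s: "(s, q) \<in> M k" "p \<le> s"
    by (rule meets_cases[OF q, of k]) (use c contains[OF q] row_unique[OF A] qj in auto)
  have "s \<noteq> p"
    using s(1) row_unique[OF A, of q] qj by auto
  then have "p < s"
    using s by simp
  moreover have "q - p < j - i"
    using qj lt contains[OF q] c by linarith
  ultimately show False
    using less.hyps[OF _ s(1) q] by simp
qed

lemma no_row_retreat:
  "(i, q) \<in> M k \<Longrightarrow> (i, j) \<in> M (Suc k) \<Longrightarrow> j < q \<Longrightarrow> False"
proof (induction "q - i" arbitrary: i j q rule: less_induct)
  case less
  note A = less.prems(1) and B = less.prems(2) and lt = less.prems(3)
  have c: "i \<le> k" "Suc k < j"
    using contains[OF A] contains[OF B] by auto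
  obtain s where s: "(s, j) \<in> M k" "i \<le> s"
    by (rule meets_cases[OF B, of k]) (use c row_unique[OF A] lt in auto)
  have "s \<noteq> i"
    using s(1) row_unique[OF A, of j] lt by auto
  then have si: "i < s"
    using s by simp
  obtain r where r: "(s, r) \<in> M (Suc k)"
    by (rule meets_cases[OF s(1), of "Suc k"]) (use c contains[OF s(1)] col_unique[OF B] si in auto)
  then have "r < j"
    using nested[OF B r] si by simp
  moreover have "j - s < q - i"
    using lt si contains[OF s(1)] by linarith
  ultimately show False
    using less.hyps[OF _ s(1) r] by simp
qed

text \<open>A converse of \<open>meets\<close>. At level \<open>i\<close> the element on the hook
  must start at \<open>i\<close>, at level \<open>j - 1\<close> it must end at \<open>j\<close>. If
  no element does both, some step from \<open>k\<close> to \<open>Suc k\<close> switches from one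
  arm of the hook to the other, against \<open>no_crossing_step\<close>.\<close>

lemma mem_if_meets_all:
  assumes "i < j" and all: "\<And>l. i \<le> l \<Longrightarrow> l < j \<Longrightarrow> (\<exists>q\<le>j. (i, q) \<in> M l) \<or> (\<exists>p\<ge>i. (p, j) \<in> M l)"
  shows "\<exists>k. (i, j) \<in> M k"
proof (rule ccontr)
  assume none: "\<not> ?thesis"
  have "\<exists>q<j. (i, q) \<in> M l" if "i \<le> l" "l < j" for l
    using that
  proof (induction l rule: dec_induct)
    case base
    then show ?case
      using all[of i] contains none by (metis le_antisym le_neq_implies_less order.refl)
  next
    case (step l)
    then obtain q where q: "q < j" "(i, q) \<in> M l"
      by auto
    from all[of "Suc l"] step consider r where "r \<le> j" "(i, r) \<in> M (Suc l)"
      | p where "i \<le> p" "(p, j) \<in> M (Suc l)"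
      by auto
    then show ?case
    proof cases
      case 1
      then show ?thesis
        using none by (metis le_neq_implies_less)
    next
      case 2
      then show ?thesis
        using no_crossing_step[OF q(2) 2(2)] q none by (metis le_neq_implies_less)
    qed
  qed
  moreover have "i \<le> j - 1" "j - 1 < j"
    using assms(1) by linarith+
  ultimately obtain q where "q < j" "(i, q) \<in> M (j - 1)"
    by meson
  then show False
    using contains[of i q "j - 1"] by linarith
qed

lemma intersection_closed:
  assumes A: "(i, j) \<in> M k" and B: "(i', j') \<in> M k'" and lt: "i < i'" "i' \<le> j" "j < j'"
  shows "i' < j" "\<exists>l. (i', j) \<in> M l"
proof -
  show "i' < j"
    using no_touch[OF A, of j' k'] B lt by (cases "i' = j") auto
  then show "\<exists>l. (i', j) \<in> M l"
    using meets_crossing[OF A B lt(1,3)] by (intro mem_if_meets_all) auto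
qed

end

text \<open>The condition of \<open>Rp\<close> on endpoints. Only proper overlaps are recorded,
  since in all other intersecting pairs one segment is the intersection; \<open>i' < j\<close>
  excludes segments sharing just an endpoint.\<close>

definition closed_cells :: "(nat \<times> nat) set \<Rightarrow> bool" where
  "closed_cells F \<longleftrightarrow> (\<forall>i j i' j'. (i, j) \<in> F \<longrightarrow> (i', j') \<in> F \<longrightarrow> i < i' \<longrightarrow> i' \<le> j \<longrightarrow> j < j' \<longrightarrow>
     i' < j \<and> (i', j) \<in> F)"

lemma nested_system_matching:
  assumes perm: "\<sigma> permutes {1..N}"
  shows "nested_system (matching N \<sigma>)"
proof
  fix i j k l m assume A: "(i, j) \<in> matching N \<sigma> k" and B: "(j, m) \<in> matching N \<sigma> l"
  have ij: "i < j" "j < m"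
    using subsetD[OF matching_subset_cells A] subsetD[OF matching_subset_cells B] by (auto simp: cells_def)
  have A': "(i, j) \<in> perm_cells N \<sigma>" and B': "(j, m) \<in> perm_cells N \<sigma>"
    using A B by (auto simp: perm_cells_def)
  \<comment> \<open>At level \<open>j - 1\<close> an element on the hook of \<open>(i, j)\<close>
    has to end at \<open>j\<close>, whence \<open>\<sigma> j < j\<close>; at level \<open>j\<close>
    one on the hook of \<open>(j, m)\<close> has to start at \<open>j\<close>, whence
    \<open>\<sigma> j > j\<close>.\<close>
  have "i \<le> j - 1" "j - 1 < j"
    using ij by linarith+
  then obtain c where c: "c \<in> matching N \<sigma> (j - 1)" "c \<in> hook i j"
    using matching_meets_hook[OF perm A'] by meson
  then have "snd c = j"
    using matching_contains(2)[OF perm, of "fst c" "snd c" "j - 1"] by (auto simp: hook_def)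
  then have "\<sigma> j \<le> j - 1"
    using c by (cases c) (auto simp: matching_def)
  obtain d where d: "d \<in> matching N \<sigma> j" "d \<in> hook j m"
    using matching_meets_hook[OF perm B', of j] ij by auto
  then have "fst d = j"
    using matching_contains(1)[OF perm, of "fst d" "snd d" j] by (auto simp: hook_def)
  then have "j < \<sigma> j"
    using d by (cases d) (auto simp: matching_def)
  then show False
    using \<open>\<sigma> j \<le> j - 1\<close> by simp
next
  fix i j k l assume "(i, j) \<in> matching N \<sigma> k" "i \<le> l" "l < j"
  then show "\<exists>c\<in>matching N \<sigma> l. c \<in> hook i j"
    using matching_meets_hook[OF perm, of i j l] by (auto simp: perm_cells_def)
qed (use matching_contains[OF perm] matching_nested in blast)+

lemma closed_perm_cells:
  assumes perm: "\<sigma> permutes {1..N}"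
  shows "closed_cells (perm_cells N \<sigma>)"
proof -
  interpret nested_system "matching N \<sigma>"
    by (rule nested_system_matching[OF perm])
  show ?thesis
    unfolding closed_cells_def perm_cells_def
  proof (intro allI impI)
    fix i j i' j' assume "(i, j) \<in> (\<Union>k. matching N \<sigma> k)" "(i', j') \<in> (\<Union>k. matching N \<sigma> k)"
      and lt: "i < i'" "i' \<le> j" "j < j'"
    then obtain k k' where "(i, j) \<in> matching N \<sigma> k" "(i', j') \<in> matching N \<sigma> k'"
      by blast
    from intersection_closed[OF this lt]
    show "i' < j \<and> (i', j) \<in> (\<Union>k. matching N \<sigma> k)"
      by blast
  qed
qed

text \<open>
  The selection at level \<open>k\<close> is the kernel of the relation of lying on a hook: a segment is
  selected iff no shorter selected segment lies on its hook. The last argument bounds the length.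
\<close>

primrec hook_kernel :: "(nat \<times> nat) set \<Rightarrow> nat \<Rightarrow> nat \<Rightarrow> (nat \<times> nat) set" where
  "hook_kernel F k 0 = {}"
| "hook_kernel F k (Suc d) = hook_kernel F k d \<union>
     {(i, j) \<in> F. j - i = d \<and> i \<le> k \<and> k < j \<and> hook i j \<inter> hook_kernel F k d = {}}"

definition family_matching :: "(nat \<times> nat) set \<Rightarrow> nat \<Rightarrow> (nat \<times> nat) set" where
  "family_matching F k = (\<Union>d. hook_kernel F k d)"

lemma hook_kernel_length: "(i, j) \<in> hook_kernel F k d \<Longrightarrow> j - i < d"
  by (induction d) auto

lemma hook_kernel_mono: "d \<le> e \<Longrightarrow> hook_kernel F k d \<subseteq> hook_kernel F k e"
  by (induction rule: dec_induct) auto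

lemma hook_kernel_cut: "(i, j) \<in> hook_kernel F k e \<Longrightarrow> j - i < d \<Longrightarrow> (i, j) \<in> hook_kernel F k d"
  by (induction e) (use hook_kernel_mono[of "Suc (j - i)" d F k] in \<open>auto simp: Suc_le_eq\<close>)

lemma mem_hook_kernel: "(i, j) \<in> hook_kernel F k d \<longleftrightarrow> (i, j) \<in> family_matching F k \<and> j - i < d"
  unfolding family_matching_def using hook_kernel_cut hook_kernel_length by blast

text \<open>The fixed-point form of the recursion. The other cells on a hook are strictly shorter,
  so the stage reached before \<open>(i, j)\<close> is considered has already decided them.\<close>

lemma mem_family_matching:
  "(i, j) \<in> family_matching F k \<longleftrightarrow>
     (i, j) \<in> F \<and> i \<le> k \<and> k < j \<and> (\<forall>c\<in>hook i j. c \<in> family_matching F k \<longrightarrow> c = (i, j))"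
proof -
  have "(i, j) \<in> family_matching F k \<longleftrightarrow> (i, j) \<in> hook_kernel F k (Suc (j - i))"
    by (simp add: mem_hook_kernel del: hook_kernel.simps)
  also have "\<dots> \<longleftrightarrow> (i, j) \<in> F \<and> i \<le> k \<and> k < j \<and> hook i j \<inter> hook_kernel F k (j - i) = {}"
    using hook_kernel_length[of i j F k "j - i"] by auto
  also have "\<dots> \<longleftrightarrow> (i, j) \<in> F \<and> i \<le> k \<and> k < j \<and>
      (\<forall>p q. (p, q) \<in> hook i j \<longrightarrow> \<not> ((p, q) \<in> family_matching F k \<and> q - p < j - i))"
    unfolding mem_hook_kernel[symmetric] by auto
  also have "\<dots> \<longleftrightarrow> (i, j) \<in> F \<and> i \<le> k \<and> k < j \<and>
      (\<forall>c\<in>hook i j. c \<in> family_matching F k \<longrightarrow> c = (i, j))"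
    by (fastforce simp: hook_def)
  finally show ?thesis .
qed

lemma family_matching_meets:
  assumes "(i, j) \<in> F" "i \<le> l" "l < j"
  shows "\<exists>c\<in>family_matching F l. c \<in> hook i j"
proof (cases "(i, j) \<in> family_matching F l")
  case True
  moreover have "(i, j) \<in> hook i j"
    using assms by (simp add: hook_def)
  ultimately show ?thesis
    by blast
next
  case False
  then show ?thesis
    using assms mem_family_matching[of i j F l] by blast
qed

text \<open>If two selected segments crossed, their overlap would be in \<open>F\<close>, and a
  selected cell on the hook of the overlap would lie on the hook of one of the two while being
  shorter than it, contrary to the selection of that one.\<close>

lemma nested_system_family_matching:
  assumes F: "closed_cells F"
  shows "nested_system (family_matching F)"
proof
  have cl: "i' < j \<and> (i', j) \<in> F"
    if "(i, j) \<in> F" "(i', j') \<in> F" "i < i'" "i' \<le> j" "j < j'" for i j i' j'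
    using F that unfolding closed_cells_def by blast
  have below: "c = (i, j)"
    if "(i, j) \<in> family_matching F k" "c \<in> hook i j" "c \<in> family_matching F k" for i j k c
    using that mem_family_matching[of i j F k] by blast
  have cont: "(i, j) \<in> F" "i \<le> k" "k < j" if "(i, j) \<in> family_matching F k" for i j k
    using that mem_family_matching[of i j F k] by auto
  have nest: "j' < j" if A: "(i, j) \<in> family_matching F k" and B: "(i', j') \<in> family_matching F k"
    and lt: "i < i'" for i j i' j' k
  proof (rule ccontr)
    assume "\<not> j' < j"
    have "j \<noteq> j'"
      using below[OF A _ B] cont[OF B] lt by (auto simp: hook_def)
    then have "j < j'"
      using \<open>\<not> j' < j\<close> by simp
    have "(i', j) \<in> F"
      using cl[OF cont(1)[OF A] cont(1)[OF B] lt _ \<open>j < j'\<close>] cont[OF A] cont[OF B] by simp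
    then obtain c where c: "c \<in> family_matching F k" "c \<in> hook i' j"
      using family_matching_meets[of i' j F k] cont[OF A] cont[OF B] by auto
    then consider "c \<in> hook i' j'" "snd c < j'" | "c \<in> hook i j" "i < fst c"
      using lt \<open>j < j'\<close> by (auto simp: hook_def)
    then show False
      using below[OF A _ c(1)] below[OF B _ c(1)] by cases auto
  qed
  show "i \<le> k \<and> k < j" if "(i, j) \<in> family_matching F k" for i j k
    using cont[OF that] by simp
  show "i < i' \<longleftrightarrow> j' < j"
    if A: "(i, j) \<in> family_matching F k" and B: "(i', j') \<in> family_matching F k" for i j i' j' k
  proof
    assume "j' < j"
    then have "i \<noteq> i'"
      using below[OF A _ B] cont[OF B] by (auto simp: hook_def)
    then show "i < i'"
      using nest[OF B A] \<open>j' < j\<close> by linarith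
  qed (use nest[OF A B] in simp)
  show "\<exists>c\<in>family_matching F l. c \<in> hook i j"
    if "(i, j) \<in> family_matching F k" "i \<le> l" "l < j" for i j k l
    using family_matching_meets[OF cont(1)] that by blast
  show False if "(i, j) \<in> family_matching F k" "(j, m) \<in> family_matching F l" for i j k l m
    using cl[of i j j m] cont[OF that(1)] cont[OF that(2)] by simp
qed

lemma Union_family_matching:
  assumes F: "closed_cells F" and sub: "F \<subseteq> cells N"
  shows "(\<Union>k. family_matching F k) = F"
proof
  show "(\<Union>k. family_matching F k) \<subseteq> F"
    using mem_family_matching by auto
  interpret nested_system "family_matching F"
    by (rule nested_system_family_matching[OF F])
  have "\<exists>k. (i, j) \<in> family_matching F k" if ij: "(i, j) \<in> F" for i j
  proof (rule mem_if_meets_all)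
    show "i < j"
      using sub ij by (auto simp: cells_def)
    show "(\<exists>q\<le>j. (i, q) \<in> family_matching F l) \<or> (\<exists>p\<ge>i. (p, j) \<in> family_matching F l)"
      if "i \<le> l" "l < j" for l
      using family_matching_meets[OF ij that] by (auto simp: hook_def)
  qed
  then show "F \<subseteq> (\<Union>k. family_matching F k)"
    by auto
qed

section \<open>Complete flags of subsets and permutations\<close>

lemma flag_permutation:
  fixes I :: "nat \<Rightarrow> nat set"
  assumes card: "\<And>k. k \<le> N \<Longrightarrow> card (I k) = k" and top: "I N = {1..N}"
    and step: "\<And>k. k < N \<Longrightarrow> I k \<subseteq> I (Suc k)"
  obtains \<sigma> where "\<sigma> permutes {1..N}" "\<And>p k. p \<in> {1..N} \<Longrightarrow> k \<le> N \<Longrightarrow> \<sigma> p \<le> k \<longleftrightarrow> p \<in> I k"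
proof -
  have mono: "I k \<subseteq> I l" if "k \<le> l" "l \<le> N" for k l
    using that
  proof (induction l rule: dec_induct)
    case (step l)
    then show ?case
      using assms(3)[of l] by simp
  qed simp
  define \<sigma> where "\<sigma> p = (if p \<in> {1..N} then LEAST k. p \<in> I k else p)" for p
  have iff: "\<sigma> p \<le> k \<longleftrightarrow> p \<in> I k" if "p \<in> {1..N}" "k \<le> N" for p k
  proof
    assume "\<sigma> p \<le> k"
    moreover have "p \<in> I (\<sigma> p)"
      using that top by (auto simp: \<sigma>_def intro: LeastI[of _ N])
    ultimately show "p \<in> I k"
      using mono that by blast
  qed (use that in \<open>simp add: \<sigma>_def Least_le\<close>)
  have fin: "finite (I k)" if "k \<le> N" for k
    using mono[OF that order.refl] top finite_subset by auto
  have surj: "\<sigma> ` {1..N} = {1..N}"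
  proof
    have "I 0 = {}"
      using card[of 0] fin[of 0] by simp
    then show "\<sigma> ` {1..N} \<subseteq> {1..N}"
      using iff[of _ 0] iff[of _ N] top by (auto simp: Suc_le_eq)
    show "{1..N} \<subseteq> \<sigma> ` {1..N}"
    proof
      fix k assume k: "k \<in> {1..N}"
      then have "k - 1 \<le> N" "k - 1 < k"
        by auto
      then have "\<not> I k \<subseteq> I (k - 1)"
        using card_mono[OF fin[of "k - 1"], of "I k"] card[of k] card[of "k - 1"] k by auto
      then obtain p where p: "p \<in> I k" "p \<notin> I (k - 1)"
        by blast
      then have "p \<in> {1..N}"
        using mono[of k N] top k by auto
      then have "\<sigma> p \<le> k" "\<not> \<sigma> p \<le> k - 1"
        using iff[of p k] iff[of p "k - 1"] p k \<open>k - 1 \<le> N\<close> by simp_all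
      then have "\<sigma> p = k"
        by linarith
      then show "k \<in> \<sigma> ` {1..N}"
        using \<open>p \<in> {1..N}\<close> by blast
    qed
  qed
  have "bij_betw \<sigma> {1..N} {1..N}"
    using surj eq_card_imp_inj_on[of "{1..N}" \<sigma>] unfolding bij_betw_def by simp
  then have "\<sigma> permutes {1..N}"
    by (rule bij_imp_permutes) (auto simp: \<sigma>_def)
  then show thesis
    using that iff by blast
qed

text \<open>\<open>I k\<close> is meant to be the set of positions with value at most
  \<open>k\<close>: take \<open>{1..k}\<close> and exchange the left ends of \<open>M k\<close> for
  its right ends. Cardinality is preserved because left and right ends are equinumerous; that the
  sets grow with \<open>k\<close> is the purpose of \<open>no_touch\<close>,
  \<open>no_col_retreat\<close> and \<open>no_row_retreat\<close>.\<close>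

lemma (in nested_system) exists_permutation:
  assumes sub: "\<And>k. M k \<subseteq> cells N"
  shows "\<exists>\<sigma>. \<sigma> permutes {1..N} \<and> matching N \<sigma> = M"
proof -
  define I where "I k = ({1..k} - fst ` M k) \<union> snd ` M k" for k
  have fin: "finite (M k)" for k
    using finite_subset[OF sub] by simp
  have inj: "inj_on fst (M k)" "inj_on snd (M k)" for k
    by (auto intro!: inj_onI dest: row_unique col_unique)
  have fst_sub: "fst ` M k \<subseteq> {1..k}" and snd_sub: "snd ` M k \<subseteq> {Suc k..N}" for k
    using sub[of k] contains by (auto simp: cells_def Suc_le_eq)
  have "card (I k) = k" for k
  proof -
    have "card ({1..k} - fst ` M k) = k - card (M k)"
      using fst_sub[of k] fin[of k] by (simp add: card_Diff_subset card_image inj)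
    moreover have "card (snd ` M k) = card (M k)"
      by (simp add: card_image inj)
    moreover have "card (M k) \<le> k"
      using card_mono[OF _ fst_sub[of k]] by (simp add: card_image inj)
    moreover have "card (I k) = card ({1..k} - fst ` M k) + card (snd ` M k)"
      unfolding I_def using fin snd_sub[of k] by (intro card_Un_disjoint) auto
    ultimately show ?thesis
      by simp
  qed
  moreover have "I N = {1..N}"
    using fst_sub[of N] snd_sub[of N] by (auto simp: I_def)
  moreover have "I k \<subseteq> I (Suc k)" for k
  proof
    fix p assume p: "p \<in> I k"
    show "p \<in> I (Suc k)"
    proof (rule ccontr)
      assume n: "p \<notin> I (Suc k)"
      consider "1 \<le> p" "p \<le> k" "p \<notin> fst ` M k" | i where "(i, p) \<in> M k"
        using p by (auto simp: I_def)
      then show False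
      proof cases
        case 1
        then obtain j where j: "(p, j) \<in> M (Suc k)"
          using n by (auto simp: I_def)
        show False
        proof (rule meets_cases[OF j, of k])
          fix s assume s: "(s, j) \<in> M k" "p \<le> s"
          then have "p \<noteq> s"
            using 1 by force
          then show False
            using no_col_retreat[OF s(1) j] s by simp
        qed (use 1 contains[OF j] in \<open>force+\<close>)
      next
        case 2
        then have c: "i \<le> k" "k < p" "1 \<le> p"
          using contains[OF 2] by auto
        have ns: "p \<notin> snd ` M (Suc k)"
          using n by (auto simp: I_def)
        show False
        proof (cases "p = Suc k")
          case True
          then obtain j where "(p, j) \<in> M (Suc k)"
            using n by (auto simp: I_def)
          then show False
            using no_touch[OF 2] by blast
        next
          case False
          show False
          proof (rule meets_cases[OF 2, of "Suc k"])
            fix q assume q: "(i, q) \<in> M (Suc k)" "q \<le> p"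
            then have "q \<noteq> p"
              using ns by force
            then show False
              using no_row_retreat[OF 2 q(1)] q by simp
          qed (use False c ns in \<open>force+\<close>)
        qed
      qed
    qed
  qed
  ultimately obtain \<sigma> where perm: "\<sigma> permutes {1..N}"
    and iff: "\<And>p k. p \<in> {1..N} \<Longrightarrow> k \<le> N \<Longrightarrow> \<sigma> p \<le> k \<longleftrightarrow> p \<in> I k"
    using flag_permutation[of N I] by blast
  have le: "M k \<subseteq> matching N \<sigma> k" for k
  proof
    fix c assume "c \<in> M k"
    then obtain i j where c: "c = (i, j)" and ij: "(i, j) \<in> M k"
      by (cases c) auto
    have b: "1 \<le> i" "i \<le> k" "k < j" "j \<le> N"
      using contains[OF ij] sub[of k] ij by (auto simp: cells_def)
    have out: "k < \<sigma> p \<longleftrightarrow> p \<in> fst ` M k" if "1 \<le> p" "p \<le> k" for p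
      using iff[of p k] that b snd_sub[of k] by (auto simp: I_def not_le[symmetric])
    have inn: "\<sigma> q \<le> k \<longleftrightarrow> q \<in> snd ` M k" if "k < q" "q \<le> N" for q
      using iff[of q k] that b by (auto simp: I_def)
    have "{p \<in> {1..i}. k < \<sigma> p} = fst ` {c \<in> M k. fst c \<le> i}"
      using out b fst_sub[of k] by force
    then have "lrank \<sigma> k i = card {c \<in> M k. fst c \<le> i}"
      unfolding lrank_def by (metis (no_types, lifting) card_image inj(1) inj_on_subset mem_Collect_eq subsetI)
    moreover have "{q \<in> {j..N}. \<sigma> q \<le> k} = snd ` {c \<in> M k. j \<le> snd c}"
      using inn b snd_sub[of k] by force
    then have "rrank N \<sigma> k j = card {c \<in> M k. j \<le> snd c}"
      unfolding rrank_def by (metis (no_types, lifting) card_image inj(2) inj_on_subset mem_Collect_eq subsetI)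
    \<comment> \<open>Both ranks count the elements of \<open>M k\<close> that enclose
      \<open>(i, j)\<close>, itself included.\<close>
    moreover have "{c \<in> M k. fst c \<le> i} = {c \<in> M k. j \<le> snd c}"
      using nested[OF ij] by (auto simp: not_less[symmetric])
    moreover have "k < \<sigma> i" "\<sigma> j \<le> k"
      using out[of i] inn[of j] b ij by force+
    ultimately show "c \<in> matching N \<sigma> k"
      using sub[of k] ij by (auto simp: c matching_def)
  qed
  have ge: "matching N \<sigma> k \<subseteq> M k" for k
  proof
    fix c assume "c \<in> matching N \<sigma> k"
    then obtain i j where c: "c = (i, j)" and ij: "(i, j) \<in> matching N \<sigma> k"
      by (cases c) auto
    have "1 \<le> i" "i \<le> k" "k < N" "\<not> \<sigma> i \<le> k"
      using matching_contains[OF perm ij] matching_less[OF ij perm] ij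
      by (auto simp: matching_def cells_def)
    then have "i \<notin> I k"
      using iff[of i k] by simp
    then obtain j' where "(i, j') \<in> M k"
      using \<open>1 \<le> i\<close> \<open>i \<le> k\<close> by (auto simp: I_def)
    \<comment> \<open>The left ends agree through \<open>I k\<close>, and in
      \<open>matching N \<sigma> k\<close> a left end has only one partner.\<close>
    then show "c \<in> M k"
      using inj_onD[OF inj_on_fst_matching _ ij, of "(i, j')"] le[of k] c by auto
  qed
  show ?thesis
    using perm le ge by (intro exI[of _ \<sigma>] conjI ext equalityI) auto
qed

lemma closed_cells_permutation:
  assumes "closed_cells F" "F \<subseteq> cells N"
  shows "\<exists>\<sigma>. \<sigma> permutes {1..N} \<and> perm_cells N \<sigma> = F"
proof -
  interpret nested_system "family_matching F"
    by (rule nested_system_family_matching[OF assms(1)])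
  have "family_matching F k \<subseteq> cells N" for k
    using Union_family_matching[OF assms] assms(2) by blast
  then obtain \<sigma> where "\<sigma> permutes {1..N}" "matching N \<sigma> = family_matching F"
    using exists_permutation by blast
  then show ?thesis
    using Union_family_matching[OF assms] by (intro exI[of _ \<sigma>]) (simp add: perm_cells_def)
qed

section \<open>Reversal symmetry\<close>

definition rev_sym :: "nat \<Rightarrow> (nat \<Rightarrow> nat) \<Rightarrow> bool" where
  "rev_sym N \<sigma> \<longleftrightarrow> (\<forall>p\<in>{1..N}. \<sigma> (Suc N - p) = Suc N - \<sigma> p)"

text \<open>Conjugation by the reversal exchanges large and small values as well as left and right,
  hence the two ranks, and moves level \<open>k\<close> to \<open>N - k\<close>.\<close>

lemma matching_reverse:
  assumes perm: "\<sigma> permutes {1..N}" and k: "k \<le> N" and ij: "(i, j) \<in> cells N"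
    and rev: "\<And>p. p \<in> {1..N} \<Longrightarrow> \<tau> p = Suc N - \<sigma> (Suc N - p)"
  shows "(i, j) \<in> matching N \<tau> k \<longleftrightarrow> (Suc N - j, Suc N - i) \<in> matching N \<sigma> (N - k)"
proof -
  have b: "1 \<le> i" "i < j" "j \<le> N"
    using ij by (auto simp: cells_def)
  have out: "k < \<tau> p \<longleftrightarrow> \<sigma> (Suc N - p) \<le> N - k" if "p \<in> {1..N}" for p
  proof -
    have "1 \<le> Suc N - p" "Suc N - p \<le> N"
      using that by auto
    then have "1 \<le> \<sigma> (Suc N - p)" "\<sigma> (Suc N - p) \<le> N"
      using permutes_interval_bounds[OF perm] by blast+
    then show ?thesis
      using rev[OF that] k by linarith
  qed
  then have inn: "\<tau> p \<le> k \<longleftrightarrow> N - k < \<sigma> (Suc N - p)" if "p \<in> {1..N}" for p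
    using that by (meson not_le)
  have outr: "k < \<tau> (Suc N - q) \<longleftrightarrow> \<sigma> q \<le> N - k"
    and innr: "\<tau> (Suc N - q) \<le> k \<longleftrightarrow> N - k < \<sigma> q" if "1 \<le> q" "q \<le> N" for q
  proof -
    have "Suc N - q \<in> {1..N}" "Suc N - (Suc N - q) = q"
      using that by auto
    then show "k < \<tau> (Suc N - q) \<longleftrightarrow> \<sigma> q \<le> N - k" "\<tau> (Suc N - q) \<le> k \<longleftrightarrow> N - k < \<sigma> q"
      using out[of "Suc N - q"] inn[of "Suc N - q"] by simp_all
  qed
  have "lrank \<tau> k i = rrank N \<sigma> (N - k) (Suc N - i)"
    unfolding lrank_def rrank_def
    by (rule bij_betw_same_card[of "\<lambda>p. Suc N - p"],
        rule bij_betw_byWitness[where f' = "\<lambda>p. Suc N - p"]) (use out outr b in auto)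
  moreover have "rrank N \<tau> k j = lrank \<sigma> (N - k) (Suc N - j)"
    unfolding lrank_def rrank_def
    by (rule bij_betw_same_card[of "\<lambda>p. Suc N - p"],
        rule bij_betw_byWitness[where f' = "\<lambda>p. Suc N - p"]) (use inn innr b in auto)
  moreover have "(Suc N - j, Suc N - i) \<in> cells N"
    using b unfolding cells_def by auto
  ultimately show ?thesis
    using out[of i] inn[of j] b ij by (auto simp: matching_def)
qed

lemma rev_sym_matching:
  assumes perm: "\<sigma> permutes {1..N}" and sym: "rev_sym N \<sigma>" and k: "k \<le> N" and ij: "(i, j) \<in> cells N"
  shows "(i, j) \<in> matching N \<sigma> k \<longleftrightarrow> (Suc N - j, Suc N - i) \<in> matching N \<sigma> (N - k)"
proof (rule matching_reverse[OF perm k ij])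
  fix p assume p: "p \<in> {1..N}"
  then show "\<sigma> p = Suc N - \<sigma> (Suc N - p)"
    using sym permutes_interval_bounds[OF perm, of p] by (simp add: rev_sym_def)
qed

text \<open>For the converse, the conjugate \<open>\<tau>\<close> has the reversed cells; if these
  are the original ones, \<open>perm_cells_inj\<close> identifies \<open>\<tau>\<close> with
  \<open>\<sigma>\<close>.\<close>

lemma rev_sym_iff_perm_cells:
  assumes perm: "\<sigma> permutes {1..N}"
  shows "rev_sym N \<sigma> \<longleftrightarrow>
    (\<forall>(i, j)\<in>cells N. (Suc N - j, Suc N - i) \<in> perm_cells N \<sigma> \<longrightarrow> (i, j) \<in> perm_cells N \<sigma>)"
proof
  assume sym: "rev_sym N \<sigma>"
  show "\<forall>(i, j)\<in>cells N. (Suc N - j, Suc N - i) \<in> perm_cells N \<sigma> \<longrightarrow> (i, j) \<in> perm_cells N \<sigma>"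
  proof safe
    fix i j assume ij: "(i, j) \<in> cells N" and "(Suc N - j, Suc N - i) \<in> perm_cells N \<sigma>"
    then obtain k where k: "(Suc N - j, Suc N - i) \<in> matching N \<sigma> k"
      by (auto simp: perm_cells_def)
    then have "k \<le> N"
      using matching_less[OF _ perm] less_imp_le by blast
    then have "(i, j) \<in> matching N \<sigma> (N - k)"
      using rev_sym_matching[OF perm sym _ ij, of "N - k"] k by simp
    then show "(i, j) \<in> perm_cells N \<sigma>"
      by (auto simp: perm_cells_def)
  qed
next
  assume sym: "\<forall>(i, j)\<in>cells N. (Suc N - j, Suc N - i) \<in> perm_cells N \<sigma> \<longrightarrow> (i, j) \<in> perm_cells N \<sigma>"
  define \<tau> where "\<tau> p = (if p \<in> {1..N} then Suc N - \<sigma> (Suc N - p) else p)" for p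
  have \<sigma>_bnd: "1 \<le> \<sigma> (Suc N - p)" "\<sigma> (Suc N - p) \<le> N" if "p \<in> {1..N}" for p
  proof -
    have "1 \<le> Suc N - p" "Suc N - p \<le> N"
      using that by auto
    then show "1 \<le> \<sigma> (Suc N - p)" "\<sigma> (Suc N - p) \<le> N"
      using permutes_interval_bounds[OF perm] by blast+
  qed
  have bnd: "Suc N - \<sigma> (Suc N - p) \<in> {1..N}" if "p \<in> {1..N}" for p
    using \<sigma>_bnd[OF that] by auto
  have "inj_on \<tau> {1..N}"
  proof (rule inj_onI)
    fix p q assume pq: "p \<in> {1..N}" "q \<in> {1..N}" "\<tau> p = \<tau> q"
    then have "\<sigma> (Suc N - p) = \<sigma> (Suc N - q)"
      using \<sigma>_bnd[OF pq(1)] \<sigma>_bnd[OF pq(2)] unfolding \<tau>_def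
      by (simp only: if_True) linarith
    then have "Suc N - p = Suc N - q"
      using permutes_inj[OF perm] by (auto dest: injD)
    then show "p = q"
      using pq by auto
  qed
  moreover have "\<tau> ` {1..N} \<subseteq> {1..N}"
    using bnd by (simp add: \<tau>_def image_subset_iff)
  ultimately have "bij_betw \<tau> {1..N} {1..N}"
    by (simp add: bij_betw_def endo_inj_surj)
  then have perm': "\<tau> permutes {1..N}"
    by (rule bij_imp_permutes) (auto simp: \<tau>_def)
  have cells: "(Suc N - j, Suc N - i) \<in> cells N" if "(i, j) \<in> cells N" for i j
    using that by (auto simp: cells_def)
  have iff: "(i, j) \<in> perm_cells N \<tau> \<longleftrightarrow> (Suc N - j, Suc N - i) \<in> perm_cells N \<sigma>"
    if ij: "(i, j) \<in> cells N" for i j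
  proof
    assume "(i, j) \<in> perm_cells N \<tau>"
    then obtain k where k: "(i, j) \<in> matching N \<tau> k"
      by (auto simp: perm_cells_def)
    then have "k \<le> N"
      using matching_less[OF _ perm'] less_imp_le by blast
    then show "(Suc N - j, Suc N - i) \<in> perm_cells N \<sigma>"
      using matching_reverse[OF perm _ ij, of k \<tau>] k by (auto simp: \<tau>_def perm_cells_def)
  next
    assume "(Suc N - j, Suc N - i) \<in> perm_cells N \<sigma>"
    then obtain k where k: "(Suc N - j, Suc N - i) \<in> matching N \<sigma> k"
      by (auto simp: perm_cells_def)
    then have "k \<le> N"
      using matching_less[OF _ perm] less_imp_le by blast
    then show "(i, j) \<in> perm_cells N \<tau>"
      using matching_reverse[OF perm _ ij, of "N - k" \<tau>] k by (auto simp: \<tau>_def perm_cells_def)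
  qed
  have invol: "(Suc N - (Suc N - i), Suc N - (Suc N - j)) = (i, j)" if "(i, j) \<in> cells N" for i j
    using that by (auto simp: cells_def)
  have "perm_cells N \<tau> = perm_cells N \<sigma>"
  proof (intro equalityI subsetI)
    fix c assume c: "c \<in> perm_cells N \<tau>"
    then have "c \<in> cells N"
      using perm_cells_subset by blast
    then show "c \<in> perm_cells N \<sigma>"
      using c iff sym by (cases c) auto
  next
    fix c assume c: "c \<in> perm_cells N \<sigma>"
    then obtain i j where ij: "c = (i, j)" "(i, j) \<in> cells N"
      using perm_cells_subset by (cases c) blast
    then have "(Suc N - j, Suc N - i) \<in> perm_cells N \<sigma>"
      using bspec[OF sym cells[OF ij(2)]] c invol[OF ij(2)] by simp
    then show "c \<in> perm_cells N \<tau>"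
      using iff[OF ij(2)] ij by simp
  qed
  then have "\<tau> = \<sigma>"
    using perm_cells_inj[OF perm' perm] by simp
  then have "\<sigma> p = Suc N - \<sigma> (Suc N - p)" if "p \<in> {1..N}" for p
    using that by (metis \<tau>_def)
  then show "rev_sym N \<sigma>"
    unfolding rev_sym_def using \<sigma>_bnd by (metis diff_diff_cancel le_SucI)
qed

section \<open>The Weyl group as signed permutations\<close>

text \<open>
  The index \<open>m > n\<close> stands for the negative of the basis vector with index \<open>2n + 1 - m\<close>.
\<close>

definition signed_ext :: "nat \<Rightarrow> weight \<Rightarrow> weight" where
  "signed_ext n v m = (if m \<le> n then v m else - v (Suc (2 * n) - m))"

text \<open>Precomposition on the signed coordinates, hence the action of the inverse permutation: a
  reflection applied on the left becomes a factor on the right of \<open>\<sigma>\<close>.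
  Coordinates outside \<open>1..n\<close> stay fixed as they do under
  \<open>weyl_group n\<close>.\<close>

definition perm_act :: "nat \<Rightarrow> (nat \<Rightarrow> nat) \<Rightarrow> weight \<Rightarrow> weight" where
  "perm_act n \<sigma> v = (\<lambda>p. if p \<in> {1..n} then signed_ext n v (\<sigma> p) else v p)"

definition signed_perms :: "nat \<Rightarrow> (nat \<Rightarrow> nat) set" where
  "signed_perms n = {\<sigma>. \<sigma> permutes {1..2 * n} \<and> rev_sym (2 * n) \<sigma>}"

text \<open>For \<open>i < n\<close> the mirrored transposition accompanies the first one to keep
  the reversal symmetry. The transposition of the two middle indices is its own mirror image and
  changes the sign of coordinate \<open>n\<close>.\<close>

definition simple_perm :: "nat \<Rightarrow> nat \<Rightarrow> nat \<Rightarrow> nat" where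
  "simple_perm n i = (if i < n then Transposition.transpose i (Suc i) \<circ> Transposition.transpose (2 * n - i) (Suc (2 * n) - i)
     else Transposition.transpose n (Suc n))"

lemma signed_ext_reverse:
  "1 \<le> m \<Longrightarrow> m \<le> 2 * n \<Longrightarrow> signed_ext n v (Suc (2 * n) - m) = - signed_ext n v m"
  by (auto simp: signed_ext_def)

lemma rev_symD: "rev_sym N \<sigma> \<Longrightarrow> 1 \<le> p \<Longrightarrow> p \<le> N \<Longrightarrow> \<sigma> (Suc N - p) = Suc N - \<sigma> p"
  by (auto simp: rev_sym_def)

lemma signed_permsD:
  assumes "\<sigma> \<in> signed_perms n"
  shows "\<sigma> permutes {1..2 * n}" "rev_sym (2 * n) \<sigma>"
  using assms by (auto simp: signed_perms_def)

section \<open>Simple reflections as signed permutations\<close>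

lemma reflection_simple_short:
  assumes "1 \<le> i" "i < n"
  shows "reflection n (simple_root n i) v = v \<circ> Transposition.transpose i (Suc i)"
proof -
  have *: "wt_inner n u (simple_root n i) = u i - u (Suc i)" for u
  proof -
    have "wt_inner n u (simple_root n i)
        = (\<Sum>k=1..n. (if k = i then u k else 0) - (if k = Suc i then u k else 0))"
      unfolding wt_inner_def by (rule sum.cong) (auto simp: simple_root_def eps_def assms)
    then show ?thesis
      using assms by (simp add: sum_subtractf)
  qed
  show ?thesis
    using assms unfolding reflection_def coroot_pairing_def *
    by (auto simp: fun_eq_iff simple_root_def eps_def Transposition.transpose_def field_simps)
qed

lemma reflection_simple_long:
  assumes "1 \<le> n"
  shows "reflection n (simple_root n n) v = v(n := - v n)"
proof -
  have *: "wt_inner n u (simple_root n n) = 2 * u n" for u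
  proof -
    have "wt_inner n u (simple_root n n) = (\<Sum>k=1..n. (if k = n then 2 * u k else 0))"
      unfolding wt_inner_def by (rule sum.cong) (auto simp: simple_root_def eps_def)
    then show ?thesis
      using assms by simp
  qed
  show ?thesis
    using assms unfolding reflection_def coroot_pairing_def *
    by (auto simp: fun_eq_iff simple_root_def eps_def)
qed

lemma simple_perm_apply:
  assumes "1 \<le> i" "i < n"
  shows "simple_perm n i i = Suc i" "simple_perm n i (Suc i) = i"
    "simple_perm n i (2 * n - i) = Suc (2 * n) - i" "simple_perm n i (Suc (2 * n) - i) = 2 * n - i"
    "p \<notin> {i, Suc i, 2 * n - i, Suc (2 * n) - i} \<Longrightarrow> simple_perm n i p = p"
  using assms unfolding simple_perm_def Transposition.transpose_def by auto

lemma simple_perm_signed: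
  assumes "1 \<le> i" "i \<le> n"
  shows "simple_perm n i \<in> signed_perms n"
proof -
  have "simple_perm n i permutes {1..2 * n}"
    unfolding simple_perm_def using assms
    by (auto intro!: permutes_compose permutes_swap_id)
  moreover have "simple_perm n i (Suc (2 * n) - p) = Suc (2 * n) - simple_perm n i p"
    if p: "1 \<le> p" "p \<le> 2 * n" for p
  proof (cases "i < n")
    case True
    note s = simple_perm_apply[OF assms(1) True]
    consider "p = i" | "p = Suc i" | "p = 2 * n - i" | "p = Suc (2 * n) - i"
      | "p \<notin> {i, Suc i, 2 * n - i, Suc (2 * n) - i}"
      by auto
    then show ?thesis
    proof cases
      case 5
      then have "Suc (2 * n) - p \<notin> {i, Suc i, 2 * n - i, Suc (2 * n) - i}"
        using p True by auto
      then show ?thesis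
        using 5 s(5) by simp
    next
      case 3
      then have "Suc (2 * n) - p = Suc i"
        using True by simp
      then show ?thesis
        using 3 s True by simp
    qed (use s True in simp_all)
  next
    case False
    then show ?thesis
      using assms p by (cases "p = n"; cases "p = Suc n") (auto simp: simple_perm_def Transposition.transpose_def)
  qed
  then have "rev_sym (2 * n) (simple_perm n i)"
    by (simp add: rev_sym_def)
  ultimately show ?thesis
    by (simp add: signed_perms_def)
qed

lemma signed_perms_comp:
  assumes "\<sigma> \<in> signed_perms n" "\<tau> \<in> signed_perms n"
  shows "\<sigma> \<circ> \<tau> \<in> signed_perms n"
proof -
  note s = signed_permsD[OF assms(1)] and t = signed_permsD[OF assms(2)]
  have "rev_sym (2 * n) (\<sigma> \<circ> \<tau>)"
    unfolding rev_sym_def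
  proof
    fix p assume p: "p \<in> {1..2 * n}"
    then show "(\<sigma> \<circ> \<tau>) (Suc (2 * n) - p) = Suc (2 * n) - (\<sigma> \<circ> \<tau>) p"
      using rev_symD[OF t(2), of p] rev_symD[OF s(2), of "\<tau> p"] permutes_interval_bounds[OF t(1), of p]
      by simp
  qed
  then show ?thesis
    using permutes_compose[OF t(1) s(1)] by (simp add: signed_perms_def)
qed

lemma id_signed: "id \<in> signed_perms n"
  by (auto simp: signed_perms_def rev_sym_def permutes_id)

lemma perm_act_id: "perm_act n id = id"
  by (auto simp: perm_act_def signed_ext_def fun_eq_iff)

lemma reflection_perm_act:
  assumes \<sigma>: "\<sigma> \<in> signed_perms n" and i: "1 \<le> i" "i \<le> n"
  shows "reflection n (simple_root n i) \<circ> perm_act n \<sigma> = perm_act n (\<sigma> \<circ> simple_perm n i)"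
proof (cases "i < n")
  case True
  have "simple_perm n i p = Transposition.transpose i (Suc i) p" "Transposition.transpose i (Suc i) p \<in> {1..n}" if "p \<in> {1..n}" for p
    using that True i by (auto simp: simple_perm_def Transposition.transpose_def)
  moreover have "Transposition.transpose i (Suc i) p = p" if "p \<notin> {1..n}" for p
    using that True i by (auto simp: Transposition.transpose_def)
  ultimately show ?thesis
    using True i by (auto simp: fun_eq_iff reflection_simple_short perm_act_def)
next
  case False
  then have "i = n"
    using i by simp
  moreover have "signed_ext n v (\<sigma> (Suc n)) = - signed_ext n v (\<sigma> n)" for v
    using signed_ext_reverse[of "\<sigma> n" n v] rev_symD[OF signed_permsD(2)[OF \<sigma>], of n]
      permutes_interval_bounds[OF signed_permsD(1)[OF \<sigma>], of n] i by simp
  ultimately show ?thesis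
    using i by (auto simp: fun_eq_iff reflection_simple_long perm_act_def simple_perm_def Transposition.transpose_def)
qed

lemma weyl_group_subset: "weyl_group n \<subseteq> perm_act n ` signed_perms n"
proof
  fix w assume "w \<in> weyl_group n"
  then show "w \<in> perm_act n ` signed_perms n"
  proof induction
    case one
    show ?case
      using imageI[OF id_signed, of "perm_act n" n] by (simp only: perm_act_id)
  next
    case (refl w i)
    then obtain \<sigma> where \<sigma>: "\<sigma> \<in> signed_perms n" "w = perm_act n \<sigma>"
      by blast
    show ?case
      unfolding \<sigma>(2) reflection_perm_act[OF \<sigma>(1) refl.hyps(2,3)]
      using signed_perms_comp[OF \<sigma>(1) simple_perm_signed[OF refl.hyps(2,3)]] by (rule imageI)
  qed
qed

section \<open>Generation by simple reflections\<close>

definition descent_weight :: "nat \<Rightarrow> (nat \<Rightarrow> nat) \<Rightarrow> nat" where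
  "descent_weight N \<sigma> = (\<Sum>p\<in>{1..N}. p * (N - \<sigma> p))"

text \<open>Removing the descent lowers the sum by \<open>\<sigma> i - \<sigma> (Suc i)\<close>,
  which makes it a termination measure for sorting.\<close>

lemma descent_weight_transpose:
  assumes "1 \<le> i" "i < N" "\<sigma> (Suc i) < \<sigma> i" "\<sigma> i \<le> N"
  shows "descent_weight N (\<sigma> \<circ> Transposition.transpose i (Suc i)) < descent_weight N \<sigma>"
proof -
  have split: "descent_weight N \<tau> = i * (N - \<tau> i) + Suc i * (N - \<tau> (Suc i)) +
      (\<Sum>p\<in>{1..N} - {i, Suc i}. p * (N - \<tau> p))" for \<tau>
  proof -
    have "descent_weight N \<tau> = (\<Sum>p\<in>{i, Suc i}. p * (N - \<tau> p)) +
        (\<Sum>p\<in>{1..N} - {i, Suc i}. p * (N - \<tau> p))"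
      unfolding descent_weight_def using assms by (subst sum.subset_diff[of "{i, Suc i}"]) auto
    then show ?thesis
      by simp
  qed
  have rest: "(\<Sum>p\<in>{1..N} - {i, Suc i}. p * (N - (\<sigma> \<circ> Transposition.transpose i (Suc i)) p))
      = (\<Sum>p\<in>{1..N} - {i, Suc i}. p * (N - \<sigma> p))"
    by (rule sum.cong) (auto simp: Transposition.transpose_def)
  have "N - \<sigma> i < N - \<sigma> (Suc i)"
    using assms by simp
  moreover have "descent_weight N (\<sigma> \<circ> Transposition.transpose i (Suc i)) =
      i * (N - \<sigma> (Suc i)) + Suc i * (N - \<sigma> i) + (\<Sum>p\<in>{1..N} - {i, Suc i}. p * (N - \<sigma> p))"
    using split[of "\<sigma> \<circ> Transposition.transpose i (Suc i)"] unfolding rest by simp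
  moreover have "A < B \<Longrightarrow> i * B + Suc i * A + R < i * A + Suc i * B + R" for A B R :: nat
    by simp
  ultimately show ?thesis
    unfolding split[of \<sigma>] by (simp only:)
qed

text \<open>Symmetry transports the ascents to the second half. An increasing permutation satisfies
  \<open>m \<le> \<sigma> m\<close>, and the same bound at the mirrored index gives the opposite
  inequality.\<close>

lemma signed_perm_ascending:
  assumes \<sigma>: "\<sigma> \<in> signed_perms n" and asc: "\<And>i. 1 \<le> i \<Longrightarrow> i \<le> n \<Longrightarrow> \<sigma> i \<le> \<sigma> (Suc i)"
  shows "\<sigma> = id"
proof
  fix p
  note perm = signed_permsD(1)[OF \<sigma>] and sym = signed_permsD(2)[OF \<sigma>]
  have step: "\<sigma> i < \<sigma> (Suc i)" if i: "1 \<le> i" "i < 2 * n" for i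
  proof -
    have "\<sigma> i \<noteq> \<sigma> (Suc i)"
      using inj_eq[OF permutes_inj[OF perm], of i "Suc i"] by simp
    moreover have "\<sigma> i \<le> \<sigma> (Suc i)"
    proof (cases "i \<le> n")
      case False
      then have "\<sigma> (2 * n - i) \<le> \<sigma> (Suc (2 * n - i))"
        using i by (intro asc) auto
      moreover have "\<sigma> (2 * n - i) = Suc (2 * n) - \<sigma> (Suc i)"
        using rev_symD[OF sym, of "Suc i"] i by simp
      moreover have "\<sigma> (Suc (2 * n - i)) = Suc (2 * n) - \<sigma> i"
        using rev_symD[OF sym, of i] i by (simp add: Suc_diff_le)
      ultimately show ?thesis
        using permutes_interval_bounds[OF perm, of i] permutes_interval_bounds[OF perm, of "Suc i"] i
        by simp
    qed (use asc i in simp)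
    ultimately show ?thesis
      by simp
  qed
  have ge: "m \<le> \<sigma> m" if "1 \<le> m" "m \<le> 2 * n" for m
    using that
  proof (induction m rule: dec_induct)
    case base
    then show ?case
      using permutes_interval_bounds[OF perm, of 1] by simp
  next
    case (step m)
    then show ?case
      using \<open>\<And>i. 1 \<le> i \<Longrightarrow> i < 2 * n \<Longrightarrow> \<sigma> i < \<sigma> (Suc i)\<close>[of m] by simp
  qed
  show "\<sigma> p = id p"
  proof (cases "p \<in> {1..2 * n}")
    case True
    then have "1 \<le> Suc (2 * n) - p" "Suc (2 * n) - p \<le> 2 * n"
      by auto
    then have "Suc (2 * n) - p \<le> \<sigma> (Suc (2 * n) - p)"
      by (rule ge)
    also have "\<dots> = Suc (2 * n) - \<sigma> p"
      using rev_symD[OF sym] True by simp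
    finally have "\<sigma> p \<le> p"
      using True permutes_interval_bounds[OF perm, of p] by auto
    then show ?thesis
      using ge[of p] True by simp
  next
    case False
    then show ?thesis
      using permutes_not_in[OF perm] by simp
  qed
qed

text \<open>Sorting by simple permutations. For \<open>i < n\<close> a descent at \<open>i\<close>
  has a mirrored descent at \<open>2 * n - i\<close>, so each of the two transpositions in the
  simple permutation lowers the measure.\<close>

lemma perm_act_in_weyl_group: "\<sigma> \<in> signed_perms n \<Longrightarrow> perm_act n \<sigma> \<in> weyl_group n"
proof (induction "descent_weight (2 * n) \<sigma>" arbitrary: \<sigma> rule: less_induct)
  case less
  note perm = signed_permsD(1)[OF less.prems] and sym = signed_permsD(2)[OF less.prems]
  show ?case
  proof (cases "\<exists>i. 1 \<le> i \<and> i \<le> n \<and> \<sigma> (Suc i) < \<sigma> i")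
    case True
    then obtain i where i: "1 \<le> i" "i \<le> n" "\<sigma> (Suc i) < \<sigma> i"
      by blast
    let ?s = "simple_perm n i"
    have bnd: "\<sigma> i \<le> 2 * n"
      using permutes_interval_bounds[OF perm, of i] i by simp
    have first: "descent_weight (2 * n) (\<sigma> \<circ> Transposition.transpose i (Suc i)) < descent_weight (2 * n) \<sigma>"
      using i bnd by (intro descent_weight_transpose) auto
    have "descent_weight (2 * n) (\<sigma> \<circ> ?s) < descent_weight (2 * n) \<sigma>"
    proof (cases "i < n")
      case True
      let ?\<tau> = "\<sigma> \<circ> Transposition.transpose i (Suc i)"
      let ?j = "2 * n - i"
      have \<tau>: "?\<tau> ?j = Suc (2 * n) - \<sigma> (Suc i)" "?\<tau> (Suc ?j) = Suc (2 * n) - \<sigma> i"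
        using rev_symD[OF sym, of i] rev_symD[OF sym, of "Suc i"] True i
        by (auto simp: Transposition.transpose_def Suc_diff_le)
      have "1 \<le> \<sigma> (Suc i)"
        using permutes_interval_bounds[OF perm, of "Suc i"] True by simp
      then have "descent_weight (2 * n) (?\<tau> \<circ> Transposition.transpose ?j (Suc ?j)) < descent_weight (2 * n) ?\<tau>"
        using True i bnd by (intro descent_weight_transpose, unfold \<tau>) linarith+
      moreover have "\<sigma> \<circ> ?s = ?\<tau> \<circ> Transposition.transpose ?j (Suc ?j)"
        using True by (simp add: simple_perm_def comp_assoc Suc_diff_le)
      ultimately show ?thesis
        using first by simp
    next
      case False
      then show ?thesis
        using first i by (simp add: simple_perm_def)
    qed
    moreover have s: "?s \<in> signed_perms n"
      using simple_perm_signed i by simp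
    then have "\<sigma> \<circ> ?s \<in> signed_perms n"
      using signed_perms_comp less.prems by simp
    ultimately have "perm_act n (\<sigma> \<circ> ?s) \<in> weyl_group n"
      by (rule less.hyps)
    then have "reflection n (simple_root n i) \<circ> perm_act n (\<sigma> \<circ> ?s) \<in> weyl_group n"
      using i by (intro weyl_group.refl)
    moreover have "?s \<circ> ?s = id"
    proof (cases "i < n")
      case True
      note s = simple_perm_apply[OF i(1) True]
      have "?s (?s p) = p" for p
        by (cases "p \<in> {i, Suc i, 2 * n - i, Suc (2 * n) - i}") (auto simp: s)
      then show ?thesis
        by (simp add: fun_eq_iff)
    qed (simp add: simple_perm_def)
    ultimately show ?thesis
      using reflection_perm_act[OF \<open>\<sigma> \<circ> ?s \<in> signed_perms n\<close> i(1,2)] by (simp add: comp_assoc)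
  next
    case False
    then have "\<sigma> = id"
      using signed_perm_ascending[OF less.prems] by (meson not_less)
    then show ?thesis
      using perm_act_id weyl_group.one by simp
  qed
qed

lemma inj_on_perm_act: "inj_on (perm_act n) (signed_perms n)"
proof (rule inj_onI)
  fix \<sigma> \<tau> assume s: "\<sigma> \<in> signed_perms n" and t: "\<tau> \<in> signed_perms n"
    and eq: "perm_act n \<sigma> = perm_act n \<tau>"
  \<comment> \<open>On \<open>1..n\<close> these are the coordinates of half the sum of the positive
    roots; the signed extension takes pairwise distinct values on \<open>1..2 * n\<close>.\<close>
  let ?v = "\<lambda>m. real (Suc n) - real m"
  have low: "\<sigma> p = \<tau> p" if p: "1 \<le> p" "p \<le> n" for p
  proof -
    have "signed_ext n ?v (\<sigma> p) = signed_ext n ?v (\<tau> p)"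
      using fun_cong[OF fun_cong[OF eq], of ?v p] p by (simp add: perm_act_def)
    then show ?thesis
      using permutes_interval_bounds[OF signed_permsD(1)[OF s], of p]
        permutes_interval_bounds[OF signed_permsD(1)[OF t], of p] p
      by (auto simp: signed_ext_def of_nat_diff split: if_splits)
  qed
  show "\<sigma> = \<tau>"
  proof
    fix p
    show "\<sigma> p = \<tau> p"
    proof (cases "p \<in> {1..2 * n}")
      case True
      show ?thesis
      proof (cases "p \<le> n")
        case False
        have q: "1 \<le> Suc (2 * n) - p" "Suc (2 * n) - p \<le> n" "Suc (2 * n) - (Suc (2 * n) - p) = p"
          using True False by auto
        then show ?thesis
          using rev_symD[OF signed_permsD(2)[OF s], of "Suc (2 * n) - p"]
            rev_symD[OF signed_permsD(2)[OF t], of "Suc (2 * n) - p"] low[OF q(1,2)] by simp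
      qed (use low True in simp)
    next
      case False
      then show ?thesis
        using permutes_not_in[OF signed_permsD(1)[OF s]] permutes_not_in[OF signed_permsD(1)[OF t]] by simp
    qed
  qed
qed

lemma bij_betw_perm_act: "bij_betw (perm_act n) (signed_perms n) (weyl_group n)"
  using inj_on_perm_act weyl_group_subset perm_act_in_weyl_group by (auto simp: bij_betw_def)

section \<open>Folding\<close>

definition coeff :: "nat \<Rightarrow> (nat \<Rightarrow> nat) \<Rightarrow> nat \<Rightarrow> real" where
  "coeff n a k = real (coeffA n a k)"

definition rev_cell :: "nat \<Rightarrow> nat \<times> nat \<Rightarrow> nat \<times> nat" where
  "rev_cell n = (\<lambda>(i, j). (Suc (2 * n) - j, Suc (2 * n) - i))"

text \<open>Inverse to \<open>unfold_map\<close> on points invariant under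
  \<open>rev_cell\<close>.\<close>

definition fold_map :: "nat \<Rightarrow> point \<Rightarrow> point" where
  "fold_map n x c = (if c \<in> indexC n then if fst c + snd c = Suc (2 * n) then x c / 2 else x c else 0)"

lemma indexA_eq_cells: "indexA n = cells (2 * n)"
  by (simp add: indexA_def cells_def)

lemma indexC_eq: "indexC n = {c \<in> cells (2 * n). fst c + snd c \<le> Suc (2 * n)}"
  by (auto simp: indexC_def cells_def)

lemma finite_indexC [simp]: "finite (indexC n)"
  by (simp add: indexC_eq)

lemma rev_cell_cells: "c \<in> cells (2 * n) \<Longrightarrow> rev_cell n c \<in> cells (2 * n)"
  unfolding rev_cell_def cells_def by auto

lemma rev_cell_rev_cell: "c \<in> cells (2 * n) \<Longrightarrow> rev_cell n (rev_cell n c) = c"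
  by (auto simp: rev_cell_def cells_def)

lemma rev_cell_sum:
  "c \<in> cells (2 * n) \<Longrightarrow> fst (rev_cell n c) + snd (rev_cell n c) + (fst c + snd c) = 2 * Suc (2 * n)"
  by (auto simp: rev_cell_def cells_def)

lemma rev_cell_diagonal: "fst c + snd c = Suc (2 * n) \<Longrightarrow> rev_cell n c = c"
  by (auto simp: rev_cell_def split: prod.splits)

lemma unfold_map_below: "c \<in> indexC n \<Longrightarrow> fst c + snd c \<noteq> Suc (2 * n) \<Longrightarrow> unfold_map n T c = T c"
  by (cases c) (auto simp: unfold_map_def indexC_def indexA_def)

lemma unfold_map_diagonal: "c \<in> indexC n \<Longrightarrow> fst c + snd c = Suc (2 * n) \<Longrightarrow> unfold_map n T c = 2 * T c"
  by (cases c) (auto simp: unfold_map_def indexC_def indexA_def)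

lemma unfold_map_outside: "c \<notin> cells (2 * n) \<Longrightarrow> unfold_map n T c = 0"
  by (cases c) (auto simp: unfold_map_def indexA_eq_cells)

lemma unfold_map_above:
  "c \<in> cells (2 * n) \<Longrightarrow> Suc (2 * n) < fst c + snd c \<Longrightarrow> unfold_map n T c = T (rev_cell n c)"
  by (cases c) (auto simp: unfold_map_def indexA_eq_cells rev_cell_def)

lemma unfold_map_rev_cell:
  assumes c: "c \<in> cells (2 * n)"
  shows "unfold_map n T (rev_cell n c) = unfold_map n T c"
proof -
  note r = rev_cell_cells[OF c] rev_cell_sum[OF c] rev_cell_rev_cell[OF c]
  consider "fst c + snd c < Suc (2 * n)" | "fst c + snd c = Suc (2 * n)" | "Suc (2 * n) < fst c + snd c"
    by linarith
  then show ?thesis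
  proof cases
    case 1
    then show ?thesis
      using r c unfold_map_above[of "rev_cell n c" n T] unfold_map_below[of c n T] by (simp add: indexC_eq)
  next
    case 2
    then show ?thesis
      by (simp add: rev_cell_diagonal)
  next
    case 3
    then show ?thesis
      using r c unfold_map_above[of c n T] unfold_map_below[of "rev_cell n c" n T] by (simp add: indexC_eq)
  qed
qed

lemma inj_on_unfold_map: "inj_on (unfold_map n) (spaceC n)"
proof (rule inj_onI, rule ext)
  fix S T c assume "S \<in> spaceC n" "T \<in> spaceC n" and eq: "unfold_map n S = unfold_map n T"
  then show "S c = T c"
    using unfold_map_below[of c n S] unfold_map_below[of c n T]
      unfold_map_diagonal[of c n S] unfold_map_diagonal[of c n T]
    by (cases c; cases "c \<in> indexC n"; cases "fst c + snd c = Suc (2 * n)") (auto simp: spaceC_def)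
qed

lemma fold_map_space: "fold_map n x \<in> spaceC n"
  by (simp add: fold_map_def spaceC_def)

lemma unfold_fold_map:
  assumes out: "\<And>c. c \<notin> cells (2 * n) \<Longrightarrow> x c = 0"
    and sym: "\<And>c. c \<in> cells (2 * n) \<Longrightarrow> x (rev_cell n c) = x c"
  shows "unfold_map n (fold_map n x) = x"
proof
  fix c
  consider "c \<notin> cells (2 * n)" | "c \<in> indexC n" "fst c + snd c = Suc (2 * n)"
    | "c \<in> indexC n" "fst c + snd c \<noteq> Suc (2 * n)"
    | "c \<in> cells (2 * n)" "Suc (2 * n) < fst c + snd c"
    unfolding indexC_eq by fastforce
  then show "unfold_map n (fold_map n x) c = x c"
  proof cases
    case 1
    then show ?thesis
      by (simp add: unfold_map_outside out)
  next
    case 2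
    then show ?thesis
      by (simp add: unfold_map_diagonal fold_map_def)
  next
    case 3
    then show ?thesis
      by (simp add: unfold_map_below fold_map_def)
  next
    case 4
    then have "rev_cell n c \<in> indexC n" "fst (rev_cell n c) + snd (rev_cell n c) \<noteq> Suc (2 * n)"
      using rev_cell_cells[OF 4(1)] rev_cell_sum[OF 4(1)] by (auto simp: indexC_eq)
    then show ?thesis
      using 4 by (simp add: unfold_map_above fold_map_def sym)
  qed
qed

text \<open>Off the antidiagonal a type C coordinate occurs at two cells; on it, at one cell but
  doubled. Hence the uniform factor two.\<close>

lemma sum_unfold_symmetric:
  assumes g: "\<And>c. c \<in> cells (2 * n) \<Longrightarrow> g (rev_cell n c) = g c"
  shows "(\<Sum>c\<in>cells (2 * n). unfold_map n T c * g c) = 2 * (\<Sum>c\<in>indexC n. T c * g c)"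
proof -
  let ?C = "cells (2 * n)" and ?h = "\<lambda>c. unfold_map n T c * g c"
  define L where "L = {c \<in> ?C. fst c + snd c < Suc (2 * n)}"
  define D where "D = {c \<in> ?C. fst c + snd c = Suc (2 * n)}"
  define U where "U = {c \<in> ?C. Suc (2 * n) < fst c + snd c}"
  have fin: "finite L" "finite D" "finite U"
    by (auto simp: L_def D_def U_def)
  have C: "?C = L \<union> D \<union> U" "(L \<union> D) \<inter> U = {}" "L \<inter> D = {}"
    by (auto simp: L_def D_def U_def)
  have I: "indexC n = L \<union> D"
    by (auto simp: L_def D_def indexC_eq)
  have "sum ?h U = sum ?h L"
  proof (rule sum.reindex_bij_witness[of _ "rev_cell n" "rev_cell n"])
    fix c assume "c \<in> U"
    then have c: "c \<in> ?C" "Suc (2 * n) < fst c + snd c"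
      by (auto simp: U_def)
    show "rev_cell n (rev_cell n c) = c" "rev_cell n c \<in> L" "?h (rev_cell n c) = ?h c"
      using c rev_cell_sum[OF c(1)] rev_cell_cells[OF c(1)]
      by (auto simp: rev_cell_rev_cell L_def unfold_map_rev_cell g)
  next
    fix c assume "c \<in> L"
    then have c: "c \<in> ?C" "fst c + snd c < Suc (2 * n)"
      by (auto simp: L_def)
    show "rev_cell n (rev_cell n c) = c" "rev_cell n c \<in> U"
      using c rev_cell_sum[OF c(1)] rev_cell_cells[OF c(1)] by (auto simp: rev_cell_rev_cell U_def)
  qed
  moreover have "sum ?h L = (\<Sum>c\<in>L. T c * g c)"
    by (rule sum.cong) (auto simp: L_def indexC_eq unfold_map_below)
  moreover have "sum ?h D = 2 * (\<Sum>c\<in>D. T c * g c)"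
    unfolding sum_distrib_left by (rule sum.cong) (auto simp: D_def indexC_eq unfold_map_diagonal)
  ultimately show ?thesis
    unfolding I C(1) using fin C by (simp add: sum.union_disjoint)
qed

section \<open>Type C weights in signed coordinates\<close>

lemma sum_fun_apply: "(\<Sum>i\<in>A. f i) x = (\<Sum>i\<in>A. f i x)" for f :: "'a \<Rightarrow> 'b \<Rightarrow> real"
  by (induction A rule: infinite_finite_induct) auto

lemma hw_apply: "1 \<le> m \<Longrightarrow> hw n a m = (\<Sum>k=m..n. real (a k))"
  unfolding hw_def sum_fun_apply scaleR_fun_apply fund_weight_apply
  by (rule sum.mono_neutral_cong_right) auto

lemma hw_outside: "p \<notin> {1..n} \<Longrightarrow> hw n a p = 0"
  unfolding hw_def sum_fun_apply scaleR_fun_apply fund_weight_apply by (intro sum.neutral) auto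

lemma coeff_nonneg: "0 \<le> coeff n a k"
  by (simp add: coeff_def)

lemma coeff_reverse: "1 \<le> k \<Longrightarrow> k < 2 * n \<Longrightarrow> coeff n a (2 * n - k) = coeff n a k"
  by (auto simp: coeff_def coeffA_def)

text \<open>Up to a constant vector, which cancels in all differences, the type A weight is the
  antisymmetric extension of \<lambda>. The doubled middle coefficient arises because
  \<open>a n\<close> contributes to both halves.\<close>

lemma tail_sum_coeff:
  assumes "1 \<le> m" "m \<le> 2 * n"
  shows "tail_sum (2 * n) (coeff n a) m = signed_ext n (hw n a) m + (\<Sum>k=1..n. real (a k))"
proof -
  have high: "tail_sum (2 * n) (coeff n a) l = (\<Sum>k=1..2 * n - l. real (a k))" if "n < l" "l \<le> 2 * n" for l
    unfolding tail_sum_def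
    by (rule sum.reindex_bij_witness[of _ "\<lambda>k. 2 * n - k" "\<lambda>k. 2 * n - k"])
      (use that in \<open>auto simp: coeff_def coeffA_def\<close>)
  show ?thesis
  proof (cases "m \<le> n")
    case True
    then have "1 \<le> n"
      using assms by simp
    have "tail_sum (2 * n) (coeff n a) m = sum (coeff n a) {m..<n} + coeff n a n + tail_sum (2 * n) (coeff n a) (Suc n)"
      using sum.atLeastLessThan_concat[of m n "2 * n" "coeff n a"]
        sum.atLeast_Suc_lessThan[of n "2 * n" "coeff n a"] True \<open>1 \<le> n\<close> by (simp add: tail_sum_def)
    also have "tail_sum (2 * n) (coeff n a) (Suc n) = (\<Sum>k=1..2 * n - Suc n. real (a k))"
      using \<open>1 \<le> n\<close> by (intro high) auto
    also have "sum (coeff n a) {m..<n} = (\<Sum>k=m..<n. real (a k))"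
      by (rule sum.cong) (auto simp: coeff_def coeffA_def)
    also have "coeff n a n = 2 * real (a n)"
      by (simp add: coeff_def coeffA_def)
    also have "2 * n - Suc n = n - 1"
      by simp
    finally have "tail_sum (2 * n) (coeff n a) m
        = ((\<Sum>k=m..<n. real (a k)) + real (a n)) + (real (a n) + (\<Sum>k=1..n - 1. real (a k)))"
      by simp
    also have "(\<Sum>k=m..<n. real (a k)) + real (a n) = (\<Sum>k=m..n. real (a k))"
      using True by (simp add: atLeastLessThanSuc_atLeastAtMost[symmetric])
    also have "real (a n) + (\<Sum>k=1..n - 1. real (a k)) = (\<Sum>k=1..n. real (a k))"
      using \<open>1 \<le> n\<close> by (cases n) simp_all
    finally show ?thesis
      using True assms by (simp add: signed_ext_def hw_apply)
  next
    case False
    have "{1..n} = {1..2 * n - m} \<union> {Suc (2 * n) - m..n}"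
      using False assms by auto
    then have "(\<Sum>k=1..n. real (a k)) = (\<Sum>k=1..2 * n - m. real (a k)) + (\<Sum>k=Suc (2 * n) - m..n. real (a k))"
      by (simp only:) (rule sum.union_disjoint, use assms in auto)
    then show ?thesis
      using high[of m] False assms hw_apply[of "Suc (2 * n) - m" n a] by (simp add: signed_ext_def)
  qed
qed

lemma sum_coeff:
  assumes "1 \<le> i" "i \<le> j" "j \<le> 2 * n"
  shows "sum (coeff n a) {i..<j} = signed_ext n (hw n a) i - signed_ext n (hw n a) j"
  using assms tail_sum_coeff[of i n a] tail_sum_coeff[of j n a] sum_eq_tail_sum_diff[of i j "2 * n" "coeff n a"]
  by simp

text \<open>This convention makes every root \<open>pos_root n (i, j)\<close> a difference as in
  type A, including the long simple root, which is
  \<open>signed_eps n n - signed_eps n (Suc n)\<close>.\<close>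

definition signed_eps :: "nat \<Rightarrow> nat \<Rightarrow> weight" where
  "signed_eps n m = (if m \<le> n then eps m else - eps (Suc (2 * n) - m))"

lemma simple_root_ext_eq:
  assumes "1 \<le> k" "k < 2 * n"
  shows "simple_root_ext n k = signed_eps n k - signed_eps n (Suc k)"
proof -
  consider "k < n" | "k = n" | "n < k"
    by linarith
  then show ?thesis
  proof cases
    case 1
    then show ?thesis
      by (simp add: simple_root_ext_def simple_root_def signed_eps_def)
  next
    case 2
    then show ?thesis
      using assms by (simp add: simple_root_ext_def simple_root_def signed_eps_def scaleR_2)
  next
    case 3
    then have "2 * n - k < n" "Suc (2 * n) - k = Suc (2 * n - k)"
      using assms by auto
    then show ?thesis
      using 3 by (simp add: simple_root_ext_def simple_root_def signed_eps_def)
  qed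
qed

lemma pos_root_eq:
  assumes "(i, j) \<in> cells (2 * n)"
  shows "pos_root n (i, j) = signed_eps n i - signed_eps n j"
proof -
  have "pos_root n (i, j) = (\<Sum>k=i..<j. signed_eps n k - signed_eps n (Suc k))"
    unfolding pos_root_def using assms
    by (auto intro!: sum.cong simple_root_ext_eq simp: cells_def)
  also have "\<dots> = signed_eps n i - signed_eps n j"
    using sum_Suc_diff'[of i j "\<lambda>k. - signed_eps n k"] assms by (simp add: cells_def)
  finally show ?thesis .
qed

lemma signed_eps_apply:
  assumes "1 \<le> m" "m \<le> 2 * n" "1 \<le> p" "p \<le> n"
  shows "signed_eps n m p = of_bool (m = p) - of_bool (m = Suc (2 * n) - p)"
  using assms by (auto simp: signed_eps_def eps_def)

lemma net_flow_reverse: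
  assumes sym: "\<And>c. c \<in> cells (2 * n) \<Longrightarrow> x (rev_cell n c) = x c" and p: "1 \<le> p" "p \<le> 2 * n"
  shows "net_flow (2 * n) x (Suc (2 * n) - p) = - net_flow (2 * n) x p"
proof -
  have "(\<Sum>q\<in>{Suc (2 * n) - p<..2 * n}. x (Suc (2 * n) - p, q)) = (\<Sum>q\<in>{1..<p}. x (q, p))"
  proof (rule sum.reindex_bij_witness[of _ "\<lambda>q. Suc (2 * n) - q" "\<lambda>q. Suc (2 * n) - q"])
    fix q assume q: "q \<in> {Suc (2 * n) - p<..2 * n}"
    then have "(Suc (2 * n) - q, p) \<in> cells (2 * n)"
      using p by (auto simp: cells_def)
    from sym[OF this] show "x (Suc (2 * n) - q, p) = x (Suc (2 * n) - p, q)"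
      using q by (simp add: rev_cell_def)
  qed (use p in auto)
  moreover have "(\<Sum>q\<in>{1..<Suc (2 * n) - p}. x (q, Suc (2 * n) - p)) = (\<Sum>q\<in>{p<..2 * n}. x (p, q))"
  proof (rule sum.reindex_bij_witness[of _ "\<lambda>q. Suc (2 * n) - q" "\<lambda>q. Suc (2 * n) - q"])
    fix q assume q: "q \<in> {1..<Suc (2 * n) - p}"
    then have "(p, Suc (2 * n) - q) \<in> cells (2 * n)"
      using p by (auto simp: cells_def)
    moreover have "Suc (2 * n) - (Suc (2 * n) - q) = q"
      using q by auto
    ultimately show "x (p, Suc (2 * n) - q) = x (q, Suc (2 * n) - p)"
      using sym[of "(p, Suc (2 * n) - q)"] by (simp add: rev_cell_def)
  qed (use p in auto)
  ultimately show ?thesis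
    by (simp add: net_flow_def)
qed

text \<open>The functional \<open>f\<close> reads off coordinate \<open>p\<close> and is
  antisymmetric under reversal. Unfolding doubles the sum, the antisymmetry of the net flow doubles
  the result, and the factors cancel.\<close>

lemma root_sum_apply:
  assumes p: "1 \<le> p" "p \<le> n"
  shows "(\<Sum>c\<in>indexC n. T c *\<^sub>R pos_root n c) p = net_flow (2 * n) (unfold_map n T) p"
proof -
  let ?x = "unfold_map n T"
  define f :: "nat \<Rightarrow> real" where "f m = of_bool (m = p) - of_bool (m = Suc (2 * n) - p)" for m
  have f_rev: "f (Suc (2 * n) - m) = - f m" if "1 \<le> m" "m \<le> 2 * n" for m
    using that p by (auto simp: f_def)
  have "(\<Sum>c\<in>indexC n. T c *\<^sub>R pos_root n c) p = (\<Sum>c\<in>indexC n. T c * (f (fst c) - f (snd c)))"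
    unfolding sum_fun_apply
  proof (rule sum.cong[OF HOL.refl])
    fix c assume "c \<in> indexC n"
    then have c: "(fst c, snd c) \<in> cells (2 * n)"
      by (simp add: indexC_eq)
    then have "1 \<le> fst c" "fst c \<le> 2 * n" "1 \<le> snd c" "snd c \<le> 2 * n"
      by (auto simp: cells_def)
    then have "signed_eps n (fst c) p = f (fst c)" "signed_eps n (snd c) p = f (snd c)"
      unfolding f_def using p by (blast intro: signed_eps_apply)+
    then show "(T c *\<^sub>R pos_root n c) p = T c * (f (fst c) - f (snd c))"
      using pos_root_eq[OF c] by simp
  qed
  also have "2 * \<dots> = (\<Sum>c\<in>cells (2 * n). ?x c * (f (fst c) - f (snd c)))"
    by (rule sum_unfold_symmetric[symmetric]) (auto simp: rev_cell_def cells_def f_rev)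
  also have "\<dots> = (\<Sum>m\<in>{1..2 * n}. f m * net_flow (2 * n) ?x m)"
    by (rule sum_net_flow[symmetric])
  also have "\<dots> = (\<Sum>m\<in>{1..2 * n}. if m = p then net_flow (2 * n) ?x m else 0) -
      (\<Sum>m\<in>{1..2 * n}. if m = Suc (2 * n) - p then net_flow (2 * n) ?x m else 0)"
    unfolding sum_subtractf[symmetric] by (rule sum.cong) (auto simp: f_def)
  also have "\<dots> = net_flow (2 * n) ?x p - net_flow (2 * n) ?x (Suc (2 * n) - p)"
    using p by (subst (1 2) sum.delta) auto
  also have "\<dots> = 2 * net_flow (2 * n) ?x p"
    using net_flow_reverse[of n ?x p] p by (simp add: unfold_map_rev_cell)
  finally show ?thesis
    by simp
qed

lemma root_sum_outside:
  assumes "p \<notin> {1..n}"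
  shows "(\<Sum>c\<in>indexC n. T c *\<^sub>R pos_root n c) p = 0"
  unfolding sum_fun_apply
proof (rule sum.neutral, safe)
  fix i j assume "(i, j) \<in> indexC n"
  then have c: "(i, j) \<in> cells (2 * n)"
    by (simp add: indexC_eq)
  then have "signed_eps n i p = 0" "signed_eps n j p = 0"
    using assms by (auto simp: signed_eps_def eps_def cells_def)
  then show "(T (i, j) *\<^sub>R pos_root n (i, j)) p = 0"
    using pos_root_eq[OF c] by simp
qed

text \<open>The equations at positions above \<open>n\<close> are the negatives of those at the
  mirrored positions, so the type C weight condition already amounts to the full type A condition on
  the unfolded point.\<close>

lemma point_weight_eq_iff:
  assumes \<sigma>: "\<sigma> \<in> signed_perms n"
  shows "point_weight n a T = perm_act n \<sigma> (hw n a) \<longleftrightarrow>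
    (\<forall>p\<in>{1..2 * n}. net_flow (2 * n) (unfold_map n T) p =
      tail_sum (2 * n) (coeff n a) p - tail_sum (2 * n) (coeff n a) (\<sigma> p))"
proof -
  let ?f = "\<lambda>p. net_flow (2 * n) (unfold_map n T) p" and ?e = "signed_ext n (hw n a)"
  note perm = signed_permsD(1)[OF \<sigma>] and sym = signed_permsD(2)[OF \<sigma>]
  have tail: "tail_sum (2 * n) (coeff n a) p - tail_sum (2 * n) (coeff n a) (\<sigma> p) = ?e p - ?e (\<sigma> p)"
    if "1 \<le> p" "p \<le> 2 * n" for p
    using that tail_sum_coeff[of p n a] tail_sum_coeff[of "\<sigma> p" n a] permutes_interval_bounds[OF perm that]
    by simp
  have "point_weight n a T = perm_act n \<sigma> (hw n a) \<longleftrightarrow> (\<forall>p. point_weight n a T p = perm_act n \<sigma> (hw n a) p)"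
    by (simp add: fun_eq_iff)
  also have "\<dots> \<longleftrightarrow> (\<forall>p\<in>{1..n}. ?f p = ?e p - ?e (\<sigma> p))"
  proof -
    have "point_weight n a T p = perm_act n \<sigma> (hw n a) p \<longleftrightarrow> (p \<in> {1..n} \<longrightarrow> ?f p = ?e p - ?e (\<sigma> p))" for p
    proof (cases "p \<in> {1..n}")
      case True
      then have "point_weight n a T p = ?e p - ?f p"
        using root_sum_apply[of p n T] by (simp add: point_weight_def signed_ext_def)
      then show ?thesis
        using True by (auto simp: perm_act_def)
    next
      case False
      then show ?thesis
        using root_sum_outside[OF False, of T] hw_outside[OF False, of a]
        by (auto simp: point_weight_def perm_act_def)
    qed
    then show ?thesis
      by blast
  qed
  also have "\<dots> \<longleftrightarrow> (\<forall>p\<in>{1..2 * n}. ?f p = ?e p - ?e (\<sigma> p))"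
  proof
    assume low: "\<forall>p\<in>{1..n}. ?f p = ?e p - ?e (\<sigma> p)"
    show "\<forall>p\<in>{1..2 * n}. ?f p = ?e p - ?e (\<sigma> p)"
    proof
      fix p assume p: "p \<in> {1..2 * n}"
      show "?f p = ?e p - ?e (\<sigma> p)"
      proof (cases "p \<le> n")
        case False
        let ?q = "Suc (2 * n) - p"
        have q: "?q \<in> {1..n}" "Suc (2 * n) - ?q = p" "1 \<le> ?q" "?q \<le> 2 * n"
          using p False by auto
        have "?f p = - ?f ?q"
          using net_flow_reverse[of n "unfold_map n T" ?q] q unfold_map_rev_cell by simp
        also have "\<dots> = ?e (\<sigma> ?q) - ?e ?q"
          using low q(1) by simp
        also have "?e ?q = - ?e p"
          using p by (intro signed_ext_reverse) auto
        also have "\<sigma> ?q = Suc (2 * n) - \<sigma> p"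
          using p by (intro rev_symD[OF sym]) auto
        also have "?e (Suc (2 * n) - \<sigma> p) = - ?e (\<sigma> p)"
          using p permutes_interval_bounds[OF perm, of p] by (intro signed_ext_reverse) auto
        finally show ?thesis
          by simp
      qed (use low p in auto)
    qed
  qed auto
  finally show ?thesis
    using tail by auto
qed

section \<open>Dyck paths\<close>

text \<open>The hook path stopped at \<open>(m, j)\<close>: with \<open>m = j - 1\<close> it is the
  whole hook, with \<open>m = 2 * n + 1 - j\<close> the part up to the antidiagonal.\<close>

definition leg_path :: "nat \<Rightarrow> nat \<Rightarrow> nat \<Rightarrow> (nat \<times> nat) list" where
  "leg_path i j m = map (\<lambda>k. (i, k)) [i + 1..<j + 1] @ map (\<lambda>k. (k, j)) [i + 1..<m + 1]"

lemma set_leg_path: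
  "i \<le> m \<Longrightarrow> m < j \<Longrightarrow> set (leg_path i j m) = {(p, q). p < q \<and> (p = i \<and> q \<le> j \<or> q = j \<and> i \<le> p \<and> p \<le> m)}"
  by (auto simp: leg_path_def)

lemma set_hook_path: "i < j \<Longrightarrow> set (hook_path i j) = hook i j"
  by (auto simp: hook_path_def hook_def)

lemma successively_leg_path: "i < j \<Longrightarrow> successively dyck_step (leg_path i j m)"
proof -
  assume "i < j"
  have upt: "successively (\<lambda>x y. y = Suc x) [k..<l]" for k l
    by (simp add: successively_conv_nth del: upt.simps)
  have "successively dyck_step (map (\<lambda>k. (i, k)) [i + 1..<j + 1])"
    "successively dyck_step (map (\<lambda>k. (k, j)) [i + 1..<m + 1])"
    unfolding successively_map using upt
    by (auto intro: successively_mono simp: dyck_step_def simp del: upt.simps upt_Suc)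
  moreover have "dyck_step (i, j) (i + 1, j)"
    by (simp add: dyck_step_def)
  ultimately show ?thesis
    unfolding leg_path_def successively_append_iff using \<open>i < j\<close>
    by (cases "m \<le> i") (simp_all add: last_map hd_map del: upt.simps upt_Suc)
qed

lemma last_leg_path: "i \<le> m \<Longrightarrow> m < j \<Longrightarrow> last (leg_path i j m) = (m, j)"
  by (cases "i = m") (auto simp: leg_path_def last_map)

lemma hd_leg_path: "i < j \<Longrightarrow> hd (leg_path i j m) = (i, Suc i)"
  by (auto simp: leg_path_def hd_append hd_map)

lemma leg_sum_le:
  assumes T: "T \<in> polytopeC n a" and i: "1 \<le> i" "i \<le> m" "m < j" "m + j \<le> Suc (2 * n)"
  shows "j = Suc m \<Longrightarrow> sum T (set (leg_path i j m)) \<le> (\<Sum>k=i..m. real (a k))"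
    and "m + j = Suc (2 * n) \<Longrightarrow> sum T (set (leg_path i j m)) \<le> (\<Sum>k=i..n. real (a k))"
proof -
  have path: "dyck_pathC n (leg_path i j m)" if "j = Suc m \<or> m + j = Suc (2 * n)"
    unfolding dyck_pathC_def
    using i that successively_leg_path[of i j m] last_leg_path[of i m j] hd_leg_path[of i j m]
      set_leg_path[of i m j]
    by (auto simp: indexC_def leg_path_def)
  then have *: "sum T (set (leg_path i j m)) \<le> path_boundC n a (leg_path i j m)"
    if "j = Suc m \<or> m + j = Suc (2 * n)"
    using T that by (auto simp: polytopeC_def path_sum_def)
  show "sum T (set (leg_path i j m)) \<le> (\<Sum>k=i..m. real (a k))" if "j = Suc m"
    using * that i last_leg_path[of i m j] hd_leg_path[of i j m] by (simp add: path_boundC_def)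
  show "sum T (set (leg_path i j m)) \<le> (\<Sum>k=i..n. real (a k))" if "m + j = Suc (2 * n)"
  proof (cases "j = Suc m")
    case True
    \<comment> \<open>A path ending on the diagonal and the antidiagonal at once is bounded by the
      first branch of \<open>path_boundC\<close>; for \<open>m = n\<close> the two branches
      agree.\<close>
    then have "m = n"
      using that by simp
    then show ?thesis
      using *[OF disjI1[OF True]] True last_leg_path[OF i(2,3)] hd_leg_path[of i j m] i(2,3)
      unfolding path_boundC_def by simp
  next
    case False
    then show ?thesis
      using * that i last_leg_path[of i m j] hd_leg_path[of i j m] by (simp add: path_boundC_def)
  qed
qed

lemma hook_rev_cell:
  assumes "(i, j) \<in> cells (2 * n)"
  shows "hook (Suc (2 * n) - j) (Suc (2 * n) - i) = rev_cell n ` hook i j"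
proof
  have sub: "rev_cell n ` hook p q \<subseteq> hook (Suc (2 * n) - q) (Suc (2 * n) - p)" if "(p, q) \<in> cells (2 * n)" for p q
    using that by (auto simp: hook_def rev_cell_def cells_def)
  show "rev_cell n ` hook i j \<subseteq> hook (Suc (2 * n) - j) (Suc (2 * n) - i)"
    using assms by (rule sub)
  have r: "(Suc (2 * n) - j, Suc (2 * n) - i) \<in> cells (2 * n)"
    "Suc (2 * n) - (Suc (2 * n) - i) = i" "Suc (2 * n) - (Suc (2 * n) - j) = j"
    using assms by (auto simp: cells_def)
  show "hook (Suc (2 * n) - j) (Suc (2 * n) - i) \<subseteq> rev_cell n ` hook i j"
  proof
    fix c assume c: "c \<in> hook (Suc (2 * n) - j) (Suc (2 * n) - i)"
    then have "rev_cell n c \<in> hook i j"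
      using sub[OF r(1)] r(2,3) by auto
    moreover have "rev_cell n (rev_cell n c) = c"
      using hook_subset_cells[OF r(1)] c by (intro rev_cell_rev_cell) auto
    ultimately show "c \<in> rev_cell n ` hook i j"
      by (metis imageI)
  qed
qed

lemma inj_on_rev_cell: "inj_on (rev_cell n) (cells (2 * n))"
  by (rule inj_on_inverseI[of _ "rev_cell n"]) (rule rev_cell_rev_cell)

lemma polytopeC_nonneg: "T \<in> polytopeC n a \<Longrightarrow> 0 \<le> T c"
  by (cases "c \<in> indexC n"; cases c) (auto simp: polytopeC_def spaceC_def)

text \<open>For \<open>j > n\<close> the hook meets the antidiagonal at \<open>(m, j)\<close> with
  \<open>m = 2 * n + 1 - j\<close>. The part beyond folds back onto row \<open>m\<close>, so the
  hook sum is the sum over two type C paths ending at \<open>(m, j)\<close>, one starting in row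
  \<open>i\<close> and one in row \<open>m\<close>; the doubled antidiagonal coordinate supplies
  their common end twice. The bounds add up to \<open>hw n a i + hw n a m\<close>.\<close>

lemma unfold_hook_sum_le:
  assumes T: "T \<in> polytopeC n a" and ij: "(i, j) \<in> cells (2 * n)" and low: "i + j \<le> Suc (2 * n)"
  shows "sum (unfold_map n T) (hook i j) \<le> sum (coeff n a) {i..<j}"
proof (cases "j \<le> n")
  case True
  have b: "1 \<le> i" "i < j"
    using ij by (auto simp: cells_def)
  have hook: "hook i j = set (leg_path i j (j - 1))"
    using b by (subst set_leg_path) (auto simp: hook_def)
  have "sum (unfold_map n T) (hook i j) = sum T (hook i j)"
    by (rule sum.cong[OF HOL.refl], rule unfold_map_below)
      (use b True in \<open>auto simp: hook_def indexC_def\<close>)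
  also have "\<dots> \<le> (\<Sum>k=i..j - 1. real (a k))"
    unfolding hook using b True by (intro leg_sum_le(1)[OF T]) auto
  also have "\<dots> = sum (coeff n a) {i..<j}"
    using b True by (intro sum.cong) (auto simp: coeff_def coeffA_def)
  finally show ?thesis .
next
  case False
  let ?m = "Suc (2 * n) - j"
  have b: "1 \<le> i" "i < j" "j \<le> 2 * n" "i \<le> ?m" "?m < j" "1 \<le> ?m" "?m \<le> n" "i \<le> n" "?m + j = Suc (2 * n)"
    using ij low False by (auto simp: cells_def)
  let ?L = "set (leg_path i j ?m)"
  have L: "?L = {(p, q). p < q \<and> (p = i \<and> q \<le> j \<or> q = j \<and> i \<le> p \<and> p \<le> ?m)}"
    using b by (intro set_leg_path) auto
  have hook: "hook i j = ?L \<union> (\<lambda>k. (k, j)) ` {?m<..<j}"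
    unfolding L using b by (auto simp: hook_def)
  have disj: "?L \<inter> (\<lambda>k. (k, j)) ` {?m<..<j} = {}"
    unfolding L using b by auto
  have corner: "(?m, j) \<in> ?L"
    unfolding L using b by auto
  have "sum (unfold_map n T) ?L = sum T ?L + T (?m, j)"
  proof -
    have "sum (unfold_map n T) (?L - {(?m, j)}) = sum T (?L - {(?m, j)})"
    proof (rule sum.cong[OF HOL.refl], rule unfold_map_below)
      fix c assume c: "c \<in> ?L - {(?m, j)}"
      obtain p q where pq: "c = (p, q)"
        by (cases c)
      have "p < q" "i \<le> p" "p + q < Suc (2 * n)"
        using c b unfolding L pq by auto
      then show "c \<in> indexC n" "fst c + snd c \<noteq> Suc (2 * n)"
        using b by (auto simp: pq indexC_def)
    qed
    moreover have "unfold_map n T (?m, j) = 2 * T (?m, j)"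
      using b by (intro unfold_map_diagonal) (auto simp: indexC_def)
    ultimately show ?thesis
      using sum.remove[OF _ corner, of "unfold_map n T"] sum.remove[OF _ corner, of T] by simp
  qed
  moreover have "sum (unfold_map n T) ((\<lambda>k. (k, j)) ` {?m<..<j}) = (\<Sum>q\<in>{?m<..<j}. T (?m, q))"
  proof -
    have "sum (unfold_map n T) ((\<lambda>k. (k, j)) ` {?m<..<j}) = (\<Sum>k\<in>{?m<..<j}. unfold_map n T (k, j))"
      by (subst sum.reindex) (auto simp: inj_on_def)
    also have "\<dots> = (\<Sum>q\<in>{?m<..<j}. T (?m, q))"
    proof (rule sum.reindex_bij_witness[of _ "\<lambda>q. Suc (2 * n) - q" "\<lambda>q. Suc (2 * n) - q"])
      fix k assume k: "k \<in> {?m<..<j}"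
      then have "unfold_map n T (k, j) = T (rev_cell n (k, j))"
        using b by (intro unfold_map_above) (auto simp: cells_def)
      then show "T (?m, Suc (2 * n) - k) = unfold_map n T (k, j)"
        by (simp add: rev_cell_def)
    qed (use b in auto)
    finally show ?thesis .
  qed
  moreover have "sum T (set (leg_path ?m j ?m)) = T (?m, j) + (\<Sum>q\<in>{?m<..<j}. T (?m, q))"
  proof -
    have "set (leg_path ?m j ?m) = insert (?m, j) ((\<lambda>q. (?m, q)) ` {?m<..<j})"
      using b by (subst set_leg_path) auto
    then show ?thesis
      by (simp add: sum.reindex inj_on_def image_iff)
  qed
  moreover have "sum T ?L \<le> hw n a i" "sum T (set (leg_path ?m j ?m)) \<le> hw n a ?m"
    using b leg_sum_le(2)[OF T, of i ?m j] leg_sum_le(2)[OF T, of ?m ?m j] by (simp_all add: hw_apply)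
  moreover have "sum (coeff n a) {i..<j} = hw n a i + hw n a ?m"
    using sum_coeff[of i j n a] b False by (simp add: signed_ext_def)
  moreover have "sum (unfold_map n T) (hook i j)
      = sum (unfold_map n T) ?L + sum (unfold_map n T) ((\<lambda>k. (k, j)) ` {?m<..<j})"
    unfolding hook using disj by (intro sum.union_disjoint) auto
  ultimately show ?thesis
    by simp
qed

lemma feasible_unfold_map:
  assumes T: "T \<in> polytopeC n a"
  shows "feasible (2 * n) (coeff n a) (unfold_map n T)"
  unfolding feasible_def
proof (intro conjI allI impI ballI)
  fix c :: "nat \<times> nat"
  show "0 \<le> unfold_map n T c"
    using polytopeC_nonneg[OF T] by (cases c) (auto simp: unfold_map_def)
  assume c: "c \<in> cells (2 * n)"
  obtain i j where ij: "c = (i, j)"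
    by (cases c)
  have "sum (unfold_map n T) (hook i j) \<le> sum (coeff n a) {i..<j}"
  proof (cases "i + j \<le> Suc (2 * n)")
    case True
    then show ?thesis
      using unfold_hook_sum_le[OF T] c ij by simp
  next
    case False
    let ?i = "Suc (2 * n) - j" and ?j = "Suc (2 * n) - i"
    have b: "1 \<le> i" "i < j" "j \<le> 2 * n"
      using c ij by (auto simp: cells_def)
    have r: "(?i, ?j) \<in> cells (2 * n)" "?i + ?j \<le> Suc (2 * n)" "1 \<le> ?i" "?i \<le> ?j" "?j \<le> 2 * n"
      using b False by (auto simp: cells_def)
    have "sum (unfold_map n T) (hook ?i ?j) = (\<Sum>c\<in>hook i j. unfold_map n T (rev_cell n c))"
      using c ij by (simp add: hook_rev_cell sum.reindex inj_on_subset[OF inj_on_rev_cell hook_subset_cells] comp_def)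
    also have "\<dots> = sum (unfold_map n T) (hook i j)"
      using c ij hook_subset_cells[of i j "2 * n"] by (intro sum.cong) (auto simp: unfold_map_rev_cell)
    finally have "sum (unfold_map n T) (hook i j) \<le> sum (coeff n a) {?i..<?j}"
      using unfold_hook_sum_le[OF T r(1,2)] by simp
    also have "\<dots> = sum (coeff n a) {i..<j}"
      using sum_coeff[OF r(3-5)] sum_coeff[of i j n a] b
        signed_ext_reverse[of i n "hw n a"] signed_ext_reverse[of j n "hw n a"] by simp
    finally show ?thesis .
  qed
  then show "case c of (i, j) \<Rightarrow> sum (unfold_map n T) (hook i j) \<le> sum (coeff n a) {i..<j}"
    by (simp add: ij)
qed (simp add: unfold_map_outside)

section \<open>Dyck paths as chains\<close>

lemma dyck_path_sorted:
  assumes "successively dyck_step d"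
  shows "sorted_wrt (\<lambda>c e. fst c \<le> fst e \<and> snd c \<le> snd e) d"
proof -
  have "successively (\<lambda>c e. fst c \<le> fst e \<and> snd c \<le> snd e) d"
    using assms by (rule successively_mono) (auto simp: dyck_step_def)
  then show ?thesis
    by (subst (asm) successively_conv_sorted_wrt) (auto simp: transp_def intro: order.trans)
qed

lemma dyck_path_chain:
  assumes s: "successively dyck_step d" and c: "c \<in> set d"
  shows "e \<in> set d \<Longrightarrow> fst c \<le> fst e \<and> snd c \<le> snd e \<or> fst e \<le> fst c \<and> snd e \<le> snd c"
    and "fst (hd d) \<le> fst c" "fst c \<le> fst (last d)" "snd c \<le> snd (last d)"
proof -
  let ?P = "\<lambda>c e. fst c \<le> fst e \<and> snd c \<le> snd e"
  have nth: "?P (d ! i) (d ! j)" if "i \<le> j" "j < length d" for i j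
    using sorted_wrt_nth_less[OF dyck_path_sorted[OF s], of i j] that by (cases "i = j") auto
  obtain i where i: "i < length d" "c = d ! i"
    using c by (auto simp: in_set_conv_nth)
  show "?P c e \<or> ?P e c" if e: "e \<in> set d"
  proof -
    obtain j where j: "j < length d" "e = d ! j"
      using e by (auto simp: in_set_conv_nth)
    show ?thesis
      using nth[of i j] nth[of j i] unfolding i(2) j(2) using i(1) j(1) by linarith
  qed
  have "d \<noteq> []"
    using i by auto
  then show "fst (hd d) \<le> fst c" "fst c \<le> fst (last d)" "snd c \<le> snd (last d)"
    using nth[of 0 i] nth[of i "length d - 1"] i(1) unfolding i(2)
    by (auto simp: hd_conv_nth last_conv_nth)
qed

section \<open>The extremal points of the type C polytope\<close>

lemma matching_point_rev_cell:
  assumes \<sigma>: "\<sigma> \<in> signed_perms n" and c: "c \<in> cells (2 * n)"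
  shows "matching_point (2 * n) (coeff n a) \<sigma> (rev_cell n c) = matching_point (2 * n) (coeff n a) \<sigma> c"
  unfolding matching_point_def
proof (rule sum.reindex_bij_witness[of _ "\<lambda>k. 2 * n - k" "\<lambda>k. 2 * n - k"])
  fix k assume k: "k \<in> {1..<2 * n}"
  have "c \<in> matching (2 * n) \<sigma> (2 * n - k) \<longleftrightarrow> rev_cell n c \<in> matching (2 * n) \<sigma> k"
    using rev_sym_matching[OF signed_permsD[OF \<sigma>], of "2 * n - k" "fst c" "snd c"] c k
    by (simp add: rev_cell_def split_def)
  then show "coeff n a (2 * n - k) * of_bool (c \<in> matching (2 * n) \<sigma> (2 * n - k)) =
      coeff n a k * of_bool (rev_cell n c \<in> matching (2 * n) \<sigma> k)"
    using k coeff_reverse[of k n a] by simp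
qed auto

text \<open>At an antidiagonal cell the levels \<open>k\<close> and \<open>2 * n - k\<close>
  contribute equally and level \<open>n\<close> carries the even coefficient \<open>2 * a n\<close>,
  so the coordinate is even.\<close>

lemma matching_point_diagonal_int:
  assumes \<sigma>: "\<sigma> \<in> signed_perms n" and c: "c \<in> indexC n" "fst c + snd c = Suc (2 * n)"
  shows "matching_point (2 * n) (coeff n a) \<sigma> c / 2 \<in> \<int>"
proof -
  let ?f = "\<lambda>k. coeff n a k * of_bool (c \<in> matching (2 * n) \<sigma> k)"
  have n: "1 \<le> n"
    using c by (auto simp: indexC_def)
  have rev: "?f (2 * n - k) = ?f k" if "1 \<le> k" "k < 2 * n" for k
    using rev_sym_matching[OF signed_permsD[OF \<sigma>], of k "fst c" "snd c"] rev_cell_diagonal[OF c(2)] c that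
      coeff_reverse[OF that, of a]
    by (simp add: rev_cell_def split_def indexC_eq)
  have "sum ?f {Suc n..<2 * n} = sum ?f {1..<n}"
    by (rule sum.reindex_bij_witness[of _ "\<lambda>k. 2 * n - k" "\<lambda>k. 2 * n - k"])
      (use rev in auto)
  moreover have "sum ?f {1..<2 * n} = sum ?f {1..<n} + (?f n + sum ?f {Suc n..<2 * n})"
    using sum.atLeastLessThan_concat[of 1 n "2 * n" ?f] sum.atLeast_Suc_lessThan[of n "2 * n" ?f] n by simp
  ultimately have "matching_point (2 * n) (coeff n a) \<sigma> c / 2
      = sum ?f {1..<n} + real (a n) * of_bool (c \<in> matching (2 * n) \<sigma> n)"
    by (simp add: matching_point_def coeff_def coeffA_def)
  moreover have "sum ?f {1..<n} \<in> \<int>"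
    by (rule Ints_sum) (simp add: coeff_def)
  moreover have "real (a n) * of_bool (c \<in> matching (2 * n) \<sigma> n) \<in> \<int>"
    by simp
  ultimately show ?thesis
    by (simp only: Ints_add)
qed

text \<open>
  A path ending on the antidiagonal is completed by its reversal to a type A path whose sum and
  bound are twice those of the original path.
\<close>

lemma fold_path_sum_le:
  assumes \<sigma>: "\<sigma> \<in> signed_perms n" and d: "dyck_pathC n d"
  shows "sum (fold_map n (matching_point (2 * n) (coeff n a) \<sigma>)) (set d) \<le> path_boundC n a d"
proof -
  let ?x = "matching_point (2 * n) (coeff n a) \<sigma>" and ?S = "set d"
  let ?T = "fold_map n ?x"
  note perm = signed_permsD(1)[OF \<sigma>]
  define i where "i = fst (hd d)"
  have d': "d \<noteq> []" "?S \<subseteq> indexC n" "successively dyck_step d"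
    using d by (auto simp: dyck_pathC_def)
  note chain = dyck_path_chain[OF d'(3)]
  have last: "last d \<in> ?S" and hd: "hd d \<in> ?S"
    using d' by auto
  have i: "1 \<le> i" "i \<le> n"
    using subsetD[OF d'(2) hd] by (auto simp: i_def indexC_def)
  show ?thesis
  proof (cases "fst (last d) + snd (last d) = Suc (2 * n)")
    case True
    have S: "c \<in> cells (2 * n)" "fst c + snd c \<le> Suc (2 * n)" if "c \<in> ?S" for c
      using subsetD[OF d'(2) that] by (auto simp: indexC_eq)
    let ?R = "?S \<union> rev_cell n ` ?S"
    have R: "c \<in> cells (2 * n)" if "c \<in> ?R" for c
      using that S rev_cell_cells by blast
    have R_iff: "rev_cell n c \<in> ?R \<longleftrightarrow> c \<in> ?R" if "c \<in> cells (2 * n)" for c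
      using rev_cell_rev_cell[OF that] rev_cell_rev_cell[OF S(1)] by (auto intro: image_eqI[OF sym])
    have RC: "?R \<inter> indexC n = ?S"
    proof -
      have "rev_cell n c \<in> ?S" if "c \<in> ?S" "rev_cell n c \<in> indexC n" for c
      proof -
        have "fst c + snd c = Suc (2 * n)"
          using rev_cell_sum[OF S(1)[OF that(1)]] S(2)[OF that(1)] that(2) by (auto simp: indexC_eq)
        then show ?thesis
          using rev_cell_diagonal that(1) by simp
      qed
      then show ?thesis
        using d'(2) by auto
    qed
    have unf: "unfold_map n ?T = ?x"
      by (rule unfold_fold_map) (simp_all add: matching_point_outside matching_point_rev_cell[OF \<sigma>])
    have "2 * sum ?T ?S = 2 * (\<Sum>c\<in>indexC n. ?T c * of_bool (c \<in> ?R))"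
      using RC sum.inter_restrict[of "indexC n" ?T ?R] by (auto simp: Int_commute of_bool_def if_distrib intro!: sum.cong cong: if_cong)
    also have "\<dots> = (\<Sum>c\<in>cells (2 * n). unfold_map n ?T c * of_bool (c \<in> ?R))"
      by (rule sum_unfold_symmetric[symmetric]) (simp only: R_iff)
    also have "\<dots> = sum ?x ?R"
      unfolding unf using R by (intro sum.mono_neutral_cong_right) auto
    also have "\<dots> \<le> sum (coeff n a) {i..<Suc (2 * n) - i}"
    proof (rule sum_matching_point_chain_le[OF perm coeff_nonneg])
      have lo: "i \<le> fst c" "snd c \<le> Suc (2 * n) - i" if "c \<in> ?S" for c
        using chain(2)[OF that] S(2)[OF that] by (auto simp: i_def)
      have hi: "i \<le> fst (rev_cell n c)" "snd (rev_cell n c) \<le> Suc (2 * n) - i" if "c \<in> ?S" for c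
        using lo[OF that] S(1)[OF that] i by (auto simp: rev_cell_def cells_def)
      have "i \<le> fst c \<and> snd c \<le> Suc (2 * n) - i" if "c \<in> ?R" for c
        using that lo hi by (elim UnE imageE) blast+
      then show "i \<le> p \<and> q \<le> Suc (2 * n) - i" if "(p, q) \<in> ?R" for p q
        using that by (metis fst_conv snd_conv)
      \<comment> \<open>The last cell is fixed by the reversal: the path lies weakly below it and
        the reversed path weakly above, so their union is again a chain.\<close>
      let ?m = "last d"
      have below: "fst c \<le> fst ?m" "snd c \<le> snd ?m" if "c \<in> ?S" for c
        using chain(3,4)[OF that] by auto
      have above: "fst ?m \<le> fst (rev_cell n c)" "snd ?m \<le> snd (rev_cell n c)" if "c \<in> ?S" for c
        using below[OF that] True S(1)[OF that] by (auto simp: rev_cell_def cells_def)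
      have comp: "fst (rev_cell n c) \<le> fst (rev_cell n e) \<and> snd (rev_cell n c) \<le> snd (rev_cell n e)"
        if "fst e \<le> fst c" "snd e \<le> snd c" for c e
        using that by (auto simp: rev_cell_def split_def)
      have "fst c \<le> fst e \<and> snd c \<le> snd e \<or> fst e \<le> fst c \<and> snd e \<le> snd c" if "c \<in> ?R" "e \<in> ?R" for c e
        using that
      proof (elim UnE imageE)
        assume "c \<in> ?S" "e \<in> ?S"
        then show ?thesis
          using chain(1) by blast
      next
        fix e' assume "c \<in> ?S" "e = rev_cell n e'" "e' \<in> ?S"
        then show ?thesis
          using below above by (meson order.trans)
      next
        fix c' assume "e \<in> ?S" "c = rev_cell n c'" "c' \<in> ?S"
        then show ?thesis
          using below above by (meson order.trans)
      next
        fix c' e' assume "c = rev_cell n c'" "c' \<in> ?S" "e = rev_cell n e'" "e' \<in> ?S"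
        then show ?thesis
          using chain(1)[of c' e'] comp by blast
      qed
      from this[of "(p, q)" "(p', q')" for p q p' q']
      show "q \<le> q'" if "(p, q) \<in> ?R" "(p', q') \<in> ?R" "p < p'" for p q p' q'
        using that unfolding fst_conv snd_conv by (meson leD)
    qed simp
    also have "\<dots> = 2 * (\<Sum>k=i..n. real (a k))"
      using sum_coeff[of i "Suc (2 * n) - i" n a] signed_ext_reverse[of i n "hw n a"] i
      by (simp add: signed_ext_def hw_apply)
    finally have "sum ?T ?S \<le> (\<Sum>k=i..n. real (a k))"
      by simp
    \<comment> \<open>If the end is also on the diagonal, \<open>path_boundC\<close> takes its other
      branch, whose upper limit is then \<open>n\<close> as well.\<close>
    moreover have "fst (last d) = n" if "snd (last d) = fst (last d) + 1"
      using True that by simp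
    ultimately show ?thesis
      by (auto simp: path_boundC_def i_def)
  next
    case False
    let ?m = "fst (last d)"
    have m: "snd (last d) = Suc ?m"
      using d False by (auto simp: dyck_pathC_def)
    then have "?m < n"
      using subsetD[OF d'(2) last] False by (auto simp: indexC_eq)
    \<comment> \<open>The coordinates only grow along the path and its end is strictly below the
      antidiagonal, so no coordinate is halved.\<close>
    have "sum ?T ?S = sum ?x ?S"
    proof (rule sum.cong[OF HOL.refl])
      fix c assume c: "c \<in> ?S"
      then have "fst c + snd c \<noteq> Suc (2 * n)"
        using chain(3,4)[OF c] m \<open>?m < n\<close> by simp
      then show "?T c = ?x c"
        using subsetD[OF d'(2) c] by (simp add: fold_map_def)
    qed
    also have "\<dots> \<le> sum (coeff n a) {i..<Suc ?m}"
    proof (rule sum_matching_point_chain_le[OF perm coeff_nonneg])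
      show "i \<le> p \<and> q \<le> Suc ?m" if "(p, q) \<in> ?S" for p q
        using chain(2,4)[OF that] m by (simp add: i_def)
      show "q \<le> q'" if "(p, q) \<in> ?S" "(p', q') \<in> ?S" "p < p'" for p q p' q'
        using chain(1)[OF that(1,2)] that(3) by auto
    qed simp
    also have "\<dots> = (\<Sum>k=i..?m. real (a k))"
      using \<open>?m < n\<close> by (intro sum.cong) (auto simp: coeff_def coeffA_def)
    finally show ?thesis
      using m by (simp add: path_boundC_def i_def)
  qed
qed

lemma fold_matching_point:
  fixes a :: "nat \<Rightarrow> nat"
  assumes \<sigma>: "\<sigma> \<in> signed_perms n"
  defines "x \<equiv> matching_point (2 * n) (coeff n a) \<sigma>"
  shows "fold_map n x \<in> lattice_pointsC n a" "unfold_map n (fold_map n x) = x"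
    "point_weight n a (fold_map n x) = perm_act n \<sigma> (hw n a)"
proof -
  show unf: "unfold_map n (fold_map n x) = x"
    unfolding x_def
    by (rule unfold_fold_map) (simp_all add: matching_point_outside matching_point_rev_cell[OF \<sigma>])
  show "point_weight n a (fold_map n x) = perm_act n \<sigma> (hw n a)"
    unfolding point_weight_eq_iff[OF \<sigma>] unf unfolding x_def
    using net_flow_matching_point[OF signed_permsD(1)[OF \<sigma>]] by blast
  have "0 \<le> fold_map n x c" for c
    using matching_point_nonneg[of "coeff n a" "2 * n" \<sigma> c] by (simp add: fold_map_def x_def coeff_nonneg)
  then have "fold_map n x \<in> polytopeC n a"
    unfolding polytopeC_def path_sum_def
    using fold_map_space fold_path_sum_le[OF \<sigma>] by (auto simp: x_def)
  moreover have "fold_map n x c \<in> \<int>" if c: "c \<in> indexC n" for c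
  proof (cases "fst c + snd c = Suc (2 * n)")
    case True
    then show ?thesis
      using matching_point_diagonal_int[OF \<sigma> c True] c by (simp add: fold_map_def x_def)
  next
    case False
    have "x c \<in> \<int>"
      unfolding x_def matching_point_def by (rule Ints_sum) (simp add: coeff_def)
    then show ?thesis
      using False by (simp add: fold_map_def)
  qed
  ultimately show "fold_map n x \<in> lattice_pointsC n a"
    by (simp add: lattice_pointsC_def)
qed

text \<open>A point of this weight unfolds to a feasible point of extremal weight, hence to the
  unique solution of the hook system, and unfolding is injective.\<close>

lemma extremal_point_perm_act:
  fixes a :: "nat \<Rightarrow> nat"
  assumes \<sigma>: "\<sigma> \<in> signed_perms n"
  defines "x \<equiv> matching_point (2 * n) (coeff n a) \<sigma>"
  shows "extremal_point n a (perm_act n \<sigma>) = fold_map n x"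
  unfolding extremal_point_def
proof (rule the_equality)
  note perm = signed_permsD(1)[OF \<sigma>]
  show "fold_map n x \<in> lattice_pointsC n a \<and> point_weight n a (fold_map n x) = perm_act n \<sigma> (hw n a)"
    using fold_matching_point[OF \<sigma>] by (simp add: x_def)
  fix T assume T: "T \<in> lattice_pointsC n a \<and> point_weight n a T = perm_act n \<sigma> (hw n a)"
  then have TP: "T \<in> polytopeC n a"
    by (simp add: lattice_pointsC_def)
  have "hook_point (coeff n a) (perm_cells (2 * n) \<sigma>) (unfold_map n T)"
    using T point_weight_eq_iff[OF \<sigma>]
    by (intro feasible_extremal_hook_point[OF perm feasible_unfold_map[OF TP]]) simp
  then have "unfold_map n T = x"
    unfolding x_def
    by (rule hook_point_unique[OF perm_cells_subset _ hook_point_matching_point[OF perm coeff_nonneg]])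
  also have "\<dots> = unfold_map n (fold_map n x)"
    unfolding x_def by (simp add: fold_matching_point(2)[OF \<sigma>])
  finally show "T = fold_map n x"
    using TP inj_onD[OF inj_on_unfold_map] fold_map_space by (auto simp: polytopeC_def)
qed

lemma unfold_map_convex:
  "unfold_map n ((1 - u) *\<^sub>R S + u *\<^sub>R T) c = (1 - u) * unfold_map n S c + u * unfold_map n T c"
  by (cases c) (auto simp: unfold_map_def algebra_simps)

lemma convex_combination_tight:
  fixes s t u B :: real
  assumes "s \<le> B" "t \<le> B" "0 < u" "u < 1" "(1 - u) * s + u * t = B"
  shows "s = B" "t = B"
proof -
  have "(1 - u) * (B - s) + u * (B - t) = 0"
    using assms(5) by (simp add: algebra_simps)
  moreover have "0 \<le> (1 - u) * (B - s)" "0 \<le> u * (B - t)"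
    using assms by simp_all
  ultimately have "(1 - u) * (B - s) = 0" "u * (B - t) = 0"
    by linarith+
  then show "s = B" "t = B"
    using assms by auto
qed

text \<open>The hook system consists of valid inequalities that are tight at the point. The ends of
  an open segment through it satisfy them with equality too, so both solve the system and
  coincide.\<close>

lemma fold_matching_point_extreme:
  fixes a :: "nat \<Rightarrow> nat"
  assumes \<sigma>: "\<sigma> \<in> signed_perms n"
  defines "x \<equiv> matching_point (2 * n) (coeff n a) \<sigma>"
  shows "fold_map n x extreme_point_of polytopeC n a"
  unfolding extreme_point_of_def
proof (intro conjI ballI notI)
  note perm = signed_permsD(1)[OF \<sigma>]
  let ?F = "perm_cells (2 * n) \<sigma>"
  show "fold_map n x \<in> polytopeC n a"
    using fold_matching_point(1)[OF \<sigma>] by (simp add: x_def lattice_pointsC_def)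
  fix S T assume S: "S \<in> polytopeC n a" and T: "T \<in> polytopeC n a" and "fold_map n x \<in> open_segment S T"
  then obtain u where "S \<noteq> T" and u: "0 < u" "u < 1" and eq: "fold_map n x = (1 - u) *\<^sub>R S + u *\<^sub>R T"
    by (auto simp: in_segment)
  have comb: "x c = (1 - u) * unfold_map n S c + u * unfold_map n T c" for c
    using fold_matching_point(2)[OF \<sigma>, of a] unfold_map_convex[of n u S T c] by (simp add: x_def[symmetric] eq)
  have hp: "hook_point (coeff n a) ?F x"
    unfolding x_def by (rule hook_point_matching_point[OF perm coeff_nonneg])
  note fS = feasible_unfold_map[OF S] and fT = feasible_unfold_map[OF T]
  have zero: "unfold_map n S c = 0 \<and> unfold_map n T c = 0" if "c \<notin> ?F" for c
  proof -
    \<comment> \<open>Nonnegativity enters as the upper bound zero for the negated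
      coordinates.\<close>
    have "(1 - u) * (- unfold_map n S c) + u * (- unfold_map n T c) = 0"
      using comb[of c] hp that by (cases c) (simp add: hook_point_def)
    moreover have "- unfold_map n S c \<le> 0" "- unfold_map n T c \<le> 0"
      using fS fT by (cases c, simp add: feasible_def)+
    ultimately show ?thesis
      using convex_combination_tight[of "- unfold_map n S c" 0 "- unfold_map n T c" u] u by simp
  qed
  have tight: "sum (unfold_map n S) (hook i j) = sum (coeff n a) {i..<j} \<and>
      sum (unfold_map n T) (hook i j) = sum (coeff n a) {i..<j}" if ij: "(i, j) \<in> ?F" for i j
  proof -
    have "(1 - u) * sum (unfold_map n S) (hook i j) + u * sum (unfold_map n T) (hook i j) = sum x (hook i j)"
      by (simp add: comb sum.distrib sum_distrib_left)
    also have "\<dots> = sum (coeff n a) {i..<j}"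
      using hp ij by (auto simp: hook_point_def)
    finally have eq: "(1 - u) * sum (unfold_map n S) (hook i j) + u * sum (unfold_map n T) (hook i j)
        = sum (coeff n a) {i..<j}" .
    have "(i, j) \<in> cells (2 * n)"
      using ij perm_cells_subset by blast
    then have "sum (unfold_map n S) (hook i j) \<le> sum (coeff n a) {i..<j}"
      "sum (unfold_map n T) (hook i j) \<le> sum (coeff n a) {i..<j}"
      using fS fT unfolding feasible_def by fast+
    from convex_combination_tight[OF this u eq] show ?thesis
      by blast
  qed
  have "unfold_map n S = unfold_map n T"
  proof (rule hook_point_unique[OF perm_cells_subset])
    show "hook_point (coeff n a) ?F (unfold_map n S)" "hook_point (coeff n a) ?F (unfold_map n T)"
      unfolding hook_point_def using zero tight by blast+
  qed
  then show False
    using \<open>S \<noteq> T\<close> S T inj_onD[OF inj_on_unfold_map, of n S T] by (simp add: polytopeC_def)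
qed

section \<open>Families of segments\<close>

definition segment_cells :: "nat \<Rightarrow> real set set \<Rightarrow> (nat \<times> nat) set" where
  "segment_cells n E = {(i, j) \<in> cells (2 * n). segment i j \<in> E}"

definition cell_segments :: "(nat \<times> nat) set \<Rightarrow> real set set" where
  "cell_segments F = (\<lambda>(i, j). segment i j) ` F"

lemma segment_eq_iff: "i < j \<Longrightarrow> segment i j = segment p q \<longleftrightarrow> p = i \<and> q = j"
  by (auto simp: segment_def)

lemma segment_cells_cell_segments:
  assumes "F \<subseteq> cells (2 * n)"
  shows "segment_cells n (cell_segments F) = F"
proof
  show "segment_cells n (cell_segments F) \<subseteq> F"
  proof
    fix c assume "c \<in> segment_cells n (cell_segments F)"
    then obtain i j p q where c: "c = (i, j)" "i < j" "(p, q) \<in> F" "segment i j = segment p q"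
      by (auto simp: segment_cells_def cell_segments_def cells_def)
    then show "c \<in> F"
      using segment_eq_iff[of i j p q] by simp
  qed
  show "F \<subseteq> segment_cells n (cell_segments F)"
    using assms by (force simp: segment_cells_def cell_segments_def)
qed

lemma cell_segments_segment_cells: "E \<subseteq> segments n \<Longrightarrow> cell_segments (segment_cells n E) = E"
  unfolding segment_cells_def cell_segments_def segments_def cells_def by force

lemma closed_segment_cells:
  assumes E: "E \<in> Rp n"
  shows "closed_cells (segment_cells n E)"
  unfolding closed_cells_def
proof (intro allI impI)
  fix i j i' j' assume c: "(i, j) \<in> segment_cells n E" "(i', j') \<in> segment_cells n E"
    and lt: "i < i'" "i' \<le> j" "j < j'"
  have eq: "segment i j \<inter> segment i' j' = segment i' j"
    using lt by (auto simp: segment_def)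
  have ne: "segment i' j \<noteq> {}"
    using lt by (auto simp: segment_def)
  have "segment i j \<in> E" "segment i' j' \<in> E"
    using c by (auto simp: segment_cells_def)
  moreover have "\<forall>A\<in>E. \<forall>B\<in>E. A \<inter> B \<noteq> {} \<longrightarrow> A \<inter> B \<in> E"
    using E by (simp add: Rp_def)
  ultimately have "segment i j \<inter> segment i' j' \<noteq> {} \<longrightarrow> segment i j \<inter> segment i' j' \<in> E"
    by blast
  then have mem: "segment i' j \<in> E"
    unfolding eq using ne by blast
  \<comment> \<open>Members of \<open>E\<close> are nondegenerate, which excludes
    \<open>i' = j\<close>.\<close>
  then have "segment i' j \<in> segments n"
    using E by (auto simp: Rp_def)
  then obtain p q where pq: "segment p q = segment i' j" "1 \<le> p" "p < q" "q \<le> 2 * n"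
    by (auto simp: segments_def)
  then have "i' = p" "j = q"
    using segment_eq_iff[of p q i' j] by auto
  then show "i' < j \<and> (i', j) \<in> segment_cells n E"
    using pq mem by (simp add: segment_cells_def cells_def)
qed

lemma cell_segments_Rp:
  assumes F: "closed_cells F" "F \<subseteq> cells (2 * n)"
  shows "cell_segments F \<in> Rp n"
  unfolding Rp_def
proof (intro CollectI conjI ballI impI)
  show "cell_segments F \<subseteq> segments n"
    using F(2) by (fastforce simp: cell_segments_def segments_def cells_def)
  fix A B assume "A \<in> cell_segments F" "B \<in> cell_segments F" and ne: "A \<inter> B \<noteq> {}"
  then obtain i j i' j' where A: "A = segment i j" "(i, j) \<in> F" and B: "B = segment i' j'" "(i', j') \<in> F"
    by (auto simp: cell_segments_def)
  have cross: "segment p q \<inter> segment p' q' \<in> cell_segments F"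
    if c: "(p, q) \<in> F" "(p', q') \<in> F" "p \<le> p'" "segment p q \<inter> segment p' q' \<noteq> {}" for p q p' q'
  proof -
    consider "q' \<le> q" | "p = p'" "q < q'" | "p < p'" "q < q'"
      using c(3) by linarith
    then show ?thesis
    proof cases
      case 1
      then have "segment p q \<inter> segment p' q' = segment p' q'"
        using c(3) by (auto simp: segment_def)
      then show ?thesis
        using c(2) by (force simp: cell_segments_def)
    next
      case 2
      then have "segment p q \<inter> segment p' q' = segment p q"
        by (auto simp: segment_def)
      then show ?thesis
        using c(1) by (force simp: cell_segments_def)
    next
      case 3
      have "p' \<le> q"
        using c(4) by (auto simp: segment_def)
      then have "(p', q) \<in> F"
        using F(1) c 3 unfolding closed_cells_def by blast
      moreover have "segment p q \<inter> segment p' q' = segment p' q"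
        using 3 by (auto simp: segment_def)
      ultimately show ?thesis
        by (force simp: cell_segments_def)
    qed
  qed
  show "A \<inter> B \<in> cell_segments F"
    using cross[OF A(2) B(2)] cross[OF B(2) A(2)] ne unfolding A B by (cases "i \<le> i'") (auto simp: Int_commute)
qed

lemma symmetric_family_iff:
  "symmetric_family n E \<longleftrightarrow>
    (\<forall>(i, j)\<in>cells (2 * n). (Suc (2 * n) - j, Suc (2 * n) - i) \<in> segment_cells n E \<longrightarrow> (i, j) \<in> segment_cells n E)"
proof -
  have "(Suc (2 * n) - j, Suc (2 * n) - i) \<in> cells (2 * n)" if "(i, j) \<in> cells (2 * n)" for i j
    using that unfolding cells_def by auto
  then have "(Suc (2 * n) - j, Suc (2 * n) - i) \<in> segment_cells n E \<longleftrightarrow>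
      segment (Suc (2 * n) - j) (Suc (2 * n) - i) \<in> E" "(i, j) \<in> segment_cells n E \<longleftrightarrow> segment i j \<in> E"
    if "(i, j) \<in> cells (2 * n)" for i j
    using that by (simp_all add: segment_cells_def)
  then show ?thesis
    unfolding symmetric_family_def by (fastforce simp: cells_def)
qed

lemma bij_betw_symmetric_families:
  "bij_betw (\<lambda>\<sigma>. cell_segments (perm_cells (2 * n) \<sigma>)) (signed_perms n) {E \<in> Rp n. symmetric_family n E}"
  unfolding bij_betw_def
proof (intro conjI inj_onI equalityI subsetI)
  fix \<sigma> \<tau> assume s: "\<sigma> \<in> signed_perms n" and t: "\<tau> \<in> signed_perms n"
    and "cell_segments (perm_cells (2 * n) \<sigma>) = cell_segments (perm_cells (2 * n) \<tau>)"
  then have "perm_cells (2 * n) \<sigma> = perm_cells (2 * n) \<tau>"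
    using segment_cells_cell_segments[OF perm_cells_subset] by metis
  then show "\<sigma> = \<tau>"
    using perm_cells_inj signed_permsD(1) s t by blast
next
  fix E assume "E \<in> (\<lambda>\<sigma>. cell_segments (perm_cells (2 * n) \<sigma>)) ` signed_perms n"
  then obtain \<sigma> where s: "\<sigma> \<in> signed_perms n" and E: "E = cell_segments (perm_cells (2 * n) \<sigma>)"
    by blast
  note perm = signed_permsD(1)[OF s]
  have "symmetric_family n E"
    unfolding symmetric_family_iff E segment_cells_cell_segments[OF perm_cells_subset]
    using rev_sym_iff_perm_cells[OF perm] signed_permsD(2)[OF s] by blast
  then show "E \<in> {E \<in> Rp n. symmetric_family n E}"
    using cell_segments_Rp[OF closed_perm_cells[OF perm] perm_cells_subset] E by simp
next
  fix E assume "E \<in> {E \<in> Rp n. symmetric_family n E}"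
  then have E: "E \<in> Rp n" "symmetric_family n E"
    by auto
  have sub: "segment_cells n E \<subseteq> cells (2 * n)"
    by (auto simp: segment_cells_def)
  obtain \<sigma> where \<sigma>: "\<sigma> permutes {1..2 * n}" "perm_cells (2 * n) \<sigma> = segment_cells n E"
    using closed_cells_permutation[OF closed_segment_cells[OF E(1)] sub] by blast
  have "rev_sym (2 * n) \<sigma>"
    using E(2) unfolding symmetric_family_iff \<sigma>(2)[symmetric] rev_sym_iff_perm_cells[OF \<sigma>(1)] .
  then have "\<sigma> \<in> signed_perms n"
    using \<sigma>(1) by (simp add: signed_perms_def)
  moreover have "E = cell_segments (perm_cells (2 * n) \<sigma>)"
    using cell_segments_segment_cells[of E n] E(1) \<sigma>(2) by (simp add: Rp_def)
  ultimately show "E \<in> (\<lambda>\<sigma>. cell_segments (perm_cells (2 * n) \<sigma>)) ` signed_perms n"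
    by blast
qed

text \<open>The description in \<open>family_point\<close> is the hook system of the cells: the
  matching point solves it, and triangularity leaves no other solution.\<close>

lemma family_point_eq:
  assumes \<sigma>: "\<sigma> \<in> signed_perms n"
  shows "family_point n a (cell_segments (perm_cells (2 * n) \<sigma>)) = matching_point (2 * n) (coeff n a) \<sigma>"
proof -
  let ?F = "perm_cells (2 * n) \<sigma>"
  have mem: "segment i j \<in> cell_segments ?F \<longleftrightarrow> (i, j) \<in> ?F" if "(i, j) \<in> cells (2 * n)" for i j
    using segment_cells_cell_segments[OF perm_cells_subset, of n \<sigma>] that by (auto simp: segment_cells_def)
  have iff: "(x \<in> spaceA n \<and> (\<forall>(i, j)\<in>indexA n.
       (segment i j \<notin> cell_segments ?F \<longrightarrow> x (i, j) = 0) \<and>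
       (segment i j \<in> cell_segments ?F \<longrightarrow>
          path_sum x (hook_path i j) = (\<Sum>k=i..<j. real (coeffA n a k))))) \<longleftrightarrow>
     hook_point (coeff n a) ?F x" (is "?l \<longleftrightarrow> ?r") for x
  proof -
    have ps: "path_sum x (hook_path i j) = sum x (hook i j)" if "(i, j) \<in> cells (2 * n)" for i j
      using that set_hook_path[of i j] by (simp add: path_sum_def cells_def)
    have "?l \<longleftrightarrow> (\<forall>c. c \<notin> cells (2 * n) \<longrightarrow> x c = 0) \<and>
        (\<forall>i j. (i, j) \<in> cells (2 * n) \<longrightarrow> ((i, j) \<notin> ?F \<longrightarrow> x (i, j) = 0) \<and>
          ((i, j) \<in> ?F \<longrightarrow> sum x (hook i j) = sum (coeff n a) {i..<j}))"
      unfolding spaceA_def indexA_eq_cells coeff_def using mem ps by auto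
    also have "\<dots> \<longleftrightarrow> ?r"
      using perm_cells_subset[of "2 * n" \<sigma>] unfolding hook_point_def by fastforce
    finally show ?thesis .
  qed
  have hp: "hook_point (coeff n a) ?F (matching_point (2 * n) (coeff n a) \<sigma>)"
    by (rule hook_point_matching_point[OF signed_permsD(1)[OF \<sigma>] coeff_nonneg])
  show ?thesis
    unfolding family_point_def iff
    using hp hook_point_unique[OF perm_cells_subset _ hp] by (rule the_equality)
qed

theorem theorem5p2:
  fixes n :: nat and a :: "nat \<Rightarrow> nat"
  assumes "1 \<le> n"
  shows "(\<forall>E\<in>Rp n. symmetric_family n E \<longrightarrow>
            family_point n a E \<in> unfold_map n ` polytopeC n a \<and>
            the_inv_into (spaceC n) (unfold_map n) (family_point n a E)
              extreme_point_of polytopeC n a)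
       \<and> (\<exists>\<Xi>. bij_betw \<Xi> {E \<in> Rp n. symmetric_family n E} (weyl_group n) \<and>
            (\<forall>E\<in>Rp n. symmetric_family n E \<longrightarrow>
               extremal_point n a (\<Xi> E)
                 = the_inv_into (spaceC n) (unfold_map n) (family_point n a E)))"
proof -
  let ?P = "\<lambda>\<sigma>. cell_segments (perm_cells (2 * n) \<sigma>)"
  let ?x = "\<lambda>\<sigma>. matching_point (2 * n) (coeff n a) \<sigma>"
  \<comment> \<open>The coefficients \<open>a\<close> do not occur here, so one bijection serves all
    weights \<lambda>.\<close>
  define \<theta> where "\<theta> = inv_into (signed_perms n) ?P"
  have \<theta>: "\<theta> E \<in> signed_perms n" "?P (\<theta> E) = E" if "E \<in> Rp n" "symmetric_family n E" for E
  proof -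
    have "E \<in> ?P ` signed_perms n"
      using bij_betw_imp_surj_on[OF bij_betw_symmetric_families[of n]] that by simp
    then show "\<theta> E \<in> signed_perms n" "?P (\<theta> E) = E"
      unfolding \<theta>_def by (rule inv_into_into, rule f_inv_into_f)
  qed
  have inv: "the_inv_into (spaceC n) (unfold_map n) (family_point n a E) = fold_map n (?x (\<theta> E))"
    if E: "E \<in> Rp n" "symmetric_family n E" for E
  proof -
    have "family_point n a E = unfold_map n (fold_map n (?x (\<theta> E)))"
      using family_point_eq[OF \<theta>(1)[OF E], of a] \<theta>(2)[OF E] fold_matching_point(2)[OF \<theta>(1)[OF E], of a]
      by simp
    then show ?thesis
      using the_inv_into_f_f[OF inj_on_unfold_map fold_map_space] by simp
  qed
  show ?thesis
  proof (intro conjI ballI impI exI)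
    fix E assume E: "E \<in> Rp n" "symmetric_family n E"
    show "family_point n a E \<in> unfold_map n ` polytopeC n a"
      using family_point_eq[OF \<theta>(1)[OF E], of a] \<theta>(2)[OF E] fold_matching_point(1,2)[OF \<theta>(1)[OF E], of a]
      by (intro image_eqI[of _ _ "fold_map n (?x (\<theta> E))"]) (auto simp: lattice_pointsC_def)
    show "the_inv_into (spaceC n) (unfold_map n) (family_point n a E) extreme_point_of polytopeC n a"
      unfolding inv[OF E] by (rule fold_matching_point_extreme[OF \<theta>(1)[OF E]])
    show "extremal_point n a ((perm_act n \<circ> \<theta>) E)
        = the_inv_into (spaceC n) (unfold_map n) (family_point n a E)"
      unfolding inv[OF E] using extremal_point_perm_act[OF \<theta>(1)[OF E]] by simp
  next
    show "bij_betw (perm_act n \<circ> \<theta>) {E \<in> Rp n. symmetric_family n E} (weyl_group n)"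
      unfolding \<theta>_def
      by (rule bij_betw_trans[OF bij_betw_inv_into[OF bij_betw_symmetric_families] bij_betw_perm_act])
  qed
qed

end
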